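(* Let $G$ be a character on $\mathbf{k}\langle\mathbf{a},\mathbf{b}\rangle$. Then the associated function $\widetilde g$ (the chain map of the second kind, regarded as a linear map on $\mathrm{QSym}$) is a Hopf algebra endomorphism of the Hopf algebra $\mathrm{QSym}$ of quasisymmetric functions.
   Context: Let $\mathbf{k}$ be a field and $\mathbf{k}\langle\mathbf{a},\mathbf{b}\rangle$ the algebra of polynomials in noncommuting variables $\mathbf{a},\mathbf{b}$ of degree $1$. For a finite graded poset $P$ (with $\widehat 0$, $\widehat 1$, rank function $\rho$, $\rho(x,y)=\rho(y)-\rho(x)$) of rank at least $1$, the $\mathbf{ab}$-index is $\Psi(P)=\sum_c (\mathbf{a}-\mathbf{b})^{\rho(x_0,x_1)-1}\cdot\mathbf{b}\cdot(\mathbf{a}-\mathbf{b})^{\rho(x_1,x_2)-1}\cdot\mathbf{b}\cdots\mathbf{b}\cdot(\mathbf{a}-\mathbf{b})^{\rho(x_{k-1},x_k)-1}$, summed over all chains $c=\{\widehat 0=x_0<\cdots<x_k=\widehat 1\}$. A character $G$ on $\mathbf{k}\langle\mathbf{a},\mathbf{b}\rangle$ is a linear functional $G:\mathbf{k}\langle\mathbf{a},\mathbf{b}\rangle\to\mathbf{k}$ with $G(\Psi(P\times Q))=G(\Psi(P))\cdot G(\Psi(Q))$ for all graded posets $P,Q$ of rank at least $1$, where $P\times Q$ is the Cartesian product. Coproduct: for a monomial $u_1\cdots u_n$, $\Delta(u_1\cdots u_n)=\sum_{i=1}^n u_1\cdots u_{i-1}\otimes u_{i+1}\cdots u_n$ (so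 $\Delta(1)=0$), extended linearly; it is coassociative. $\Delta^1=\mathrm{id}$, $\Delta^{k+1}=(\mathrm{id}\otimes\Delta^k)\circ\Delta$, with Sweedler notation $\Delta^k(u)=\sum_u u_{(1)}\otimes\cdots\otimes u_{(k)}$. For homogeneous $u$ let $\widehat g(u)=G(u)(\mathbf{a}-\mathbf{b})^{\deg u}$, extended linearly. The chain map of the second kind is $\widetilde g(u)=\sum_{k\ge1}\sum_u\widehat g(u_{(1)})\cdot\mathbf{b}\cdot\widehat g(u_{(2)})\cdot\mathbf{b}\cdots\mathbf{b}\cdot\widehat g(u_{(k)})$ (coproduct into $k$ parts). $\mathrm{QSym}$ is the algebra (over $\mathbf{k}$) of quasisymmetric functions in $t_1,t_2,\ldots$, with linear basis $M_{(p_1,\ldots,p_k)}=\sum_{i_1<\cdots<i_k}t_{i_1}^{p_1}\cdots t_{i_k}^{p_k}$ (all $p_i\ge1$, $k\ge 0$; the empty one is the unit $1_{\mathrm{QSym}}$), product of power series, coproduct $\Delta^{\mathrm{QSym}}(M_{(p_1,\ldots,p_k)})=\sum_{i=0}^k M_{(p_1,\ldots,p_i)}\otimes M_{(p_{i+1},\ldots,p_k)}$, and counit the constant term. The linear map $\gamma((\mathbf{a}-\mathbf{b})^{p_1-1}\cdot\mathbf{b}\cdots\mathbf{b}\cdot(\mathbf{a}-\mathbf{b})^{p_k-1})=M_{(p_1,\ldots,p_k)}$ is an isomorphism of $\mathbf{k}\langle\mathbf{a},\mathbf{b}\rangle$ onto quasisymmetric functions with no constant term. On $\mathrm{QSym}$,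 $\widetilde g$ denotes the linear map with $\widetilde g(1_{\mathrm{QSym}})=1_{\mathrm{QSym}}$ and $\widetilde g(f)=\gamma(\widetilde g(\gamma^{-1}(f)))$ for $f$ with no constant term. *)

theory Defs
  imports Complex_Main "HOL-Library.Poly_Mapping"
begin

section \<open>Linear extension from a basis\<close>

text \<open>
  A vector space with a chosen basis indexed by a type \<open>'w\<close> is the type of finitely supported
  functions \<open>'w \<Rightarrow>\<^sub>0 'k\<close>; the basis vector at \<open>w\<close> is \<open>Poly_Mapping.single w 1\<close>.
  Tensor products of such spaces are indexed by pairs (or lists) of indices.
\<close>

definition pm_scale :: "'k::field \<Rightarrow> ('w \<Rightarrow>\<^sub>0 'k) \<Rightarrow> ('w \<Rightarrow>\<^sub>0 'k)"
  where "pm_scale c = Poly_Mapping.map ((*) c)"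

definition lin_ext :: "('k::field \<Rightarrow> 'v \<Rightarrow> 'v) \<Rightarrow> ('w \<Rightarrow> 'v) \<Rightarrow> ('w \<Rightarrow>\<^sub>0 'k) \<Rightarrow> 'v::ab_group_add"
  where "lin_ext scale F u =
    (\<Sum>w\<in>Poly_Mapping.keys u. scale (Poly_Mapping.lookup u w) (F w))"

lemma lookup_pm_scale [simp]:
  "Poly_Mapping.lookup (pm_scale c u) w = c * Poly_Mapping.lookup u w"
  by (simp add: pm_scale_def Poly_Mapping.map.rep_eq when_def)

lemma vector_space_pm_scale: "vector_space pm_scale"
  by standard (auto intro!: poly_mapping_eqI simp: lookup_add algebra_simps)

lemma vector_space_mult: "vector_space ((*) :: 'k::field \<Rightarrow> 'k \<Rightarrow> 'k)"
  by standard (auto simp: algebra_simps)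

lemma lin_ext_superset:
  assumes "vector_space scale" "finite A" "Poly_Mapping.keys u \<subseteq> A"
  shows "lin_ext scale F u = (\<Sum>w\<in>A. scale (Poly_Mapping.lookup u w) (F w))"
proof -
  interpret vector_space scale by fact
  show ?thesis
    unfolding lin_ext_def using assms
    by (intro sum.mono_neutral_left) (auto simp: in_keys_iff)
qed

lemma linear_lin_ext:
  fixes scale :: "'k::field \<Rightarrow> 'v \<Rightarrow> 'v::ab_group_add" and F :: "'w \<Rightarrow> 'v"
  assumes "vector_space scale"
  shows "Vector_Spaces.linear pm_scale scale (lin_ext scale F)"
proof -
  interpret vector_space scale by fact
  interpret P: vector_space pm_scale by (rule vector_space_pm_scale)
  show ?thesis
  proof (unfold_locales)
    fix u v :: "'w \<Rightarrow>\<^sub>0 'k"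
    let ?A = "Poly_Mapping.keys u \<union> Poly_Mapping.keys v"
    have "Poly_Mapping.keys (u + v) \<subseteq> ?A" by (rule Poly_Mapping.keys_add)
    then show "lin_ext scale F (u + v) = lin_ext scale F u + lin_ext scale F v"
      by (simp add: lin_ext_superset[OF assms, of ?A] lookup_add scale_left_distrib sum.distrib)
  next
    fix c and u :: "'w \<Rightarrow>\<^sub>0 'k"
    have "Poly_Mapping.keys (pm_scale c u) \<subseteq> Poly_Mapping.keys u"
      by (auto simp: in_keys_iff)
    then show "lin_ext scale F (pm_scale c u) = scale c (lin_ext scale F u)"
      by (simp add: lin_ext_superset[OF assms, of "Poly_Mapping.keys u"] scale_sum_right)
  qed
qed

lemma lin_ext_single [simp]:
  assumes "vector_space scale"
  shows "lin_ext scale F (Poly_Mapping.single w 1) = F w"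
proof -
  interpret vector_space scale by fact
  show ?thesis by (simp add: lin_ext_def)
qed


section \<open>The algebra of noncommutative polynomials in a and b\<close>

text \<open>Words form a monoid under concatenation (written additively, as \<open>Poly_Mapping\<close> expects);
  the product of \<open>'k ab_poly\<close> is then the product of noncommutative polynomials.\<close>

instantiation list :: (type) monoid_add
begin
definition zero_list :: "'a list" where "zero_list = []"
definition plus_list :: "'a list \<Rightarrow> 'a list \<Rightarrow> 'a list" where "plus_list = (@)"
instance by standard (auto simp: zero_list_def plus_list_def)
end

datatype letter = LA | LB

type_synonym 'k ab_poly = "letter list \<Rightarrow>\<^sub>0 'k"

abbreviation ab_word :: "letter list \<Rightarrow> 'k::field ab_poly"
  where "ab_word w \<equiv> Poly_Mapping.single w 1"

abbreviation ab_a :: "'k::field ab_poly" where "ab_a \<equiv> ab_word [LA]"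
abbreviation ab_b :: "'k::field ab_poly" where "ab_b \<equiv> ab_word [LB]"

text \<open>\<open>bjoin [u\<^sub>1, \<dots>, u\<^sub>k] = u\<^sub>1 \<cdot> b \<cdot> u\<^sub>2 \<cdot> b \<cdots> b \<cdot> u\<^sub>k\<close>; the value on \<open>[]\<close> is never used.\<close>

fun bjoin :: "'k::field ab_poly list \<Rightarrow> 'k ab_poly" where
  "bjoin [] = 1"
| "bjoin [u] = u"
| "bjoin (u # v # us) = u * ab_b * bjoin (v # us)"


section \<open>Graded posets and the ab-index\<close>

text \<open>A poset is given by a carrier and an order relation as in \<^const>\<open>partial_order_on\<close>.\<close>

definition poset_bot :: "'a set \<Rightarrow> 'a rel \<Rightarrow> 'a"
  where "poset_bot A r = (THE z. z \<in> A \<and> (\<forall>x\<in>A. (z, x) \<in> r))"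

definition poset_top :: "'a set \<Rightarrow> 'a rel \<Rightarrow> 'a"
  where "poset_top A r = (THE z. z \<in> A \<and> (\<forall>x\<in>A. (x, z) \<in> r))"

definition poset_covers :: "'a set \<Rightarrow> 'a rel \<Rightarrow> 'a \<Rightarrow> 'a \<Rightarrow> bool"
  where "poset_covers A r x y \<longleftrightarrow> x \<in> A \<and> y \<in> A \<and> (x, y) \<in> r \<and> x \<noteq> y \<and>
    \<not> (\<exists>z\<in>A. z \<noteq> x \<and> z \<noteq> y \<and> (x, z) \<in> r \<and> (z, y) \<in> r)"

definition rank_function :: "'a set \<Rightarrow> 'a rel \<Rightarrow> ('a \<Rightarrow> nat) \<Rightarrow> bool"
  where "rank_function A r \<rho> \<longleftrightarrow> \<rho> (poset_bot A r) = 0 \<and>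
    (\<forall>x y. poset_covers A r x y \<longrightarrow> \<rho> y = \<rho> x + 1)"

definition graded_poset :: "'a set \<Rightarrow> 'a rel \<Rightarrow> bool"
  where "graded_poset A r \<longleftrightarrow> finite A \<and> partial_order_on A r \<and>
    (\<exists>z\<in>A. \<forall>x\<in>A. (z, x) \<in> r) \<and> (\<exists>z\<in>A. \<forall>x\<in>A. (x, z) \<in> r) \<and>
    (\<exists>\<rho>. rank_function A r \<rho>)"

text \<open>For a graded poset the rank function is unique on the carrier, so the choice is immaterial.\<close>

definition poset_rank :: "'a set \<Rightarrow> 'a rel \<Rightarrow> 'a \<Rightarrow> nat"
  where "poset_rank A r = (SOME \<rho>. rank_function A r \<rho>)"

definition total_rank :: "'a set \<Rightarrow> 'a rel \<Rightarrow> nat"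
  where "total_rank A r = poset_rank A r (poset_top A r)"

definition prod_rel :: "'a rel \<Rightarrow> 'b rel \<Rightarrow> ('a \<times> 'b) rel"
  where "prod_rel r s = {((x, y), (x', y')). (x, x') \<in> r \<and> (y, y') \<in> s}"

text \<open>Chains from bottom to top, listed increasingly.\<close>

definition full_chains :: "'a set \<Rightarrow> 'a rel \<Rightarrow> 'a list set"
  where "full_chains A r = {xs. xs \<noteq> [] \<and> set xs \<subseteq> A \<and>
    sorted_wrt (\<lambda>x y. (x, y) \<in> r \<and> x \<noteq> y) xs \<and>
    hd xs = poset_bot A r \<and> last xs = poset_top A r}"

definition ab_index :: "'a set \<Rightarrow> 'a rel \<Rightarrow> 'k::field ab_poly"
  where "ab_index A r = (\<Sum>xs\<in>full_chains A r.
    bjoin (map2 (\<lambda>x y. (ab_a - ab_b) ^ (poset_rank A r y - poset_rank A r x - 1)) xs (tl xs)))"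

text \<open>Quantifying over posets carried by sets of natural numbers is no restriction: every finite
  poset is isomorphic to such a poset, and \<^const>\<open>ab_index\<close> is invariant under isomorphism.\<close>

definition ab_character :: "('k::field ab_poly \<Rightarrow> 'k) \<Rightarrow> bool"
  where "ab_character G \<longleftrightarrow> Vector_Spaces.linear pm_scale (*) G \<and>
    (\<forall>(A :: nat set) r (B :: nat set) s.
       graded_poset A r \<and> total_rank A r \<ge> 1 \<and> graded_poset B s \<and> total_rank B s \<ge> 1 \<longrightarrow>
       G (ab_index (A \<times> B) (prod_rel r s)) = G (ab_index A r) * G (ab_index B s))"


section \<open>Coproduct and the chain map of the second kind\<close>

definition ab_coprod :: "'k::field ab_poly \<Rightarrow> (letter list \<times> letter list \<Rightarrow>\<^sub>0 'k)"
  where "ab_coprod = lin_ext pm_scale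
    (\<lambda>w. \<Sum>i<length w. Poly_Mapping.single (take i w, drop (Suc i) w) 1)"

text \<open>\<open>ab_coprod_iter n\<close> is \<open>\<Delta>\<^sup>k\<close> for \<open>k = n + 1\<close>, the coproduct into \<open>k\<close> parts.\<close>

primrec ab_coprod_iter :: "nat \<Rightarrow> 'k::field ab_poly \<Rightarrow> (letter list list \<Rightarrow>\<^sub>0 'k)" where
  "ab_coprod_iter 0 u = lin_ext pm_scale (\<lambda>w. Poly_Mapping.single [w] 1) u"
| "ab_coprod_iter (Suc n) u = lin_ext pm_scale
     (\<lambda>(v, w). lin_ext pm_scale (\<lambda>ws. Poly_Mapping.single (v # ws) 1)
        (ab_coprod_iter n (ab_word w)))
     (ab_coprod u)"

definition ab_hat :: "('k::field ab_poly \<Rightarrow> 'k) \<Rightarrow> 'k ab_poly \<Rightarrow> 'k ab_poly"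
  where "ab_hat G = lin_ext pm_scale (\<lambda>w. pm_scale (G (ab_word w)) ((ab_a - ab_b) ^ length w))"

text \<open>For each \<open>u\<close> only finitely many summands are nonzero, since \<open>\<Delta>\<^sup>k\<close> vanishes on words of
  length less than \<open>k - 1\<close>.\<close>

definition chain_map2 :: "('k::field ab_poly \<Rightarrow> 'k) \<Rightarrow> 'k ab_poly \<Rightarrow> 'k ab_poly"
  where "chain_map2 G u = Sum_any (\<lambda>n.
    lin_ext pm_scale (\<lambda>ws. bjoin (map (\<lambda>w. ab_hat G (ab_word w)) ws)) (ab_coprod_iter n u))"


section \<open>Quasisymmetric functions\<close>

text \<open>Variables are indexed from \<open>0\<close>. A monomial is its exponent vector \<open>nat \<Rightarrow>\<^sub>0 nat\<close>; a formal power series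
  is its coefficient function. \<open>expseq\<close> lists the nonzero exponents of a monomial in the order of
  the variables: the monomials with \<open>expseq m = [p\<^sub>1, \<dots>, p\<^sub>k]\<close> are exactly those occurring in
  the monomial quasisymmetric function of the composition \<open>(p\<^sub>1, \<dots>, p\<^sub>k)\<close>. A power series is
  quasisymmetric iff it has bounded degree and its coefficients depend only on \<open>expseq\<close>.\<close>

definition expseq :: "(nat \<Rightarrow>\<^sub>0 nat) \<Rightarrow> nat list"
  where "expseq m = map (Poly_Mapping.lookup m) (sorted_list_of_set (Poly_Mapping.keys m))"

definition mdegree :: "(nat \<Rightarrow>\<^sub>0 nat) \<Rightarrow> nat"
  where "mdegree m = (\<Sum>i\<in>Poly_Mapping.keys m. Poly_Mapping.lookup m i)"

typedef (overloaded) 'k qsym = "{f :: (nat \<Rightarrow>\<^sub>0 nat) \<Rightarrow> 'k::field.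
    (\<exists>d. \<forall>m. f m \<noteq> 0 \<longrightarrow> mdegree m \<le> d) \<and>
    (\<forall>m m'. expseq m = expseq m' \<longrightarrow> f m = f m')}"
  morphisms qcoeff Abs_qsym
  by (rule exI[of _ "\<lambda>_. 0"]) auto

setup_lifting type_definition_qsym

lemma qsym_eqI: "(\<And>m. qcoeff f m = qcoeff g m) \<Longrightarrow> f = g"
  by (simp add: qcoeff_inject[symmetric] fun_eq_iff)

lemma qcoeff_cong: "expseq m = expseq m' \<Longrightarrow> qcoeff f m = qcoeff f m'"
  using qcoeff[of f] by blast

lemma sum_list_expseq: "sum_list (expseq m) = mdegree m"
  by (simp add: expseq_def mdegree_def sum_list_distinct_conv_sum_set)

lemma mdegree_superset:
  assumes "finite A" "Poly_Mapping.keys m \<subseteq> A"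
  shows "mdegree m = (\<Sum>i\<in>A. Poly_Mapping.lookup m i)"
  unfolding mdegree_def using assms
  by (intro sum.mono_neutral_left) (auto simp: in_keys_iff)

lemma mdegree_add: "mdegree (a + b) = mdegree a + mdegree b"
proof -
  let ?A = "Poly_Mapping.keys a \<union> Poly_Mapping.keys b"
  have "Poly_Mapping.keys (a + b) \<subseteq> ?A" by (rule Poly_Mapping.keys_add)
  then show ?thesis
    by (simp add: mdegree_superset[of ?A] lookup_add sum.distrib)
qed

lemma expseq_eq_Nil_iff: "expseq m = [] \<longleftrightarrow> m = 0"
  by (simp add: expseq_def)

text \<open>The monomial with exponents \<open>e\<close> at the variables \<open>ks\<close>.\<close>

lift_definition mono_at :: "nat list \<Rightarrow> nat list \<Rightarrow> (nat \<Rightarrow>\<^sub>0 nat)"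
  is "\<lambda>ks e i. case map_of (zip ks e) i of None \<Rightarrow> 0 | Some x \<Rightarrow> x"
proof -
  fix ks e :: "nat list"
  have "{i. (case map_of (zip ks e) i of None \<Rightarrow> 0 | Some x \<Rightarrow> x) \<noteq> 0} \<subseteq> dom (map_of (zip ks e))"
    by (auto split: option.splits)
  then show "finite {i. (case map_of (zip ks e) i of None \<Rightarrow> 0 | Some x \<Rightarrow> x) \<noteq> 0}"
    by (rule finite_subset) (simp add: finite_dom_map_of)
qed

lemma lookup_mono_at_nth:
  assumes "distinct ks" "length e = length ks" "j < length ks"
  shows "Poly_Mapping.lookup (mono_at ks e) (ks ! j) = e ! j"
proof -
  have "map_of (zip ks e) (ks ! j) = Some (e ! j)"
    using assms by (intro map_of_zip_nth) auto
  then show ?thesis by (simp add: mono_at.rep_eq)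
qed

lemma lookup_mono_at_notin:
  assumes "length e = length ks" "i \<notin> set ks"
  shows "Poly_Mapping.lookup (mono_at ks e) i = 0"
proof -
  have "map_of (zip ks e) i = None"
    using assms by (simp add: map_of_zip_is_None)
  then show ?thesis by (simp add: mono_at.rep_eq)
qed

lemma mono_at_eqI:
  assumes "distinct ks" "Poly_Mapping.keys m \<subseteq> set ks"
  shows "mono_at ks (map (Poly_Mapping.lookup m) ks) = m"
proof (rule poly_mapping_eqI)
  fix i
  show "Poly_Mapping.lookup (mono_at ks (map (Poly_Mapping.lookup m) ks)) i
      = Poly_Mapping.lookup m i"
  proof (cases "i \<in> set ks")
    case True
    then obtain j where "j < length ks" "i = ks ! j" by (auto simp: in_set_conv_nth)
    then show ?thesis using assms by (simp add: lookup_mono_at_nth)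
  next
    case False
    then have "i \<notin> Poly_Mapping.keys m" using assms by auto
    then show ?thesis using False by (simp add: lookup_mono_at_notin in_keys_iff)
  qed
qed

lemma expseq_mono_at:
  assumes ks: "sorted_wrt (<) ks" and len: "length e = length ks"
  shows "expseq (mono_at ks e) = filter (\<lambda>x. x \<noteq> 0) e"
proof -
  let ?L = "filter (\<lambda>(k, x). x \<noteq> 0) (zip ks e)"
  have dist: "distinct ks" using ks by (simp add: strict_sorted_iff)
  have mem: "Poly_Mapping.lookup (mono_at ks e) k = x" if "(k, x) \<in> set (zip ks e)" for k x
    using that dist len by (auto simp: set_zip lookup_mono_at_nth)
  have keys: "Poly_Mapping.keys (mono_at ks e) = fst ` set ?L"
  proof (intro equalityI subsetI)
    fix k assume k: "k \<in> Poly_Mapping.keys (mono_at ks e)"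
    then have "k \<in> set ks" using len lookup_mono_at_notin[of e ks k] by (auto simp: in_keys_iff)
    then obtain j where j: "j < length ks" "k = ks ! j" by (auto simp: in_set_conv_nth)
    then have "(k, e ! j) \<in> set (zip ks e)" using len by (auto simp: set_zip)
    moreover have "e ! j \<noteq> 0" using k j dist len by (simp add: in_keys_iff lookup_mono_at_nth)
    ultimately show "k \<in> fst ` set ?L" by force
  next
    fix k assume "k \<in> fst ` set ?L"
    then show "k \<in> Poly_Mapping.keys (mono_at ks e)"
      using mem by (auto simp: in_keys_iff)
  qed
  have srt: "sorted_wrt (<) (map fst ?L)"
  proof -
    have "sorted_wrt (<) (map fst (zip ks e))" using ks len by simp
    then have "sorted_wrt (\<lambda>p q. fst p < fst q) (zip ks e)" by (simp add: sorted_wrt_map)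
    then have "sorted_wrt (\<lambda>p q. fst p < fst q) ?L" by (rule sorted_wrt_filter)
    then show ?thesis by (simp add: sorted_wrt_map)
  qed
  have "sorted_list_of_set (Poly_Mapping.keys (mono_at ks e)) = map fst ?L"
  proof -
    have "sorted_list_of_set (set (map fst ?L)) = map fst ?L"
      using srt by (metis strict_sorted_iff sorted_list_of_set.idem_if_sorted_distinct)
    then show ?thesis by (simp add: keys)
  qed
  then have "expseq (mono_at ks e) = map (Poly_Mapping.lookup (mono_at ks e)) (map fst ?L)"
    by (simp add: expseq_def)
  also have "\<dots> = map snd ?L"
    using mem by auto
  also have "\<dots> = filter (\<lambda>x. x \<noteq> 0) (map snd (zip ks e))"
    by (simp add: filter_map o_def case_prod_unfold)
  also have "\<dots> = filter (\<lambda>x. x \<noteq> 0) e" using len by simp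
  finally show ?thesis .
qed

text \<open>\<open>Poly_Mapping.nth p\<close> is the monomial with exponents \<open>p\<close> at the first variables.\<close>

lemma expseq_nth:
  assumes "0 \<notin> set p"
  shows "expseq (Poly_Mapping.nth p) = p"
proof -
  have "Poly_Mapping.nth p = mono_at [0..<length p] p"
  proof (rule poly_mapping_eqI)
    fix i
    show "Poly_Mapping.lookup (Poly_Mapping.nth p) i
        = Poly_Mapping.lookup (mono_at [0..<length p] p) i"
      using lookup_mono_at_nth[of "[0..<length p]" p i]
        lookup_mono_at_notin[of p "[0..<length p]" i]
      by (cases "i < length p") (auto simp: nth_default_def)
  qed
  then show ?thesis using assms by (auto simp: expseq_mono_at filter_id_conv intro!: gr0I)
qed

lemma zero_notin_expseq: "0 \<notin> set (expseq m)"
  by (auto simp: expseq_def in_keys_iff)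

subsection \<open>Vector space and algebra structure\<close>

definition msplits :: "(nat \<Rightarrow>\<^sub>0 nat) \<Rightarrow> ((nat \<Rightarrow>\<^sub>0 nat) \<times> (nat \<Rightarrow>\<^sub>0 nat)) set"
  where "msplits m = {(a, b). a + b = m}"

text \<open>Transport of factorizations: with \<open>ks\<close> the variables of \<open>m\<close>, the factorizations of \<open>m\<close>
  correspond to the coordinatewise splittings of \<open>expseq m\<close>.\<close>

definition esplits :: "nat list \<Rightarrow> (nat list \<times> nat list) set"
  where "esplits p = {(x, y). length x = length p \<and> length y = length p \<and> map2 (+) x y = p}"

lemma finite_esplits: "finite (esplits p)"
proof -
  let ?F = "{x. set x \<subseteq> {..sum_list p} \<and> length x = length p}"
  have *: "z \<le> sum_list p" if "x \<in> {x. length x = length p}" "map2 (+) x y = p"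
    "length y = length p" "z \<in> set x" for x y z
  proof -
    from that obtain j where j: "j < length p" "z = x ! j" by (auto simp: in_set_conv_nth)
    have "p ! j = x ! j + y ! j"
      using that j by (metis (no_types, lifting) length_map length_zip mem_Collect_eq min_less_iff_conj nth_map nth_zip case_prod_conv)
    moreover have "p ! j \<le> sum_list p" using j by (simp add: elem_le_sum_list)
    ultimately show ?thesis using j by simp
  qed
  have **: "map2 (+) y x = map2 (+) x y" if "length x = length y" for x y :: "nat list"
    using that by (intro nth_equalityI) auto
  have "esplits p \<subseteq> ?F \<times> ?F"
  proof
    fix z assume "z \<in> esplits p"
    then obtain x y where z: "z = (x, y)" "length x = length p" "length y = length p"
      "map2 (+) x y = p" by (auto simp: esplits_def)
    then show "z \<in> ?F \<times> ?F"
      using *[of x y] *[of y x] **[of x y] by auto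
  qed
  moreover have "finite ?F" by (rule finite_lists_length_eq) simp
  ultimately show ?thesis by (meson finite_SigmaI finite_subset)
qed

lemma bij_betw_esplits:
  assumes ks: "sorted_wrt (<) ks" "set ks = Poly_Mapping.keys m"
  shows "bij_betw (\<lambda>(x, y). (mono_at ks x, mono_at ks y))
    (esplits (map (Poly_Mapping.lookup m) ks)) (msplits m)"
proof -
  let ?p = "map (Poly_Mapping.lookup m) ks"
  let ?g = "\<lambda>(a, b). (map (Poly_Mapping.lookup a) ks, map (Poly_Mapping.lookup b) ks)"
  have dist: "distinct ks" using ks by (simp add: strict_sorted_iff)
  have inv: "map (Poly_Mapping.lookup (mono_at ks x)) ks = x" if "length x = length ks" for x
    using that dist by (intro nth_equalityI) (auto simp: lookup_mono_at_nth)
  have sub: "Poly_Mapping.keys a \<subseteq> set ks \<and> Poly_Mapping.keys b \<subseteq> set ks" if "a + b = m" for a b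
    unfolding ks(2) that[symmetric] by (auto simp: in_keys_iff lookup_add)
  show ?thesis
  proof (rule bij_betw_byWitness[where f' = ?g])
    show "\<forall>z\<in>esplits ?p. ?g ((\<lambda>(x, y). (mono_at ks x, mono_at ks y)) z) = z"
      by (auto simp: esplits_def inv)
    show "\<forall>z\<in>msplits m. (\<lambda>(x, y). (mono_at ks x, mono_at ks y)) (?g z) = z"
      using dist sub by (auto simp: msplits_def mono_at_eqI)
    show "(\<lambda>(x, y). (mono_at ks x, mono_at ks y)) ` esplits ?p \<subseteq> msplits m"
    proof clarsimp
      fix x y assume "(x, y) \<in> esplits ?p"
      then have len: "length x = length ks" "length y = length ks"
        and eq: "map2 (+) x y = ?p" by (auto simp: esplits_def)
      have "mono_at ks x + mono_at ks y = m"
      proof (rule poly_mapping_eqI)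
        fix i
        show "Poly_Mapping.lookup (mono_at ks x + mono_at ks y) i = Poly_Mapping.lookup m i"
        proof (cases "i \<in> set ks")
          case True
          then obtain j where j: "j < length ks" "i = ks ! j" by (auto simp: in_set_conv_nth)
          have "map2 (+) x y ! j = ?p ! j" by (simp add: eq)
          then have "x ! j + y ! j = Poly_Mapping.lookup m i" using j len by simp
          then show ?thesis using j len dist by (simp add: lookup_add lookup_mono_at_nth)
        next
          case False
          moreover have "Poly_Mapping.lookup m i = 0"
            using False ks(2) by (simp add: in_keys_iff)
          ultimately show ?thesis using len by (simp add: lookup_add lookup_mono_at_notin)
        qed
      qed
      then show "(mono_at ks x, mono_at ks y) \<in> msplits m" by (simp add: msplits_def)
    qed
    show "?g ` msplits m \<subseteq> esplits ?p"
      by (auto simp: msplits_def esplits_def lookup_add intro!: nth_equalityI)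
  qed
qed

lemma finite_msplits: "finite (msplits m)"
  using bij_betw_finite[OF bij_betw_esplits[of "sorted_list_of_set (Poly_Mapping.keys m)" m]]
  by (simp add: finite_esplits)

lemma sum_msplits_cong:
  fixes f g :: "(nat \<Rightarrow>\<^sub>0 nat) \<Rightarrow> 'k::field"
  assumes f: "\<And>m m'. expseq m = expseq m' \<Longrightarrow> f m = f m'"
    and g: "\<And>m m'. expseq m = expseq m' \<Longrightarrow> g m = g m'"
    and eq: "expseq m = expseq m'"
  shows "(\<Sum>(a, b)\<in>msplits m. f a * g b) = (\<Sum>(a, b)\<in>msplits m'. f a * g b)"
proof -
  define ks where "ks n = sorted_list_of_set (Poly_Mapping.keys (n :: nat \<Rightarrow>\<^sub>0 nat))" for n
  have ks: "sorted_wrt (<) (ks n)" "set (ks n) = Poly_Mapping.keys n"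
    "map (Poly_Mapping.lookup n) (ks n) = expseq n" for n
    by (simp_all add: ks_def expseq_def)
  have len: "length (ks m) = length (ks m')"
    using arg_cong[OF eq, of length] by (simp add: expseq_def ks_def)
  have len': "length (ks m) = length (expseq m)" by (simp add: expseq_def ks_def)
  have *: "(\<Sum>(a, b)\<in>msplits n. f a * g b)
      = (\<Sum>(x, y)\<in>esplits (expseq n). f (mono_at (ks n) x) * g (mono_at (ks n) y))" for n
    using sum.reindex_bij_betw[OF bij_betw_esplits[OF ks(1,2)[of n]], of "\<lambda>(a, b). f a * g b"]
    by (simp add: ks(3) case_prod_unfold)
  show ?thesis unfolding * eq
  proof (rule sum.cong[OF refl], clarsimp)
    fix x y assume "(x, y) \<in> esplits (expseq m')"
    then have "length x = length (ks m)" "length y = length (ks m)"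
      using len' eq by (auto simp: esplits_def)
    then have "expseq (mono_at (ks m) x) = expseq (mono_at (ks m') x)"
      "expseq (mono_at (ks m) y) = expseq (mono_at (ks m') y)"
      using ks(1) len by (simp_all add: expseq_mono_at)
    then show "f (mono_at (ks m) x) * g (mono_at (ks m) y)
        = f (mono_at (ks m') x) * g (mono_at (ks m') y)"
      using f g by metis
  qed
qed

instantiation qsym :: (field) ab_group_add
begin

lift_definition zero_qsym :: "'a qsym" is "\<lambda>_. 0" by auto

lift_definition plus_qsym :: "'a qsym \<Rightarrow> 'a qsym \<Rightarrow> 'a qsym" is "\<lambda>f g m. f m + g m"
proof (intro conjI)
  fix f g :: "(nat \<Rightarrow>\<^sub>0 nat) \<Rightarrow> 'a"
  assume f: "(\<exists>d. \<forall>m. f m \<noteq> 0 \<longrightarrow> mdegree m \<le> d) \<and>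
      (\<forall>m m'. expseq m = expseq m' \<longrightarrow> f m = f m')"
    and g: "(\<exists>d. \<forall>m. g m \<noteq> 0 \<longrightarrow> mdegree m \<le> d) \<and>
      (\<forall>m m'. expseq m = expseq m' \<longrightarrow> g m = g m')"
  from f g obtain d d' where "\<forall>m. f m \<noteq> 0 \<longrightarrow> mdegree m \<le> d" "\<forall>m. g m \<noteq> 0 \<longrightarrow> mdegree m \<le> d'"
    by blast
  then have "\<forall>m. f m + g m \<noteq> 0 \<longrightarrow> mdegree m \<le> max d d'"
    by (metis add.left_neutral le_max_iff_disj)
  then show "\<exists>d. \<forall>m. f m + g m \<noteq> 0 \<longrightarrow> mdegree m \<le> d" by blast
  show "\<forall>m m'. expseq m = expseq m' \<longrightarrow> f m + g m = f m' + g m'"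
    using f g by metis
qed

lift_definition uminus_qsym :: "'a qsym \<Rightarrow> 'a qsym" is "\<lambda>f m. - f m"
  by (metis neg_equal_0_iff_equal)

definition minus_qsym :: "'a qsym \<Rightarrow> 'a qsym \<Rightarrow> 'a qsym" where "minus_qsym f g = f + - g"

instance
  by standard (rule qsym_eqI; simp add: plus_qsym.rep_eq uminus_qsym.rep_eq zero_qsym.rep_eq
      minus_qsym_def)+

end

lift_definition qscale :: "'k::field \<Rightarrow> 'k qsym \<Rightarrow> 'k qsym" is "\<lambda>c f m. c * f m"
  by (metis mult_zero_right)

lemma vector_space_qscale: "vector_space qscale"
  by standard (rule qsym_eqI; simp add: plus_qsym.rep_eq qscale.rep_eq algebra_simps)+

instantiation qsym :: (field) comm_ring_1
begin

lift_definition one_qsym :: "'a qsym" is "\<lambda>m. if m = 0 then 1 else 0"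
proof (intro conjI)
  show "\<exists>d. \<forall>m::nat \<Rightarrow>\<^sub>0 nat. (if m = 0 then 1 else 0::'a) \<noteq> 0 \<longrightarrow> mdegree m \<le> d"
    by (rule exI[of _ "mdegree 0"]) auto
  show "\<forall>m m'. expseq m = expseq m' \<longrightarrow> (if m = 0 then 1 else 0::'a) = (if m' = 0 then 1 else 0)"
    by (metis expseq_eq_Nil_iff)
qed

text \<open>The product of power series.\<close>

lift_definition times_qsym :: "'a qsym \<Rightarrow> 'a qsym \<Rightarrow> 'a qsym"
  is "\<lambda>f g m. \<Sum>(a, b)\<in>msplits m. f a * g b"
proof (intro conjI)
  fix f g :: "(nat \<Rightarrow>\<^sub>0 nat) \<Rightarrow> 'a"
  assume f: "(\<exists>d. \<forall>m. f m \<noteq> 0 \<longrightarrow> mdegree m \<le> d) \<and>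
      (\<forall>m m'. expseq m = expseq m' \<longrightarrow> f m = f m')"
    and g: "(\<exists>d. \<forall>m. g m \<noteq> 0 \<longrightarrow> mdegree m \<le> d) \<and>
      (\<forall>m m'. expseq m = expseq m' \<longrightarrow> g m = g m')"
  from f g obtain d d' where d: "\<And>m. f m \<noteq> 0 \<Longrightarrow> mdegree m \<le> d" "\<And>m. g m \<noteq> 0 \<Longrightarrow> mdegree m \<le> d'"
    by blast
  have "mdegree m \<le> d + d'" if "(\<Sum>(a, b)\<in>msplits m. f a * g b) \<noteq> 0" for m
  proof -
    from that obtain a b where "(a, b) \<in> msplits m" "f a * g b \<noteq> 0"
      by (metis (no_types, lifting) case_prodE old.prod.case sum.not_neutral_contains_not_neutral surj_pair)
    then have "m = a + b" "f a \<noteq> 0" "g b \<noteq> 0" by (auto simp: msplits_def)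
    then show ?thesis using d[of a] d[of b] by (simp add: mdegree_add add_mono)
  qed
  then show "\<exists>d. \<forall>m. (\<Sum>(a, b)\<in>msplits m. f a * g b) \<noteq> 0 \<longrightarrow> mdegree m \<le> d" by blast
  show "\<forall>m m'. expseq m = expseq m' \<longrightarrow>
      (\<Sum>(a, b)\<in>msplits m. f a * g b) = (\<Sum>(a, b)\<in>msplits m'. f a * g b)"
    using f g by (intro allI impI sum_msplits_cong) blast+
qed

instance
proof
  fix f g h :: "'a qsym"
  show comm: "f * g = g * f" for f g :: "'a qsym"
  proof (rule qsym_eqI)
    fix m
    have "bij_betw prod.swap (msplits m) (msplits m)"
      by (rule bij_betw_byWitness[where f' = prod.swap]) (auto simp: msplits_def add.commute)
    from sum.reindex_bij_betw[OF this, of "\<lambda>(a, b). qcoeff g a * qcoeff f b"]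
    show "qcoeff (f * g) m = qcoeff (g * f) m"
      by (simp add: times_qsym.rep_eq case_prod_unfold mult.commute)
  qed
  show "f * g * h = f * (g * h)"
  proof (rule qsym_eqI)
    fix m
    let ?F = "\<lambda>(a, b, c). qcoeff f a * (qcoeff g b * qcoeff h c)"
    have "qcoeff (f * g * h) m
        = (\<Sum>(s, t)\<in>Sigma (msplits m) (\<lambda>s. msplits (fst s)). ?F (fst t, snd t, snd s))"
      by (simp add: times_qsym.rep_eq case_prod_unfold sum_distrib_right sum.Sigma finite_msplits
          mult.assoc)
    also have "\<dots> = (\<Sum>(s, t)\<in>Sigma (msplits m) (\<lambda>s. msplits (snd s)). ?F (fst s, fst t, snd t))"
      by (rule sum.reindex_bij_witness[where
            i = "\<lambda>(s, t). ((fst s + fst t, snd t), (fst s, fst t))"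
            and j = "\<lambda>(s, t). ((fst t, snd t + snd s), (snd t, snd s))"])
        (auto simp: msplits_def add.assoc)
    also have "\<dots> = qcoeff (f * (g * h)) m"
      by (simp add: times_qsym.rep_eq case_prod_unfold sum_distrib_left sum.Sigma finite_msplits)
    finally show "qcoeff (f * g * h) m = qcoeff (f * (g * h)) m" .
  qed
  show "(f + g) * h = f * h + g * h"
    by (rule qsym_eqI)
      (simp add: times_qsym.rep_eq plus_qsym.rep_eq case_prod_unfold distrib_right sum.distrib)
  show "1 * f = f"
  proof (rule qsym_eqI)
    fix m
    have "qcoeff (1 * f) m = (\<Sum>(a, b)\<in>{(0, m)}. qcoeff 1 a * qcoeff f b)"
      unfolding times_qsym.rep_eq
      by (rule sum.mono_neutral_right[OF finite_msplits]) (auto simp: msplits_def one_qsym.rep_eq split: if_splits)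
    then show "qcoeff (1 * f) m = qcoeff f m" by (simp add: one_qsym.rep_eq)
  qed
  have "qcoeff (0::'a qsym) 0 \<noteq> qcoeff 1 0" by (simp add: zero_qsym.rep_eq one_qsym.rep_eq)
  then show "(0::'a qsym) \<noteq> 1" by auto
qed

end

subsection \<open>The monomial basis\<close>

text \<open>Compositions are lists of positive integers; \<open>qM p = 0\<close> if \<open>p\<close> has an entry \<open>0\<close>.\<close>

lift_definition qM :: "nat list \<Rightarrow> 'k::field qsym" is "\<lambda>p m. if expseq m = p then 1 else 0"
proof (intro conjI)
  fix p
  show "\<exists>d. \<forall>m. (if expseq m = p then 1 else 0::'k) \<noteq> 0 \<longrightarrow> mdegree m \<le> d"
    by (rule exI[of _ "sum_list p"]) (auto simp: sum_list_expseq[symmetric])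
qed auto

text \<open>The coordinates of a quasisymmetric function in the basis of the \<open>qM p\<close>, with \<open>p\<close> a
  composition.\<close>

lift_definition qcoords :: "'k::field qsym \<Rightarrow> (nat list \<Rightarrow>\<^sub>0 'k)"
  is "\<lambda>f p. if 0 \<in> set p then 0 else f (Poly_Mapping.nth p)"
proof -
  fix f :: "(nat \<Rightarrow>\<^sub>0 nat) \<Rightarrow> 'k"
  assume "(\<exists>d. \<forall>m. f m \<noteq> 0 \<longrightarrow> mdegree m \<le> d) \<and>
    (\<forall>m m'. expseq m = expseq m' \<longrightarrow> f m = f m')"
  then obtain d where d: "\<And>m. f m \<noteq> 0 \<Longrightarrow> mdegree m \<le> d" by blast
  have "{p. (if 0 \<in> set p then 0 else f (Poly_Mapping.nth p)) \<noteq> 0}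
      \<subseteq> {p. set p \<subseteq> {..d} \<and> length p \<le> d}"
  proof
    fix p assume "p \<in> {p. (if 0 \<in> set p then 0 else f (Poly_Mapping.nth p)) \<noteq> 0}"
    then have p0: "0 \<notin> set p" "f (Poly_Mapping.nth p) \<noteq> 0" by (auto split: if_splits)
    then have s: "sum_list p \<le> d"
      using d sum_list_expseq[of "Poly_Mapping.nth p"] by (simp add: expseq_nth)
    have "length p \<le> sum_list p" using p0(1) by (induction p) auto
    then show "p \<in> {p. set p \<subseteq> {..d} \<and> length p \<le> d}"
      using s member_le_sum_list[of _ p] by (auto intro: le_trans)
  qed
  then show "finite {p. (if 0 \<in> set p then 0 else f (Poly_Mapping.nth p)) \<noteq> 0}"
    by (rule finite_subset) (simp add: finite_lists_length_le)
qed

lemma qcoords_qM: "0 \<notin> set p \<Longrightarrow> qcoords (qM p) = Poly_Mapping.single p 1"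
  by (rule poly_mapping_eqI)
    (auto simp: qcoords.rep_eq qM.rep_eq expseq_nth lookup_single when_def)

lemma qcoeff_sum: "qcoeff (sum F S) m = (\<Sum>x\<in>S. qcoeff (F x) m)"
  by (induction S rule: infinite_finite_induct) (auto simp: zero_qsym.rep_eq plus_qsym.rep_eq)

lemma lin_ext_qM_qcoords: "lin_ext qscale qM (qcoords f) = f"
proof (rule qsym_eqI)
  fix m
  have 0: "0 \<notin> set (expseq m)" by (rule zero_notin_expseq)
  have "qcoeff (lin_ext qscale qM (qcoords f)) m
      = (\<Sum>p\<in>Poly_Mapping.keys (qcoords f).
          if p = expseq m then Poly_Mapping.lookup (qcoords f) p else 0)"
    unfolding lin_ext_def qcoeff_sum
    by (rule sum.cong) (auto simp: qscale.rep_eq qM.rep_eq)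
  also have "\<dots> = Poly_Mapping.lookup (qcoords f) (expseq m)"
    by (simp add: sum.delta in_keys_iff)
  also have "\<dots> = qcoeff f (Poly_Mapping.nth (expseq m))"
    using 0 by (simp add: qcoords.rep_eq)
  also have "\<dots> = qcoeff f m"
    by (rule qcoeff_cong) (rule expseq_nth[OF 0])
  finally show "qcoeff (lin_ext qscale qM (qcoords f)) m = qcoeff f m" .
qed

subsection \<open>Hopf algebra structure\<close>

definition qcounit :: "'k::field qsym \<Rightarrow> 'k"
  where "qcounit f = qcoeff f 0"

text \<open>The tensor square of the space of quasisymmetric functions has the basis
  \<open>qM p \<otimes> qM q\<close>, represented by \<open>Poly_Mapping.single (p, q) 1\<close>, for compositions \<open>p, q\<close>.\<close>

type_synonym 'k qsym2 = "nat list \<times> nat list \<Rightarrow>\<^sub>0 'k"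

definition qtensor :: "'k::field qsym \<Rightarrow> 'k qsym \<Rightarrow> 'k qsym2"
  where "qtensor f g = lin_ext pm_scale
    (\<lambda>p. lin_ext pm_scale (\<lambda>q. Poly_Mapping.single (p, q) 1) (qcoords g)) (qcoords f)"

definition qcoprod :: "'k::field qsym \<Rightarrow> 'k qsym2"
  where "qcoprod f = lin_ext pm_scale
    (\<lambda>p. \<Sum>i\<le>length p. qtensor (qM (take i p)) (qM (drop i p))) (qcoords f)"

definition qtensor_map ::
    "('k::field qsym \<Rightarrow> 'k qsym) \<Rightarrow> ('k qsym \<Rightarrow> 'k qsym) \<Rightarrow> 'k qsym2 \<Rightarrow> 'k qsym2"
  where "qtensor_map \<phi> \<psi> = lin_ext pm_scale (\<lambda>(p, q). qtensor (\<phi> (qM p)) (\<psi> (qM q)))"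

definition qmult :: "'k::field qsym2 \<Rightarrow> 'k qsym"
  where "qmult = lin_ext qscale (\<lambda>(p, q). qM p * qM q)"

definition qsym_antipode :: "('k::field qsym \<Rightarrow> 'k qsym) \<Rightarrow> bool"
  where "qsym_antipode S \<longleftrightarrow> Vector_Spaces.linear qscale qscale S \<and>
    (\<forall>f. qmult (qtensor_map S id (qcoprod f)) = qscale (qcounit f) 1 \<and>
         qmult (qtensor_map id S (qcoprod f)) = qscale (qcounit f) 1)"

definition qsym_hopf_endomorphism :: "('k::field qsym \<Rightarrow> 'k qsym) \<Rightarrow> bool"
  where "qsym_hopf_endomorphism \<phi> \<longleftrightarrow>
    Vector_Spaces.linear qscale qscale \<phi> \<and>
    \<phi> 1 = 1 \<and> (\<forall>f g. \<phi> (f * g) = \<phi> f * \<phi> g) \<and>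
    (\<forall>f. qcounit (\<phi> f) = qcounit f) \<and>
    (\<forall>f. qcoprod (\<phi> f) = qtensor_map \<phi> \<phi> (qcoprod f)) \<and>
    (\<forall>S. qsym_antipode S \<longrightarrow> (\<forall>f. \<phi> (S f) = S (\<phi> f)))"

subsection \<open>The isomorphism and the chain map on quasisymmetric functions\<close>

definition is_qsym_gamma :: "('k::field ab_poly \<Rightarrow> 'k qsym) \<Rightarrow> bool"
  where "is_qsym_gamma \<gamma> \<longleftrightarrow> Vector_Spaces.linear pm_scale qscale \<gamma> \<and>
    (\<forall>p. p \<noteq> [] \<and> 0 \<notin> set p \<longrightarrow>
       \<gamma> (bjoin (map (\<lambda>i. (ab_a - ab_b) ^ (i - 1)) p)) = qM p)"

definition qsym_gamma :: "'k::field ab_poly \<Rightarrow> 'k qsym"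
  where "qsym_gamma = (THE \<gamma>. is_qsym_gamma \<gamma>)"

text \<open>The map \<open>\<gamma>\<close> exists, is unique, and is an isomorphism onto the quasisymmetric functions
  without constant term: substitute \<open>a + b\<close> for \<open>a\<close>, then turn words into nonempty
  compositions.\<close>

lemma pm_induct [case_names zero add scale_single]:
  fixes u :: "'w \<Rightarrow>\<^sub>0 'k::field"
  assumes "P 0" "\<And>u v. P u \<Longrightarrow> P v \<Longrightarrow> P (u + v)"
    and "\<And>c w. P (pm_scale c (Poly_Mapping.single w 1))"
  shows "P u"
proof -
  have "P (\<Sum>w\<in>S. pm_scale (Poly_Mapping.lookup u w) (Poly_Mapping.single w 1))" for S
    by (induction S rule: infinite_finite_induct) (use assms in auto)
  moreover have "u = (\<Sum>w\<in>Poly_Mapping.keys u.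
      pm_scale (Poly_Mapping.lookup u w) (Poly_Mapping.single w 1))"
    by (rule poly_mapping_eqI)
      (auto simp: lookup_sum lookup_single when_def in_keys_iff sum.delta if_distrib cong: if_cong)
  ultimately show ?thesis by metis
qed

lemma linear_eq_on_single:
  assumes "Vector_Spaces.linear pm_scale scale f" "Vector_Spaces.linear pm_scale scale g"
    and "\<And>w. f (Poly_Mapping.single w 1) = g (Poly_Mapping.single w 1)"
  shows "f = g"
proof
  interpret f: Vector_Spaces.linear pm_scale scale f by fact
  interpret g: Vector_Spaces.linear pm_scale scale g by fact
  show "f u = g u" for u
    by (induction u rule: pm_induct) (simp_all add: f.zero g.zero f.add g.add f.scale g.scale assms(3))
qed

lemma pm_scale_single: "pm_scale c (Poly_Mapping.single w d) = Poly_Mapping.single w (c * d)"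
  by (rule poly_mapping_eqI) (simp add: lookup_single when_def)

lemma pm_scale_mult_left: "pm_scale c u * v = pm_scale c (u * v :: 'k::field ab_poly)"
  unfolding pm_scale_def mult_map_scale_conv_mult by (simp add: mult.assoc)

lemma pm_scale_mult_right: "u * pm_scale c v = pm_scale c (u * v :: 'k::field ab_poly)"
proof -
  interpret vector_space "pm_scale :: 'k \<Rightarrow> 'k ab_poly \<Rightarrow> _" by (rule vector_space_pm_scale)
  have "u * Poly_Mapping.single 0 c = Poly_Mapping.single 0 c * u" for u :: "'k ab_poly"
    by (induction u rule: pm_induct)
      (simp_all add: distrib_left distrib_right pm_scale_single mult_single mult.commute)
  then show ?thesis
    unfolding pm_scale_def mult_map_scale_conv_mult by (metis mult.assoc)
qed

definition ab_subst :: "'k::field ab_poly \<Rightarrow> 'k ab_poly \<Rightarrow> 'k ab_poly"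
  where "ab_subst x = lin_ext pm_scale
    (\<lambda>w. prod_list (map (\<lambda>l. case l of LA \<Rightarrow> x | LB \<Rightarrow> ab_b) w))"

lemma linear_ab_subst: "Vector_Spaces.linear pm_scale pm_scale (ab_subst x)"
  unfolding ab_subst_def by (rule linear_lin_ext[OF vector_space_pm_scale])

lemma ab_subst_word:
  "ab_subst x (ab_word w) = prod_list (map (\<lambda>l. case l of LA \<Rightarrow> x | LB \<Rightarrow> ab_b) w)"
  unfolding ab_subst_def by (simp add: vector_space_pm_scale)

lemma ab_subst_a [simp]: "ab_subst x ab_a = x"
  and ab_subst_b [simp]: "ab_subst x ab_b = ab_b"
  by (simp_all add: ab_subst_word)

lemma ab_subst_one [simp]: "ab_subst x 1 = 1"
proof -
  have "ab_word [] = (1 :: 'a ab_poly)" by (simp flip: zero_list_def)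
  then show ?thesis using ab_subst_word[of x "[]"] by simp
qed

lemma ab_subst_mult: "ab_subst x (u * v) = ab_subst x u * ab_subst x v"
proof -
  interpret Vector_Spaces.linear pm_scale pm_scale "ab_subst x" by (rule linear_ab_subst)
  have *: "ab_subst x (ab_word w * v) = ab_subst x (ab_word w) * ab_subst x v" for w v
  proof (induction v rule: pm_induct)
    case (scale_single c w')
    have "ab_word w * ab_word w' = (ab_word (w @ w') :: 'a ab_poly)"
      by (simp add: mult_single plus_list_def)
    then show ?case by (simp add: pm_scale_mult_right scale ab_subst_word)
  qed (simp_all add: distrib_left add zero)
  show ?thesis
    by (induction u rule: pm_induct)
      (simp_all add: distrib_right add zero pm_scale_mult_left scale *)
qed

lemma ab_subst_power: "ab_subst x (u ^ n) = ab_subst x u ^ n"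
  by (induction n) (simp_all add: ab_subst_mult)

lemma ab_subst_bjoin: "ab_subst x (bjoin us) = bjoin (map (ab_subst x) us)"
  by (induction us rule: bjoin.induct) (simp_all add: ab_subst_mult)

lemma ab_subst_inverse:
  assumes "ab_subst x y = ab_a"
  shows "ab_subst x (ab_subst y u) = u"
proof -
  interpret x: Vector_Spaces.linear pm_scale pm_scale "ab_subst x" by (rule linear_ab_subst)
  interpret y: Vector_Spaces.linear pm_scale pm_scale "ab_subst y" by (rule linear_ab_subst)
  have w: "ab_subst x (ab_subst y (ab_word w)) = ab_word w" for w
  proof (induction w)
    case Nil
    then show ?case by (simp add: zero_list_def[symmetric])
  next
    case (Cons l w)
    have "ab_word (l # w) = (ab_word [l] * ab_word w :: 'a ab_poly)"
      by (simp add: mult_single plus_list_def)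
    moreover have "ab_subst x (ab_subst y (ab_word [l])) = ab_word [l]"
      by (cases l) (simp_all add: assms)
    ultimately show ?case by (simp add: ab_subst_mult Cons.IH)
  qed
  show ?thesis
    by (induction u rule: pm_induct) (simp_all add: x.add y.add x.zero y.zero x.scale y.scale w)
qed

lemma ab_subst_plus_minus:
  "ab_subst (ab_a + ab_b) (ab_subst (ab_a - ab_b) u) = u"
  "ab_subst (ab_a - ab_b) (ab_subst (ab_a + ab_b) u) = u"
proof -
  interpret p: Vector_Spaces.linear pm_scale pm_scale "ab_subst (ab_a + ab_b :: 'a ab_poly)"
    by (rule linear_ab_subst)
  interpret m: Vector_Spaces.linear pm_scale pm_scale "ab_subst (ab_a - ab_b :: 'a ab_poly)"
    by (rule linear_ab_subst)
  show "ab_subst (ab_a + ab_b) (ab_subst (ab_a - ab_b) u) = u"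
    by (rule ab_subst_inverse) (simp add: p.diff)
  show "ab_subst (ab_a - ab_b) (ab_subst (ab_a + ab_b) u) = u"
    by (rule ab_subst_inverse) (simp add: m.add)
qed

fun comp_of_word :: "letter list \<Rightarrow> nat list" where
  "comp_of_word [] = [1]"
| "comp_of_word (LA # w) = (hd (comp_of_word w) + 1) # tl (comp_of_word w)"
| "comp_of_word (LB # w) = 1 # comp_of_word w"

fun word_of_comp :: "nat list \<Rightarrow> letter list" where
  "word_of_comp [] = []"
| "word_of_comp [i] = replicate (i - 1) LA"
| "word_of_comp (i # j # p) = replicate (i - 1) LA @ LB # word_of_comp (j # p)"

lemma comp_of_word: "comp_of_word w \<noteq> [] \<and> 0 \<notin> set (comp_of_word w)"
  by (induction w rule: comp_of_word.induct) (auto dest: list.set_sel(2))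

lemma comp_of_word_replicate:
  "comp_of_word (replicate n LA @ w) = (hd (comp_of_word w) + n) # tl (comp_of_word w)"
  using comp_of_word[of w] by (induction n) auto

lemma comp_of_word_of_comp:
  "p \<noteq> [] \<Longrightarrow> 0 \<notin> set p \<Longrightarrow> comp_of_word (word_of_comp p) = p"
proof (induction p rule: word_of_comp.induct)
  case (2 i)
  then show ?case using comp_of_word_replicate[of "i - 1" "[]"] by simp
next
  case (3 i j p)
  then show ?case by (simp add: comp_of_word_replicate)
qed simp

lemma word_of_comp_of_word: "word_of_comp (comp_of_word w) = w"
proof (induction w rule: comp_of_word.induct)
  case (2 w)
  obtain i p where ip: "comp_of_word w = i # p" "i > 0"
    using comp_of_word[of w] by (cases "comp_of_word w") auto
  have "word_of_comp ((i + 1) # p) = LA # word_of_comp (i # p)"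
    using ip(2) by (cases p; cases i) auto
  then show ?case using 2 ip by simp
next
  case (3 w)
  then show ?case using comp_of_word[of w] by (cases "comp_of_word w") auto
qed simp

lemma ab_a_power: "ab_a ^ n = ab_word (replicate n LA)"
proof (induction n)
  case 0
  then show ?case by (simp add: zero_list_def[symmetric])
next
  case (Suc n)
  then show ?case by (simp add: mult_single plus_list_def)
qed

lemma bjoin_powers: "p \<noteq> [] \<Longrightarrow> bjoin (map (\<lambda>i. ab_a ^ (i - 1)) p) = ab_word (word_of_comp p)"
  by (induction p rule: word_of_comp.induct)
    (simp_all add: ab_a_power mult_single plus_list_def)

lemma ab_basis_eq:
  assumes "p \<noteq> []"
  shows "bjoin (map (\<lambda>i. (ab_a - ab_b) ^ (i - 1)) p)
    = ab_subst (ab_a - ab_b) (ab_word (word_of_comp p) :: 'k::field ab_poly)"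
  by (simp add: bjoin_powers[OF assms, symmetric] ab_subst_bjoin ab_subst_power o_def)

lemma is_qsym_gamma_iff:
  fixes \<gamma> :: "'k::field ab_poly \<Rightarrow> 'k qsym"
  shows "is_qsym_gamma \<gamma> \<longleftrightarrow>
    \<gamma> = lin_ext qscale (\<lambda>w. qM (comp_of_word w)) \<circ> ab_subst (ab_a + ab_b)"
    (is "_ \<longleftrightarrow> \<gamma> = ?L \<circ> ?s")
proof
  assume *: "is_qsym_gamma \<gamma>"
  then have lin: "Vector_Spaces.linear pm_scale qscale (\<gamma> \<circ> ab_subst (ab_a - ab_b))"
    by (auto simp: is_qsym_gamma_def intro!: Vector_Spaces.linear_compose linear_ab_subst)
  have "\<gamma> \<circ> ab_subst (ab_a - ab_b) = ?L"
  proof (rule linear_eq_on_single[OF lin linear_lin_ext[OF vector_space_qscale]])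
    fix w
    have "\<gamma> (bjoin (map (\<lambda>i. (ab_a - ab_b) ^ (i - 1)) (comp_of_word w))) = qM (comp_of_word w)"
      using * comp_of_word[of w] unfolding is_qsym_gamma_def by blast
    then have "\<gamma> (ab_subst (ab_a - ab_b) (ab_word w)) = qM (comp_of_word w)"
      unfolding ab_basis_eq[OF conjunct1[OF comp_of_word]] word_of_comp_of_word .
    then show "(\<gamma> \<circ> ab_subst (ab_a - ab_b)) (ab_word w) = ?L (ab_word w)"
      by (simp add: vector_space_qscale)
  qed
  then show "\<gamma> = ?L \<circ> ?s"
    by (metis (no_types, lifting) ab_subst_plus_minus(2) comp_apply ext)
next
  assume *: "\<gamma> = ?L \<circ> ?s"
  have "Vector_Spaces.linear pm_scale qscale (?L \<circ> ?s)"
    by (intro Vector_Spaces.linear_compose[OF linear_ab_subst] linear_lin_ext vector_space_qscale)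
  moreover have "(?L \<circ> ?s) (bjoin (map (\<lambda>i. (ab_a - ab_b) ^ (i - 1)) p)) = qM p"
    if "p \<noteq> []" "0 \<notin> set p" for p
    unfolding ab_basis_eq[OF that(1)]
    using that by (simp add: ab_subst_plus_minus comp_of_word_of_comp vector_space_qscale)
  ultimately show "is_qsym_gamma \<gamma>"
    unfolding is_qsym_gamma_def * by blast
qed

lemma is_qsym_gamma_qsym_gamma: "is_qsym_gamma qsym_gamma"
  by (simp add: qsym_gamma_def is_qsym_gamma_iff)

lemma linear_qcoords: "Vector_Spaces.linear qscale pm_scale qcoords"
proof -
  interpret q: vector_space qscale by (rule vector_space_qscale)
  interpret p: vector_space pm_scale by (rule vector_space_pm_scale)
  show ?thesis
    by unfold_locales
      (auto intro!: poly_mapping_eqI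
        simp: lookup_add qcoords.rep_eq plus_qsym.rep_eq qscale.rep_eq)
qed

lemma bij_betw_qsym_gamma: "bij_betw (qsym_gamma :: 'k::field ab_poly \<Rightarrow> _) UNIV {f. qcounit f = 0}"
proof -
  let ?L = "lin_ext qscale (\<lambda>w. qM (comp_of_word w)) :: 'k ab_poly \<Rightarrow> 'k qsym"
  let ?J = "\<lambda>f. lin_ext pm_scale (\<lambda>p. ab_word (word_of_comp p)) (qcoords f) :: 'k ab_poly"
  interpret L: Vector_Spaces.linear pm_scale qscale ?L
    by (rule linear_lin_ext[OF vector_space_qscale])
  have Jlin: "Vector_Spaces.linear qscale pm_scale ?J"
    using Vector_Spaces.linear_compose[OF linear_qcoords linear_lin_ext[OF vector_space_pm_scale]]
    by (simp add: o_def)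
  have "?J \<circ> ?L = id"
    by (rule linear_eq_on_single[OF Vector_Spaces.linear_compose[OF L.linear_axioms Jlin]])
      (use comp_of_word in \<open>auto intro!: vector_space.linear_id vector_space_pm_scale
         simp: vector_space_qscale vector_space_pm_scale qcoords_qM word_of_comp_of_word\<close>)
  then have JL: "?J (?L u) = u" for u by (metis comp_apply id_apply)
  have counit: "qcounit (qM p :: 'k qsym) = 0" if "p \<noteq> []" for p
    using that by (simp add: qcounit_def qM.rep_eq expseq_def)
  have counit_L: "qcounit (?L u) = 0" for u
    using counit comp_of_word
    by (simp add: lin_ext_def qcounit_def qcoeff_sum qscale.rep_eq)
  have LJ: "?L (?J f) = f" if "qcounit f = 0" for f
  proof -
    have ne: "p \<noteq> [] \<and> 0 \<notin> set p" if p: "p \<in> Poly_Mapping.keys (qcoords f)" for p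
    proof -
      have "Poly_Mapping.nth [] = (0 :: nat \<Rightarrow>\<^sub>0 nat)"
        by (rule poly_mapping_eqI) simp
      then show ?thesis
        using p \<open>qcounit f = 0\<close> by (auto simp: in_keys_iff qcoords.rep_eq qcounit_def split: if_splits)
    qed
    have "?L (?J f) = (\<Sum>p\<in>Poly_Mapping.keys (qcoords f).
        qscale (Poly_Mapping.lookup (qcoords f) p) (qM (comp_of_word (word_of_comp p))))"
      by (subst (2) lin_ext_def) (simp add: L.sum L.scale vector_space_qscale)
    also have "\<dots> = lin_ext qscale qM (qcoords f)"
      unfolding lin_ext_def using ne by (intro sum.cong) (auto simp: comp_of_word_of_comp)
    finally show ?thesis by (simp add: lin_ext_qM_qcoords)
  qed
  have g: "qsym_gamma = ?L \<circ> ab_subst (ab_a + ab_b)"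
    using is_qsym_gamma_qsym_gamma is_qsym_gamma_iff by blast
  show ?thesis
    by (rule bij_betw_byWitness[where f' = "\<lambda>f. ab_subst (ab_a - ab_b) (?J f)"])
      (auto simp: g JL LJ counit_L ab_subst_plus_minus)
qed

text \<open>A quasisymmetric function is split into its constant term, on which the map is the identity,
  and the rest, on which it is \<open>\<gamma> \<circ> chain_map2 G \<circ> \<gamma>\<^sup>-\<^sup>1\<close>.\<close>

definition qsym_chain_map2 :: "('k::field ab_poly \<Rightarrow> 'k) \<Rightarrow> 'k qsym \<Rightarrow> 'k qsym"
  where "qsym_chain_map2 G f = qscale (qcounit f) 1 +
    qsym_gamma (chain_map2 G (inv qsym_gamma (f - qscale (qcounit f) 1)))"

end

theory Submission
  imports Defs
begin

text \<open>
  Put \<open>c = a - b\<close>. The coproduct \<open>\<Delta>\<close> of noncommutative polynomials is a derivation with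
  \<open>\<Delta>(c) = 0\<close> and \<open>\<Delta>(b) = 1 \<otimes> 1\<close>, so it cuts a word in \<open>c\<close> and \<open>b\<close> at its letters \<open>b\<close>
  (\<open>coprod_apply_cb_mono\<close>). Under \<open>\<gamma>\<close> such words become the functions \<open>M\<^sub>p\<close>, and \<open>\<Delta>\<close> becomes
  deconcatenation of compositions. Write \<open>h(p) = G(\<gamma>\<^sup>-\<^sup>1 M\<^sub>p)\<close> and \<open>h([]) = 1\<close>. The chain map then
  sends \<open>M\<^sub>p\<close> to the sum of \<open>h(p\<^sub>1) \<cdots> h(p\<^sub>k) M\<^bsub>(|p\<^sub>1|, \<dots>, |p\<^sub>k|)\<^esub>\<close> over all ways of cutting \<open>p\<close>
  into consecutive nonempty blocks \<open>p\<^sub>1, \<dots>, p\<^sub>k\<close>. In other words, the coefficient of the image of \<open>f\<close>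
  at a monomial with exponents \<open>s\<^sub>1, \<dots>, s\<^sub>k\<close> is \<open>(h\<^bsub>s\<^sub>1\<^esub> \<otimes> \<dots> \<otimes> h\<^bsub>s\<^sub>k\<^esub>)(\<Delta>\<^sup>k f)\<close>, where
  \<open>h\<^bsub>s\<^esub>\<close> is the part of the functional \<open>h\<close> in degree \<open>s\<close> (\<open>block_coef\<close>, \<open>qc_qsym_chain_map2\<close>).

  This formula respects the coproduct because iterated coproducts compose (\<open>block_coef_append\<close>).
  It respects the product if \<open>h\<close> is multiplicative on quasisymmetric functions, because the
  coproduct is itself multiplicative (\<open>block_coef_split_prod\<close>).

  It remains to see that \<open>h\<close> is multiplicative. The hypothesis on \<open>G\<close> speaks of ab-indices of
  posets, so two facts are needed. Firstly, \<open>\<gamma>(\<Psi>(P \<times> Q)) = \<gamma>(\<Psi>(P)) \<gamma>(\<Psi>(Q))\<close>: the coefficients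
  of \<open>\<gamma>(\<Psi>(P))\<close> count multichains in \<open>P\<close> with prescribed rank steps, and a multichain in a product
  is a pair of multichains (\<open>gamma_ab_index_prod\<close>). Secondly, ab-indices span all polynomials, over
  any field: if the levels of a poset between bottom and top have one or two elements each and
  elements of different levels are comparable, its ab-index is the product of a factor \<open>a\<close> for each such level with one element and
  a factor \<open>a + b\<close> for each level with two (\<open>ab_index_level\<close>), and these products span since
  \<open>b = (a + b) - a\<close> (\<open>level_letter_induct\<close>). Bilinearity then gives \<open>qsym_char_mult\<close>.

  Compatibility with the antipode is automatic for a bialgebra endomorphism
  (\<open>bialgebra_endomorphism_antipode\<close>).
\<close>

section \<open>Coefficients of quasisymmetric functions\<close>

text \<open>A monomial enters only through its sequence of exponents. The sequence \<open>w\<close> may contain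
  zeros, which do not change the coefficient (\<open>qc_filter\<close>). Zeros are unavoidable: a factorization
  of a monomial splits each exponent into a sum in which either summand can vanish.\<close>

definition qc :: "'k::field qsym \<Rightarrow> nat list \<Rightarrow> 'k"
  where "qc f w = qcoeff f (Poly_Mapping.nth w)"

lemma expseq_nth_filter: "expseq (Poly_Mapping.nth w) = filter (\<lambda>x. 0 < x) w"
proof -
  have "Poly_Mapping.nth w = mono_at [0..<length w] w"
  proof (rule poly_mapping_eqI)
    fix i
    show "Poly_Mapping.lookup (Poly_Mapping.nth w) i
        = Poly_Mapping.lookup (mono_at [0..<length w] w) i"
      using lookup_mono_at_nth[of "[0..<length w]" w i]
        lookup_mono_at_notin[of w "[0..<length w]" i]
      by (cases "i < length w") (auto simp: nth_default_def)
  qed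
  then show ?thesis by (simp add: expseq_mono_at)
qed

lemma qcoeff_eq_qc: "qcoeff f m = qc f (expseq m)"
  unfolding qc_def by (rule qcoeff_cong) (simp add: expseq_nth zero_notin_expseq)

lemma qc_filter: "qc f (filter (\<lambda>x. 0 < x) w) = qc f w"
  unfolding qc_def by (rule qcoeff_cong) (simp add: expseq_nth_filter)

lemma qsym_eqI_qc: "(\<And>w. 0 \<notin> set w \<Longrightarrow> qc f w = qc g w) \<Longrightarrow> f = g"
  by (rule qsym_eqI) (simp add: qcoeff_eq_qc zero_notin_expseq)

lemma qc_add [simp]: "qc (f + g) w = qc f w + qc g w"
  and qc_scale [simp]: "qc (qscale c f) w = c * qc f w"
  by (simp_all add: qc_def plus_qsym.rep_eq qscale.rep_eq)

lemma qc_minus [simp]: "qc (f - g) w = qc f w - qc g w"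
  by (metis add_diff_cancel_right' diff_add_cancel qc_add)

lemma qc_sum: "qc (sum F S) w = (\<Sum>x\<in>S. qc (F x) w)"
  by (simp add: qc_def qcoeff_sum)

lemma qc_qM: "qc (qM p) w = (if filter (\<lambda>x. 0 < x) w = p then 1 else 0)"
  by (simp add: qc_def qM.rep_eq expseq_nth_filter)

lemma filter_id_nz: "0 \<notin> set w \<Longrightarrow> filter (\<lambda>x. 0 < x) w = (w :: nat list)"
  by (rule filter_True) (metis gr0I)

lemma qM_Nil: "qM [] = 1"
  by (rule qsym_eqI) (simp add: qM.rep_eq one_qsym.rep_eq expseq_eq_Nil_iff)

lemma qcounit_eq_qc: "qcounit f = qc f []"
  by (simp add: qcounit_def qcoeff_eq_qc expseq_def)

lemma lookup_qcoords: "Poly_Mapping.lookup (qcoords f) p = (if 0 \<in> set p then 0 else qc f p)"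
  by (simp add: qcoords.rep_eq qc_def)

subsection \<open>Splittings of exponent sequences\<close>

lemma esplits_Nil: "esplits [] = {([], [])}"
  by (auto simp: esplits_def)

lemma sum_esplits_Nil [simp]: "(\<Sum>(x, y)\<in>esplits []. f x y) = f [] []"
  by (simp add: esplits_Nil)

lemma in_esplits_Cons_Cons:
  "(a # x, b # y) \<in> esplits (e # w) \<longleftrightarrow> a + b = e \<and> (x, y) \<in> esplits w"
  unfolding esplits_def
  by (simp only: mem_Collect_eq case_prod_conv length_Cons nat.inject zip_Cons_Cons list.map
      list.inject conj_commute conj_left_commute)
lemma in_esplits_Cons_Nil:
  "([], y) \<notin> esplits (e # w)" "(y, []) \<notin> esplits (e # w)"
  unfolding esplits_def by simp_all

lemma in_esplits_Cons:
  "(x, y) \<in> esplits (e # w) \<longleftrightarrow>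
    (\<exists>a x' y'. x = a # x' \<and> y = (e - a) # y' \<and> a \<le> e \<and> (x', y') \<in> esplits w)"
proof (cases x; cases y)
  fix a x' b y' assume "x = a # x'" "y = b # y'"
  moreover have "a + b = e \<longleftrightarrow> b = e - a \<and> a \<le> e" by auto
  ultimately show ?thesis by (simp add: in_esplits_Cons_Cons)
qed (simp_all add: in_esplits_Cons_Nil)

lemma sum_esplits_Cons:
  "(\<Sum>(x, y)\<in>esplits (e # w). f x y) = (\<Sum>a\<le>e. \<Sum>(x, y)\<in>esplits w. f (a # x) ((e - a) # y))"
proof -
  have "(\<Sum>(x, y)\<in>esplits (e # w). f x y)
      = (\<Sum>(a, x, y)\<in>{..e} \<times> esplits w. f (a # x) ((e - a) # y))"
    by (rule sum.reindex_bij_witness[where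
          i = "\<lambda>(a, x, y). (a # x, (e - a) # y)" and j = "\<lambda>(x, y). (hd x, tl x, tl y)"])
      (auto simp: in_esplits_Cons)
  then show ?thesis by (simp add: sum.Sigma finite_esplits case_prod_unfold)
qed

lemma sum_esplits_append:
  "(\<Sum>(x, y)\<in>esplits (u @ w). f x y)
    = (\<Sum>(x, y)\<in>esplits u. \<Sum>(x', y')\<in>esplits w. f (x @ x') (y @ y'))"
  by (induction u arbitrary: f) (simp_all add: sum_esplits_Cons)

text \<open>The product of power series in terms of coefficients at exponent sequences, for arbitrary
  functions of such sequences: multichain counts and values of functionals are multiplied by the
  same rule as quasisymmetric functions (\<open>qc_mult\<close>).\<close>

definition split_prod :: "(nat list \<Rightarrow> 'k::field) \<Rightarrow> (nat list \<Rightarrow> 'k) \<Rightarrow> nat list \<Rightarrow> 'k"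
  where "split_prod F G w = (\<Sum>(x, y)\<in>esplits w. F x * G y)"

lemma qc_mult:
  assumes "0 \<notin> set w"
  shows "qc (f * g) w = split_prod (qc f) (qc g) w"
proof -
  define m where "m = Poly_Mapping.nth w"
  define ks where "ks = sorted_list_of_set (Poly_Mapping.keys m)"
  have ks: "sorted_wrt (<) ks" "set ks = Poly_Mapping.keys m"
    "map (Poly_Mapping.lookup m) ks = w"
  proof -
    show "sorted_wrt (<) ks" "set ks = Poly_Mapping.keys m" by (simp_all add: ks_def)
    show "map (Poly_Mapping.lookup m) ks = w"
      using expseq_nth[OF assms] unfolding ks_def m_def expseq_def .
  qed
  have len: "length w = length ks" using ks(3) by (metis length_map)
  have "qc (f * g) w = (\<Sum>(a, b)\<in>msplits m. qcoeff f a * qcoeff g b)"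
    by (simp add: qc_def m_def times_qsym.rep_eq)
  also have "\<dots> = (\<Sum>(x, y)\<in>esplits w. qcoeff f (mono_at ks x) * qcoeff g (mono_at ks y))"
    using sum.reindex_bij_betw[OF bij_betw_esplits[OF ks(1,2)], of "\<lambda>(a, b). qcoeff f a * qcoeff g b"]
    by (simp add: ks(3) case_prod_unfold)
  also have "\<dots> = split_prod (qc f) (qc g) w"
    unfolding split_prod_def
  proof (intro sum.cong refl, clarsimp)
    fix x y assume "(x, y) \<in> esplits w"
    then have "length x = length ks" "length y = length ks" using len by (auto simp: esplits_def)
    then show "qcoeff f (mono_at ks x) * qcoeff g (mono_at ks y) = qc f x * qc g y"
      by (simp add: qcoeff_eq_qc expseq_mono_at ks(1) qc_filter)
  qed
  finally show ?thesis .
qed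

section \<open>The ab-index of a product of graded posets\<close>

text \<open>A graded poset with its rank function and its bounds as parameters, instead of the
  choices hidden in \<^const>\<open>poset_rank\<close>, \<^const>\<open>poset_bot\<close> and \<^const>\<open>poset_top\<close>.\<close>

locale ranked_poset =
  fixes A :: "'a set" and r :: "'a rel" and \<rho> :: "'a \<Rightarrow> nat" and bot top :: 'a
  assumes fin: "finite A" and po: "partial_order_on A r"
    and bot: "bot \<in> A" "\<And>x. x \<in> A \<Longrightarrow> (bot, x) \<in> r"
    and top: "top \<in> A" "\<And>x. x \<in> A \<Longrightarrow> (x, top) \<in> r"
    and rank_bot: "\<rho> bot = 0"
    and rank_covers: "\<And>x y. poset_covers A r x y \<Longrightarrow> \<rho> y = \<rho> x + 1"
begin

lemma r_refl: "x \<in> A \<Longrightarrow> (x, x) \<in> r"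
  and r_trans: "(x, y) \<in> r \<Longrightarrow> (y, z) \<in> r \<Longrightarrow> (x, z) \<in> r"
  and r_antisym: "(x, y) \<in> r \<Longrightarrow> (y, x) \<in> r \<Longrightarrow> x = y"
  and r_in: "(x, y) \<in> r \<Longrightarrow> x \<in> A" "(x, y) \<in> r \<Longrightarrow> y \<in> A"
  using po unfolding partial_order_on_def preorder_on_def refl_on_def trans_def antisym_def
  by blast+

lemma poset_bot_eq: "poset_bot A r = bot"
  unfolding poset_bot_def using bot r_antisym by blast

lemma poset_top_eq: "poset_top A r = top"
  unfolding poset_top_def using top r_antisym by blast

text \<open>A finite order is the reflexive transitive closure of its covering relation, by induction on
  the size of an interval. Everything about ranks follows from their behaviour on covers.\<close>

lemma covers_induct [consumes 1, case_names refl covers trans]: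
  assumes "(x, y) \<in> r" and "\<And>x. x \<in> A \<Longrightarrow> P x x"
    and "\<And>x y. poset_covers A r x y \<Longrightarrow> P x y"
    and "\<And>x y z. (x, y) \<in> r \<Longrightarrow> (y, z) \<in> r \<Longrightarrow> P x y \<Longrightarrow> P y z \<Longrightarrow> P x z"
  shows "P x y"
  using assms(1)
proof (induction "card {z \<in> A. (x, z) \<in> r \<and> (z, y) \<in> r}" arbitrary: x y rule: less_induct)
  case less
  let ?I = "\<lambda>x y. {z \<in> A. (x, z) \<in> r \<and> (z, y) \<in> r}"
  have fI: "finite (?I u v)" for u v using fin by simp
  consider "x = y" | "poset_covers A r x y" | z where "z \<noteq> x" "z \<noteq> y" "(x, z) \<in> r" "(z, y) \<in> r"
    using less.prems r_in by (auto simp: poset_covers_def)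
  then show ?case
  proof cases
    case 3
    have "?I x z \<subseteq> ?I x y" "?I z y \<subseteq> ?I x y"
      using r_trans[OF _ 3(4)] r_trans[OF 3(3)] by auto
    note sub = this
    have "y \<in> ?I x y" "y \<notin> ?I x z" "x \<in> ?I x y" "x \<notin> ?I z y"
      using 3 less.prems r_antisym[of y z] r_antisym[of x z] r_refl r_in[OF less.prems] by auto
    with sub have "?I x z \<subset> ?I x y" "?I z y \<subset> ?I x y" by (simp_all only: psubset_eq) metis+
    then have "card (?I x z) < card (?I x y)" "card (?I z y) < card (?I x y)"
      by (simp_all only: psubset_card_mono[OF fI])
    then have "P x z" "P z y" using less.hyps 3(3,4) by simp_all
    with 3(3,4) show ?thesis by (rule assms(4))
  next
    case 1
    then show ?thesis using assms(2) r_in(1)[OF less.prems] by simp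
  next
    case 2
    then show ?thesis by (rule assms(3))
  qed
qed

lemma rank_mono: "(x, y) \<in> r \<Longrightarrow> \<rho> x \<le> \<rho> y"
  by (induction rule: covers_induct) (auto dest: rank_covers)

lemma rank_strict: "(x, y) \<in> r \<Longrightarrow> x = y \<or> \<rho> x < \<rho> y"
  by (induction rule: covers_induct) (auto dest: rank_covers)

lemma rank_unique:
  assumes "rank_function A r \<rho>'" "x \<in> A"
  shows "\<rho>' x = \<rho> x"
proof -
  have "\<rho>' y + \<rho> x = \<rho> y + \<rho>' x" if "(x, y) \<in> r" for x y
    using that
    by (induction rule: covers_induct)
      (use assms(1) in \<open>auto simp: rank_function_def dest: rank_covers\<close>)
  from this[OF bot(2)[OF assms(2)]] show ?thesis
    using assms(1) by (simp add: rank_function_def rank_bot poset_bot_eq)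
qed

lemma rank_function: "rank_function A r \<rho>"
  by (simp add: rank_function_def poset_bot_eq rank_bot rank_covers)

lemma poset_rank_eq: "x \<in> A \<Longrightarrow> poset_rank A r x = \<rho> x"
  unfolding poset_rank_def by (rule rank_unique[OF someI[of _ \<rho>]]) (rule rank_function)

lemma total_rank_eq: "total_rank A r = \<rho> top"
  by (simp add: total_rank_def poset_rank_eq poset_top_eq top)

lemma graded: "graded_poset A r"
  using fin po bot top rank_function by (auto simp: graded_poset_def)

end

lemma graded_posetE:
  assumes "graded_poset A r"
  obtains \<rho> bot top where "ranked_poset A r \<rho> bot top"
proof -
  from assms obtain \<rho> b t where *: "finite A" "partial_order_on A r" "b \<in> A" "\<forall>x\<in>A. (b, x) \<in> r"
    "t \<in> A" "\<forall>x\<in>A. (x, t) \<in> r" "rank_function A r \<rho>" by (auto simp: graded_poset_def)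
  have "antisym r" using * by (simp add: partial_order_on_def)
  then have "poset_bot A r = b"
    unfolding poset_bot_def using * by (intro the_equality) (auto dest: antisymD)
  then have "ranked_poset A r \<rho> b t"
    using * by unfold_locales (auto simp: rank_function_def)
  then show thesis by (rule that)
qed

text \<open>In a product, a cover moves in exactly one coordinate: a pair \<open>(x, y) < (x', y')\<close> that
  differs in both has \<open>(x', y)\<close> strictly in between.\<close>

lemma ranked_poset_prod:
  assumes "ranked_poset A r \<rho> b t" "ranked_poset B s \<sigma> b' t'"
  shows "ranked_poset (A \<times> B) (prod_rel r s) (\<lambda>(x, y). \<rho> x + \<sigma> y) (b, b') (t, t')"
proof -
  interpret P: ranked_poset A r \<rho> b t by fact
  interpret Q: ranked_poset B s \<sigma> b' t' by fact
  show ?thesis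
  proof
    show "partial_order_on (A \<times> B) (prod_rel r s)"
      unfolding partial_order_on_def preorder_on_def refl_on_def
    proof (intro conjI)
      show "prod_rel r s \<subseteq> (A \<times> B) \<times> A \<times> B"
        using P.r_in Q.r_in by (auto simp: prod_rel_def)
      show "trans (prod_rel r s)"
        using P.r_trans Q.r_trans by (auto simp: prod_rel_def intro!: transI)
      show "antisym (prod_rel r s)"
        using P.r_antisym Q.r_antisym by (auto simp: prod_rel_def intro!: antisymI)
    qed (auto simp: prod_rel_def P.r_refl Q.r_refl)
  next
    fix z z' assume cov: "poset_covers (A \<times> B) (prod_rel r s) z z'"
    obtain x y x' y' where z: "z = (x, y)" "z' = (x', y')" by (metis surj_pair)
    have le: "(x, x') \<in> r" "(y, y') \<in> s" and ne: "x \<noteq> x' \<or> y \<noteq> y'"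
      using cov by (auto simp: poset_covers_def prod_rel_def z)
    have btw: "(u = x \<and> v = y) \<or> (u = x' \<and> v = y')"
      if "(x, u) \<in> r" "(u, x') \<in> r" "(y, v) \<in> s" "(v, y') \<in> s" for u v
    proof -
      have "(u, v) \<in> A \<times> B" using that P.r_in Q.r_in by blast
      moreover have "((x, y), (u, v)) \<in> prod_rel r s" "((u, v), (x', y')) \<in> prod_rel r s"
        using that by (simp_all add: prod_rel_def)
      ultimately have "\<not> ((u, v) \<noteq> (x, y) \<and> (u, v) \<noteq> (x', y'))"
        using cov unfolding poset_covers_def z by metis
      then show ?thesis by simp
    qed
    have mem: "x \<in> A" "x' \<in> A" "y \<in> B" "y' \<in> B" using le P.r_in Q.r_in by auto
    note rf = P.r_refl[OF mem(1)] P.r_refl[OF mem(2)] Q.r_refl[OF mem(3)] Q.r_refl[OF mem(4)]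
    have "x = x' \<or> y = y'"
      using btw[OF le(1) rf(2) rf(3) le(2)] by auto
    then consider "x = x'" "poset_covers B s y y'" | "y = y'" "poset_covers A r x x'"
    proof (elim disjE)
      assume "x = x'"
      then have "poset_covers B s y y'"
        using btw[OF rf(1)] le rf mem ne by (auto simp: poset_covers_def)
      with \<open>x = x'\<close> show thesis by (rule that)
    next
      assume "y = y'"
      then have "poset_covers A r x x'"
        using btw[OF _ _ rf(3)] le rf mem ne by (auto simp: poset_covers_def)
      with \<open>y = y'\<close> show thesis by (rule that)
    qed
    then show "(case z' of (x, y) \<Rightarrow> \<rho> x + \<sigma> y) = (case z of (x, y) \<Rightarrow> \<rho> x + \<sigma> y) + 1"
      by cases (auto simp: z dest: P.rank_covers Q.rank_covers)
  qed (auto simp: P.fin Q.fin P.bot Q.bot P.top Q.top P.rank_bot Q.rank_bot prod_rel_def)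
qed

text \<open>With \<open>c = a - b\<close>, these are the words in \<open>c\<close> and \<open>b\<close>, indexed by compositions. They form the
  basis that \<^const>\<open>qsym_gamma\<close> carries to the monomial quasisymmetric functions.\<close>

definition cb_mono :: "nat list \<Rightarrow> 'k::field ab_poly"
  where "cb_mono p = bjoin (map (\<lambda>i. (ab_a - ab_b) ^ (i - 1)) p)"

lemma linear_qsym_gamma: "Vector_Spaces.linear pm_scale qscale qsym_gamma"
  by (rule is_qsym_gamma_qsym_gamma[unfolded is_qsym_gamma_def, THEN conjunct1])

lemma qsym_gamma_cb_mono: "p \<noteq> [] \<Longrightarrow> 0 \<notin> set p \<Longrightarrow> qsym_gamma (cb_mono p) = qM p"
  unfolding cb_mono_def
  by (rule is_qsym_gamma_qsym_gamma[unfolded is_qsym_gamma_def, THEN conjunct2, rule_format]) simp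

interpretation pm: vector_space pm_scale
  by (rule vector_space_pm_scale)

interpretation qsym_gamma: Vector_Spaces.linear pm_scale qscale qsym_gamma
  by (rule linear_qsym_gamma)

context ranked_poset
begin

definition chains :: "'a \<Rightarrow> 'a list set"
  where "chains x = {xs. xs \<noteq> [] \<and> set xs \<subseteq> A \<and>
    sorted_wrt (\<lambda>x y. (x, y) \<in> r \<and> x \<noteq> y) xs \<and> hd xs = x \<and> last xs = top}"

definition steps :: "'a list \<Rightarrow> nat list"
  where "steps xs = map2 (\<lambda>x y. \<rho> y - \<rho> x) xs (tl xs)"

definition above :: "'a \<Rightarrow> 'a set"
  where "above x = {y \<in> A. (x, y) \<in> r \<and> x \<noteq> y}"

text \<open>The weight of a chain depends only on its rank steps. With \<open>f = cb_mono\<close> this sum is the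
  ab-index; with \<open>f\<close> an indicator it counts the chains with prescribed steps.\<close>

definition chain_sum :: "'a \<Rightarrow> (nat list \<Rightarrow> 'v::ab_group_add) \<Rightarrow> 'v"
  where "chain_sum x f = (\<Sum>xs\<in>chains x. f (steps xs))"

text \<open>The number of multichains from \<open>x\<close> to the top with rank steps \<open>w\<close>. A zero entry of \<open>w\<close> stands
  for a repeated element; multichains, unlike chains, are compatible with products of posets.\<close>

primrec multichains :: "nat list \<Rightarrow> 'a \<Rightarrow> 'k::field"
  where "multichains [] x = (if x = top then 1 else 0)"
  | "multichains (e # w) x = (\<Sum>y\<in>{y \<in> A. (x, y) \<in> r \<and> \<rho> y = \<rho> x + e}. multichains w y)"

lemma finite_chains: "finite (chains x)"
proof (rule finite_subset[OF _ finite_subset_distinct[OF fin]])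
  have "distinct xs" if "sorted_wrt (\<lambda>x y. (x, y) \<in> r \<and> x \<noteq> y) xs" for xs
    using that by (induction xs) auto
  then show "chains x \<subseteq> {xs. set xs \<subseteq> A \<and> distinct xs}"
    by (auto simp: chains_def)
qed

lemma finite_above: "finite (above x)"
  using fin by (simp add: above_def)

lemma above_in: "y \<in> above x \<Longrightarrow> y \<in> A"
  by (simp add: above_def)

lemma rank_above: "y \<in> above x \<Longrightarrow> \<rho> x < \<rho> y"
  using rank_strict by (auto simp: above_def)

lemma chains_top: "chains top = {[top]}"
proof -
  have "ys = []" if "top # ys \<in> chains top" for ys
  proof (rule ccontr)
    assume "ys \<noteq> []"
    moreover have "last ys = top" using \<open>ys \<noteq> []\<close> that by (simp add: chains_def)
    ultimately have "top \<in> set ys" using last_in_set by metis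
    then show False using that by (auto simp: chains_def)
  qed
  moreover have "\<exists>ys. xs = top # ys" if "xs \<in> chains top" for xs
    using that by (cases xs) (auto simp: chains_def)
  moreover have "[top] \<in> chains top" by (simp add: chains_def top)
  ultimately show ?thesis by blast
qed

lemma chains_rec:
  assumes "x \<in> A" "x \<noteq> top"
  shows "chains x = (\<Union>y\<in>above x. (#) x ` chains y)"
proof (intro equalityI subsetI)
  fix xs assume xs: "xs \<in> chains x"
  then obtain ys where ys: "xs = x # ys" by (cases xs) (auto simp: chains_def)
  then have "ys \<noteq> []" using xs assms by (auto simp: chains_def)
  then obtain y zs where "ys = y # zs" by (cases ys) auto
  then have "ys \<in> chains y" "y \<in> above x" using xs ys by (auto simp: chains_def above_def)
  then show "xs \<in> (\<Union>y\<in>above x. (#) x ` chains y)" using ys by blast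
next
  fix xs assume "xs \<in> (\<Union>y\<in>above x. (#) x ` chains y)"
  then obtain y ys where y: "y \<in> above x" "ys \<in> chains y" "xs = x # ys" by blast
  then obtain zs where ys: "ys = y # zs" by (cases ys) (auto simp: chains_def)
  have xy: "(x, y) \<in> r" "x \<noteq> y" using y by (simp_all add: above_def)
  have "(x, z) \<in> r \<and> x \<noteq> z" if "z \<in> set zs" for z
  proof -
    have "(y, z) \<in> r" using y(2) that by (auto simp: chains_def ys)
    then show ?thesis using xy r_trans[of x y z] r_antisym[of x y] by metis
  qed
  then show "xs \<in> chains x" using y xy assms by (auto simp: chains_def ys)
qed

lemma chain_sum_top: "chain_sum top f = f []"
  by (simp add: chain_sum_def chains_top steps_def)

lemma chain_sum_rec:
  assumes "x \<in> A" "x \<noteq> top"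
  shows "chain_sum x f = (\<Sum>y\<in>above x. chain_sum y (\<lambda>p. f ((\<rho> y - \<rho> x) # p)))"
proof -
  have disj: "(#) x ` chains y \<inter> (#) x ` chains y' = {}" if "y \<noteq> y'" for y y'
    using that by (auto simp: chains_def)
  have st: "steps (x # xs) = (\<rho> y - \<rho> x) # steps xs" if "xs \<in> chains y" for xs y
    using that by (cases xs) (auto simp: chains_def steps_def)
  have "chain_sum x f = (\<Sum>y\<in>above x. \<Sum>xs\<in>(#) x ` chains y. f (steps xs))"
    unfolding chain_sum_def chains_rec[OF assms]
    by (rule sum.UNION_disjoint) (simp_all add: finite_above finite_chains disj)
  also have "\<dots> = (\<Sum>y\<in>above x. chain_sum y (\<lambda>p. f ((\<rho> y - \<rho> x) # p)))"
    unfolding chain_sum_def by (rule sum.cong[OF refl]) (subst sum.reindex, auto simp: st)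
  finally show ?thesis .
qed

lemma steps_nonempty_pos:
  assumes "xs \<in> chains x"
  shows "x \<noteq> top \<Longrightarrow> steps xs \<noteq> []" "0 \<notin> set (steps xs)"
proof -
  show "x \<noteq> top \<Longrightarrow> steps xs \<noteq> []"
    using assms by (cases xs; cases "tl xs") (auto simp: chains_def steps_def)
  have "0 \<notin> set (steps xs)" if "set xs \<subseteq> A" "sorted_wrt (\<lambda>x y. (x, y) \<in> r \<and> x \<noteq> y) xs" for xs
    using that
  proof (induction xs rule: induct_list012)
    case (3 x y xs)
    then have "\<rho> x < \<rho> y" using rank_strict[of x y] by auto
    then show ?case using 3 by (auto simp: steps_def)
  qed (simp_all add: steps_def)
  then show "0 \<notin> set (steps xs)" using assms by (simp add: chains_def)
qed

lemma multichains_0: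
  assumes "x \<in> A"
  shows "multichains (0 # w) x = multichains w x"
proof -
  have "{y \<in> A. (x, y) \<in> r \<and> \<rho> y = \<rho> x + 0} = {x}"
    using assms r_refl[OF assms] rank_strict by fastforce
  then show ?thesis by simp
qed

lemma multichains_filter: "x \<in> A \<Longrightarrow> multichains (filter (\<lambda>e. 0 < e) w) x = multichains w x"
proof (induction w arbitrary: x)
  case (Cons e w)
  then show ?case
    by (cases "e = 0") (simp_all add: multichains_0 del: multichains.simps(2), simp)
qed simp

text \<open>A multichain without zero steps is a chain.\<close>

lemma chain_sum_indicator:
  assumes "0 \<notin> set p" "x \<in> A"
  shows "chain_sum x (\<lambda>q. if q = p then 1 else 0) = (multichains p x :: 'k::field)"
  using assms
proof (induction p arbitrary: x)
  case Nil
  show ?case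
  proof (cases "x = top")
    case False
    then show ?thesis using Nil by (simp add: chain_sum_rec) (simp add: chain_sum_def)
  qed (simp add: chain_sum_top)
next
  case (Cons e p)
  show ?case
  proof (cases "x = top")
    case True
    have "{y \<in> A. (top, y) \<in> r \<and> \<rho> y = \<rho> top + e} = {}"
      using Cons.prems rank_mono[OF top(2)] by force
    then have "multichains (e # p) x = (0 :: 'k)" unfolding multichains.simps True by (simp only: sum.empty)
    then show ?thesis using True by (simp add: chain_sum_top del: multichains.simps)
  next
    case False
    have "chain_sum x (\<lambda>q. if q = e # p then 1 else 0)
        = (\<Sum>y\<in>above x. if \<rho> y = \<rho> x + e then multichains p y else (0 :: 'k))"
      unfolding chain_sum_rec[OF Cons.prems(2) False]
    proof (rule sum.cong[OF refl])
      fix y assume y: "y \<in> above x"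
      then have "\<rho> y - \<rho> x = e \<longleftrightarrow> \<rho> y = \<rho> x + e" using rank_above by force
      then show "chain_sum y (\<lambda>q. if (\<rho> y - \<rho> x) # q = e # p then 1 else 0)
          = (if \<rho> y = \<rho> x + e then multichains p y else (0 :: 'k))"
        using Cons.IH[OF _ above_in[OF y]] Cons.prems(1)
        by (cases "\<rho> y = \<rho> x + e") (simp_all, simp add: chain_sum_def)
    qed
    also have "\<dots> = (\<Sum>y\<in>{y \<in> above x. \<rho> y = \<rho> x + e}. multichains p y)"
      by (rule sum.inter_filter[OF finite_above, symmetric])
    also have "{y \<in> above x. \<rho> y = \<rho> x + e} = {y \<in> A. (x, y) \<in> r \<and> \<rho> y = \<rho> x + e}"
      using Cons.prems(1) by (auto simp: above_def)
    finally show ?thesis by simp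
  qed
qed

lemma ab_index_eq_chain_sum: "ab_index A r = chain_sum bot cb_mono"
proof -
  have "full_chains A r = chains bot"
    by (simp add: full_chains_def chains_def poset_bot_eq poset_top_eq)
  moreover have eq: "map2 (\<lambda>x y. (ab_a - ab_b) ^ (poset_rank A r y - poset_rank A r x - 1)) xs (tl xs)
      = map2 (\<lambda>x y. (ab_a - ab_b) ^ (\<rho> y - \<rho> x - 1)) xs (tl xs)" if "xs \<in> chains bot" for xs
  proof (rule map_cong[OF refl], clarify)
    fix x y assume "(x, y) \<in> set (zip xs (tl xs))"
    then have "x \<in> set xs" "y \<in> set xs"
      by (cases xs; auto dest: set_zip_leftD set_zip_rightD)+
    then have "x \<in> A" "y \<in> A" using that by (auto simp: chains_def)
    then show "(ab_a - ab_b) ^ (poset_rank A r y - poset_rank A r x - 1)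
        = (ab_a - ab_b) ^ (\<rho> y - \<rho> x - 1)"
      by (simp only: poset_rank_eq)
  qed
  ultimately show ?thesis
    unfolding ab_index_def chain_sum_def cb_mono_def
    by (intro sum.cong, simp) (simp only: eq, simp add: steps_def o_def case_prod_unfold)
qed

text \<open>Since \<^const>\<open>qsym_gamma\<close> turns the weight of a chain into the monomial function of its rank steps,
  the coefficients count chains. The hypothesis excludes the one-element poset, whose only chain has
  the empty sequence of steps.\<close>

lemma qc_gamma_ab_index:
  assumes "bot \<noteq> top"
  shows "qc (qsym_gamma (ab_index A r) :: 'k::field qsym) w = multichains w bot"
proof -
  let ?w = "filter (\<lambda>e. 0 < e) w"
  have "qsym_gamma (ab_index A r) = (chain_sum bot qM :: 'k qsym)"
    unfolding ab_index_eq_chain_sum chain_sum_def qsym_gamma.sum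
    by (rule sum.cong[OF refl], rule qsym_gamma_cb_mono)
      (simp_all add: steps_nonempty_pos(1)[OF _ assms] steps_nonempty_pos(2))
  then have "qc (qsym_gamma (ab_index A r)) w = (chain_sum bot (\<lambda>p. if p = ?w then 1 else 0) :: 'k)"
    unfolding chain_sum_def by (auto simp: qc_sum qc_qM intro!: sum.cong)
  also have "\<dots> = multichains w bot"
    using bot(1) by (subst chain_sum_indicator) (simp_all add: multichains_filter)
  finally show ?thesis .
qed

end

text \<open>A multichain in a product is a pair of multichains of the same length, and ranks add up: a
  step of size \<open>e\<close> splits into steps of sizes \<open>a\<close> and \<open>e - a\<close> in the two factors.\<close>

lemma multichains_prod:
  assumes "ranked_poset A r \<rho> b t" "ranked_poset B s \<sigma> b' t'" "x \<in> A" "y \<in> B"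
  shows "ranked_poset.multichains (A \<times> B) (prod_rel r s) (\<lambda>(x, y). \<rho> x + \<sigma> y) (t, t') w (x, y)
    = (split_prod (\<lambda>u. ranked_poset.multichains A r \<rho> t u x) (\<lambda>v. ranked_poset.multichains B s \<sigma> t' v y) w
      :: 'k::field)"
proof -
  interpret P: ranked_poset A r \<rho> b t by fact
  interpret Q: ranked_poset B s \<sigma> b' t' by fact
  interpret PQ: ranked_poset "A \<times> B" "prod_rel r s" "\<lambda>(x, y). \<rho> x + \<sigma> y" "(b, b')" "(t, t')"
    by (rule ranked_poset_prod) fact+
  show ?thesis using assms(3,4)
  proof (induction w arbitrary: x y)
    case Nil
    then show ?case by (simp add: split_prod_def)
  next
    case (Cons e w)
    let ?U = "\<lambda>a. {x' \<in> A. (x, x') \<in> r \<and> \<rho> x' = \<rho> x + a}"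
    let ?V = "\<lambda>a. {y' \<in> B. (y, y') \<in> s \<and> \<sigma> y' = \<sigma> y + a}"
    let ?S = "{z \<in> A \<times> B. ((x, y), z) \<in> prod_rel r s \<and>
      (case z of (x', y') \<Rightarrow> \<rho> x' + \<sigma> y') = (case (x, y) of (x', y') \<Rightarrow> \<rho> x' + \<sigma> y') + e}"
    have S: "{z \<in> ?S. \<rho> (fst z) - \<rho> x = a} = ?U a \<times> ?V (e - a)" if "a \<le> e" for a
      using that P.rank_mono Q.rank_mono by (fastforce simp: prod_rel_def)
    \<comment> \<open>The elements \<open>e\<close> ranks above \<open>(x, y)\<close> are grouped by the rank step in the first factor.\<close>
    have "(\<lambda>z. \<rho> (fst z) - \<rho> x) ` ?S \<subseteq> {..e}"
      using Q.rank_mono by (fastforce simp: prod_rel_def)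
    moreover have "finite ?S" using P.fin Q.fin by simp
    ultimately have "(\<Sum>a\<le>e. \<Sum>z\<in>{z \<in> ?S. \<rho> (fst z) - \<rho> x = a}. PQ.multichains w z :: 'k)
        = sum (PQ.multichains w) ?S"
      by (intro sum.group) simp_all
    then have "(PQ.multichains (e # w) (x, y) :: 'k)
        = (\<Sum>a\<le>e. \<Sum>z\<in>{z \<in> ?S. \<rho> (fst z) - \<rho> x = a}. PQ.multichains w z)"
      unfolding PQ.multichains.simps by (rule sym)
    also have "\<dots> = (\<Sum>a\<le>e. \<Sum>x'\<in>?U a. \<Sum>y'\<in>?V (e - a). PQ.multichains w (x', y'))"
      by (intro sum.cong refl) (simp only: S atMost_iff sum.cartesian_product case_prod_eta)
    also have "\<dots> = (\<Sum>a\<le>e. \<Sum>x'\<in>?U a. \<Sum>y'\<in>?V (e - a). \<Sum>(u, v)\<in>esplits w.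
        P.multichains u x' * Q.multichains v y')"
      by (intro sum.cong refl) (simp add: Cons.IH split_prod_def)
    also have "\<dots> = (\<Sum>a\<le>e. \<Sum>(u, v)\<in>esplits w. \<Sum>x'\<in>?U a. \<Sum>y'\<in>?V (e - a).
        P.multichains u x' * Q.multichains v y')"
      by (simp only: case_prod_unfold sum.swap[of _ "esplits w"])
    also have "\<dots> = split_prod (\<lambda>u. P.multichains u x) (\<lambda>v. Q.multichains v y) (e # w)"
      by (simp add: split_prod_def sum_esplits_Cons sum_product)
    finally show ?case .
  qed
qed

text \<open>Both sides have the same coefficients: multichain counts multiply by \<^const>\<open>split_prod\<close>, which is
  also the rule for the product of power series.\<close>

lemma gamma_ab_index_prod:
  assumes "graded_poset A r" "total_rank A r \<ge> 1" "graded_poset B s" "total_rank B s \<ge> 1"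
  shows "qsym_gamma (ab_index (A \<times> B) (prod_rel r s))
    = qsym_gamma (ab_index A r) * (qsym_gamma (ab_index B s) :: 'k::field qsym)"
proof -
  obtain \<rho> b t \<sigma> b' t' where PQ: "ranked_poset A r \<rho> b t" "ranked_poset B s \<sigma> b' t'"
    using assms graded_posetE by metis
  interpret P: ranked_poset A r \<rho> b t by fact
  interpret Q: ranked_poset B s \<sigma> b' t' by fact
  interpret PQ: ranked_poset "A \<times> B" "prod_rel r s" "\<lambda>(x, y). \<rho> x + \<sigma> y" "(b, b')" "(t, t')"
    by (rule ranked_poset_prod) fact+
  have ne: "b \<noteq> t" "b' \<noteq> t'"
    using assms P.total_rank_eq Q.total_rank_eq P.rank_bot Q.rank_bot by auto
  show ?thesis
    by (rule qsym_eqI_qc)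
      (simp add: qc_mult PQ.qc_gamma_ab_index P.qc_gamma_ab_index Q.qc_gamma_ab_index
        ne multichains_prod[OF PQ P.bot(1) Q.bot(1)] split_prod_def)
qed

section \<open>From characters on posets to characters on quasisymmetric functions\<close>

lemma cb_mono_one [simp]: "cb_mono [Suc 0] = 1"
  by (simp add: cb_mono_def)

lemma cb_mono_1_Cons: "p \<noteq> [] \<Longrightarrow> cb_mono (Suc 0 # p) = ab_b * cb_mono p"
  by (cases p) (simp_all add: cb_mono_def)

lemma cb_mono_Suc_Cons: "k \<ge> 1 \<Longrightarrow> cb_mono (Suc k # p) = (ab_a - ab_b) * cb_mono (k # p)"
  by (cases p; cases k) (simp_all add: cb_mono_def mult.assoc)

text \<open>The words in \<open>a - b\<close> and \<open>b\<close> span, because substituting \<open>a - b\<close> for \<open>a\<close> is invertible.\<close>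

lemma cb_mono_induct [case_names add scale mono]:
  fixes u :: "'k::field ab_poly"
  assumes "\<And>u v. P u \<Longrightarrow> P v \<Longrightarrow> P (u + v)" "\<And>c u. P u \<Longrightarrow> P (pm_scale c u)"
    and "\<And>p. p \<noteq> [] \<Longrightarrow> 0 \<notin> set p \<Longrightarrow> P (cb_mono p)"
  shows "P u"
proof -
  interpret s: Vector_Spaces.linear pm_scale pm_scale "ab_subst (ab_a - ab_b :: 'k ab_poly)"
    by (rule linear_ab_subst)
  have z: "P 0"
  proof -
    have "pm_scale 0 (cb_mono [1]) = (0 :: 'k ab_poly)" by (rule poly_mapping_eqI) simp
    then show ?thesis using assms(2)[OF assms(3)[of "[1]"], of 0] by simp
  qed
  have "P (ab_subst (ab_a - ab_b) (ab_word w))" for w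
    using assms(3)[of "comp_of_word w"] comp_of_word[of w] ab_basis_eq[of "comp_of_word w", where 'k = 'k]
    by (simp add: cb_mono_def word_of_comp_of_word)
  then have "P (ab_subst (ab_a - ab_b) v)" for v
    by (induction v rule: pm_induct) (simp_all add: s.zero s.add s.scale z assms)
  from this[of "ab_subst (ab_a + ab_b) u"] show ?thesis by (simp add: ab_subst_plus_minus)
qed

text \<open>The factor contributed to an ab-index by a level with one element (\<open>a\<close>) or two elements
  (\<open>a + b\<close>); see \<open>ab_index_level\<close>.\<close>

definition level_letter :: "bool \<Rightarrow> 'k::field ab_poly"
  where "level_letter c = (if c then ab_a + ab_b else ab_a)"

text \<open>The products of letters \<open>a\<close> and \<open>a + b\<close> span over every field, in any characteristic, since
  \<open>b = (a + b) - a\<close>. Hence ab-indices of posets span the whole algebra. In the induction a word is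
  traded, from its last letter on, for products of the new letters.\<close>

lemma level_letter_induct [case_names add scale prod]:
  fixes u :: "'k::field ab_poly"
  assumes "\<And>u v. P u \<Longrightarrow> P v \<Longrightarrow> P (u + v)" "\<And>c u. P u \<Longrightarrow> P (pm_scale c u)"
    and "\<And>w. P (prod_list (map level_letter w))"
  shows "P u"
proof -
  have z: "P 0"
  proof -
    have "pm_scale 0 1 = (0 :: 'k ab_poly)" by (rule poly_mapping_eqI) simp
    then show ?thesis using assms(2)[OF assms(3)[of "[]"], of 0] by simp
  qed
  have one: "ab_word [] = (1 :: 'k ab_poly)" by (simp flip: zero_list_def)
  have word_snoc: "ab_word (u @ [l]) = (ab_word u * ab_word [l] :: 'k ab_poly)" for u l
    by (simp add: mult_single plus_list_def)
  have neg: "pm_scale (- 1) u = - u" for u :: "'k ab_poly"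
    by (rule poly_mapping_eqI) simp
  have "P (ab_word u * prod_list (map level_letter w))" for u w
  proof (induction u arbitrary: w rule: rev_induct)
    case Nil
    show ?case using assms(3) by (simp add: one)
  next
    case (snoc l u)
    show ?case
    proof (cases l)
      case LA
      then have "ab_word (u @ [l]) * prod_list (map level_letter w)
          = (ab_word u * prod_list (map level_letter (False # w)) :: 'k ab_poly)"
        by (simp add: word_snoc level_letter_def mult.assoc)
      then show ?thesis using snoc[of "False # w"] by simp
    next
      case LB
      then have "ab_word (u @ [l]) * prod_list (map level_letter w)
          = (ab_word u * prod_list (map level_letter (True # w))
            + pm_scale (- 1) (ab_word u * prod_list (map level_letter (False # w))) :: 'k ab_poly)"
        by (simp add: word_snoc level_letter_def mult.assoc neg algebra_simps)
      then show ?thesis using assms(1)[OF snoc[of "True # w"] assms(2)[OF snoc[of "False # w"], of "- 1"]] by (simp add: neg)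
    qed
  qed
  from this[of _ "[]"] show ?thesis
    by (induction u rule: pm_induct) (simp_all add: z assms)
qed

subsection \<open>Posets with levels of one or two elements\<close>

text \<open>An ordinal sum of antichains: the bottom element \<open>0\<close>, then for \<open>1 \<le> i \<le> length w\<close> a level
  consisting of \<open>2 * i\<close> and, if \<open>w ! (i - 1)\<close> holds, also \<open>2 * i + 1\<close>, and finally a top element. The
  rank of \<open>x\<close> is \<open>x div 2\<close>, and elements of different levels are always comparable.\<close>

definition level_set :: "bool list \<Rightarrow> nat set"
  where "level_set w = {x. even x \<and> x div 2 \<le> Suc (length w) \<or>
    odd x \<and> 1 \<le> x div 2 \<and> x div 2 \<le> length w \<and> w ! (x div 2 - 1)}"

definition level_rel :: "bool list \<Rightarrow> nat rel"
  where "level_rel w = {(x, y). x \<in> level_set w \<and> y \<in> level_set w \<and> (x = y \<or> x div 2 < y div 2)}"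

definition level_top :: "bool list \<Rightarrow> nat"
  where "level_top w = 2 * Suc (length w)"

lemma level_top_div [simp]: "level_top w div 2 = Suc (length w)"
  by (simp add: level_top_def)

lemma level_top_in: "level_top w \<in> level_set w"
  by (simp add: level_top_def level_set_def)

lemma level_rel_iff:
  "(x, y) \<in> level_rel w \<and> x \<noteq> y \<longleftrightarrow> x \<in> level_set w \<and> y \<in> level_set w \<and> x div 2 < y div 2"
  by (auto simp: level_rel_def)

lemma level_topI: "x \<in> level_set w \<Longrightarrow> x div 2 = Suc (length w) \<Longrightarrow> x = level_top w"
  by (auto simp: level_set_def level_top_def)

lemma level_le: "x \<in> level_set w \<Longrightarrow> x div 2 \<le> Suc (length w)"
  by (auto simp: level_set_def)

lemma ranked_poset_level:
  "ranked_poset (level_set w) (level_rel w) (\<lambda>x. x div 2) 0 (level_top w)"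
proof
  show "finite (level_set w)"
    by (rule finite_subset[of _ "{..level_top w + 1}"]) (auto simp: level_set_def level_top_def)
  show "partial_order_on (level_set w) (level_rel w)"
    unfolding partial_order_on_def preorder_on_def refl_on_def
    by (auto simp: level_rel_def intro!: transI antisymI)
  show "0 \<in> level_set w" "level_top w \<in> level_set w"
    by (simp add: level_set_def, rule level_top_in)
  then show "(0, x) \<in> level_rel w" if "x \<in> level_set w" for x
    using that by (auto simp: level_rel_def level_set_def)
  show "(x, level_top w) \<in> level_rel w" if "x \<in> level_set w" for x
    using that level_top_in[of w] level_topI[OF that] level_le[OF that]
    by (auto simp: level_rel_def le_Suc_eq)
  show "(0::nat) div 2 = 0" by simp
next
  fix x y assume cov: "poset_covers (level_set w) (level_rel w) x y"
  have lt: "x div 2 < y div 2" and mem: "x \<in> level_set w" "y \<in> level_set w"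
    using cov by (auto simp: poset_covers_def level_rel_def)
  show "y div 2 = x div 2 + 1"
  proof (rule ccontr)
    assume "y div 2 \<noteq> x div 2 + 1"
    then have *: "x div 2 + 1 < y div 2" using lt by simp
    let ?z = "2 * (x div 2 + 1)"
    have z: "?z div 2 = x div 2 + 1" by simp
    have "y div 2 \<le> Suc (length w)" using mem(2) by (auto simp: level_set_def)
    then have "?z \<in> level_set w" using * by (simp add: level_set_def)
    moreover have "(x, ?z) \<in> level_rel w" "(?z, y) \<in> level_rel w"
      using calculation mem * z by (simp_all add: level_rel_def)
    moreover have "?z \<noteq> x" "?z \<noteq> y" using z * lt by (metis less_irrefl less_add_one)+
    ultimately show False using cov unfolding poset_covers_def by metis
  qed
qed

text \<open>Let \<open>\<psi>\<^sub>i\<close> be the weighted sum of the chains from an element of level \<open>i\<close> to the top. A chain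
  from level \<open>i\<close> next visits either one of the \<open>m\<close> elements of level \<open>i + 1\<close>, with weight
  \<open>m b \<psi>\<^sub>i\<^sub>+\<^sub>1\<close>, or an element above them; the chains of the second kind have the weights of those from
  level \<open>i + 1\<close> multiplied by one more factor \<open>a - b\<close>. So \<open>\<psi>\<^sub>i = (a + (m - 1) b) \<psi>\<^sub>i\<^sub>+\<^sub>1\<close>.\<close>

lemma ab_index_level:
  "ab_index (level_set w) (level_rel w) = prod_list (map level_letter w)"
proof -
  interpret ranked_poset "level_set w" "level_rel w" "\<lambda>x. x div 2" 0 "level_top w"
    by (rule ranked_poset_level)
  have above_iff: "y \<in> above x \<longleftrightarrow> x \<in> level_set w \<and> y \<in> level_set w \<and> x div 2 < y div 2" for x y
    using level_rel_iff[of x y w] unfolding above_def by blast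
  have "chain_sum x cb_mono = (prod_list (map level_letter (drop (x div 2) w)) :: 'k::field ab_poly)"
    if "x \<in> level_set w" "x div 2 \<le> length w" for x
    using that
  proof (induction "length w - x div 2" arbitrary: x)
    case 0
    then have x: "x div 2 = length w" by simp
    then have ne: "x \<noteq> level_top w" by auto
    have "y \<in> level_set w \<and> length w < y div 2 \<longleftrightarrow> y = level_top w" for y
    proof
      assume y: "y \<in> level_set w \<and> length w < y div 2"
      then have "y div 2 = Suc (length w)" using level_le[of y w] by linarith
      then show "y = level_top w" using y level_topI by blast
    qed (simp add: level_top_in)
    then have "above x = {level_top w}"
      using 0 x by (intro set_eqI) (simp add: above_iff)
    then show ?case
      using 0 ne by (simp add: chain_sum_rec chain_sum_top x)
  next
    case (Suc d)
    define i where "i = x div 2"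
    \<comment> \<open>\<open>z\<close> is the element of level \<open>i + 1\<close> that always exists, \<open>L\<close> the whole level.\<close>
    define z where "z = 2 * Suc i"
    define R where "R = (prod_list (map level_letter (drop (Suc i) w)) :: 'k ab_poly)"
    define L where "L = {y \<in> level_set w. y div 2 = Suc i}"
    have i: "i < length w" using Suc by (simp add: i_def)
    have xtop: "x \<noteq> level_top w" using i by (auto simp: i_def)
    have zL: "z \<in> L" using i by (simp add: L_def z_def level_set_def)
    then have z: "z \<in> level_set w" "z div 2 = Suc i" by (auto simp: L_def)
    have ztop: "z \<noteq> level_top w" using i z(2) by auto
    have IH: "chain_sum y cb_mono = R" if "y \<in> L" for y
      using Suc.hyps(1)[of y] Suc.hyps(2) Suc.prems that i by (simp add: L_def R_def i_def)
    have L: "L = (if w ! i then {z, Suc z} else {z})"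
    proof -
      have "y div 2 = Suc i \<longleftrightarrow> y = z \<or> y = Suc z" for y unfolding z_def by arith
      moreover have "Suc z \<in> level_set w \<longleftrightarrow> w ! i" using i by (simp add: level_set_def z_def)
      ultimately show ?thesis using z(1) by (auto simp: L_def)
    qed
    have ab: "above x = L \<union> above z" "L \<inter> above z = {}"
      using Suc.prems(1) z by (auto simp: above_iff L_def i_def)
    have "chain_sum x cb_mono
        = (\<Sum>y\<in>L. chain_sum y (\<lambda>p. cb_mono (Suc 0 # p)))
          + (\<Sum>y\<in>above z. chain_sum y (\<lambda>p. cb_mono ((y div 2 - i) # p)) :: 'k ab_poly)"
    proof -
      have "finite L" using fin by (simp add: L_def)
      then have "chain_sum x cb_mono
          = (\<Sum>y\<in>L. chain_sum y (\<lambda>p. cb_mono ((y div 2 - i) # p)))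
          + (\<Sum>y\<in>above z. chain_sum y (\<lambda>p. cb_mono ((y div 2 - i) # p)) :: 'k ab_poly)"
        using chain_sum_rec[OF Suc.prems(1) xtop, of cb_mono]
        by (simp add: ab sum.union_disjoint finite_above i_def)
      then show ?thesis by (simp add: L_def)
    qed
    also have "(\<Sum>y\<in>L. chain_sum y (\<lambda>p. cb_mono (Suc 0 # p))) = (\<Sum>y\<in>L. ab_b * R)"
    proof (rule sum.cong[OF refl])
      fix y assume y: "y \<in> L"
      then have "y \<noteq> level_top w" using i by (auto simp: L_def)
      then have "chain_sum y (\<lambda>p. cb_mono (Suc 0 # p)) = ab_b * (chain_sum y cb_mono :: 'k ab_poly)"
        unfolding chain_sum_def sum_distrib_left
        by (intro sum.cong refl cb_mono_1_Cons steps_nonempty_pos(1))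
      then show "chain_sum y (\<lambda>p. cb_mono (Suc 0 # p)) = ab_b * R" by (simp only: IH[OF y])
    qed
    also have "(\<Sum>y\<in>above z. chain_sum y (\<lambda>p. cb_mono ((y div 2 - i) # p)))
        = (ab_a - ab_b) * (chain_sum z cb_mono :: 'k ab_poly)"
      unfolding chain_sum_rec[OF z(1) ztop] sum_distrib_left
    proof (rule sum.cong[OF refl])
      fix y assume "y \<in> above z"
      then have y: "y div 2 - i = Suc (y div 2 - z div 2)" "y div 2 - z div 2 \<ge> 1"
        using rank_above[of y z] z(2) by simp_all
      show "chain_sum y (\<lambda>p. cb_mono ((y div 2 - i) # p))
          = (ab_a - ab_b) * (chain_sum y (\<lambda>p. cb_mono ((y div 2 - z div 2) # p)) :: 'k ab_poly)"
        unfolding chain_sum_def sum_distrib_left y(1) cb_mono_Suc_Cons[OF y(2)] ..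
    qed
    also have "(\<Sum>y\<in>L. ab_b * R) + (ab_a - ab_b) * chain_sum z cb_mono = level_letter (w ! i) * R"
      by (simp add: IH[OF zL] L level_letter_def algebra_simps mult_2)
    also have "\<dots> = prod_list (map level_letter (drop i w))"
      using i by (simp add: R_def Cons_nth_drop_Suc[symmetric])
    finally show ?case by (simp add: i_def)
  qed
  from this[of 0] show ?thesis by (simp add: ab_index_eq_chain_sum bot(1))
qed

subsection \<open>The character on quasisymmetric functions\<close>

lemma qscale_mult_left: "qscale c f * g = qscale c (f * g)"
  by (rule qsym_eqI_qc)
    (simp add: qc_mult split_prod_def sum_distrib_left mult.assoc case_prod_unfold)

text \<open>The functional \<open>f \<mapsto> G (\<gamma>\<^sup>-\<^sup>1 f)\<close> on monomial quasisymmetric functions, extended to the unit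
  by the value \<open>1\<close>.\<close>

definition qchar :: "('k::field ab_poly \<Rightarrow> 'k) \<Rightarrow> nat list \<Rightarrow> 'k"
  where "qchar G p = (if p = [] then 1 else G (cb_mono p))"

definition qsym_char :: "('k::field ab_poly \<Rightarrow> 'k) \<Rightarrow> 'k qsym \<Rightarrow> 'k"
  where "qsym_char G f = lin_ext (*) (qchar G) (qcoords f)"

lemma linear_qsym_char: "Vector_Spaces.linear qscale (*) (qsym_char G)"
proof -
  have "Vector_Spaces.linear qscale (*) (lin_ext (*) (qchar G) \<circ> qcoords)"
    by (intro Vector_Spaces.linear_compose[OF linear_qcoords] linear_lin_ext vector_space_mult)
  then show ?thesis by (simp add: qsym_char_def[abs_def] o_def)
qed

lemma qsym_char_qM: "0 \<notin> set p \<Longrightarrow> qsym_char G (qM p) = qchar G p"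
  by (simp add: qsym_char_def qcoords_qM vector_space_mult)

lemma qsym_decompose:
  obtains u where "f = qscale (qcounit f) 1 + qsym_gamma u"
proof -
  have "qcounit (f - qscale (qcounit f) 1) = 0"
    by (simp add: qcounit_eq_qc flip: qM_Nil) (simp add: qc_qM)
  then obtain u where "f - qscale (qcounit f) 1 = qsym_gamma u"
    using bij_betw_qsym_gamma unfolding bij_betw_def by blast
  then have "f = qscale (qcounit f) 1 + qsym_gamma u" by (simp add: algebra_simps)
  then show thesis by (rule that)
qed

context
  fixes G :: "'k::field ab_poly \<Rightarrow> 'k"
  assumes G: "ab_character G"
begin

interpretation G: Vector_Spaces.linear pm_scale "(*)" G
  using G by (simp add: ab_character_def)

interpretation H: Vector_Spaces.linear qscale "(*)" "qsym_char G"
  by (rule linear_qsym_char)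

lemma qsym_char_gamma: "qsym_char G (qsym_gamma u) = G u"
  by (induction u rule: cb_mono_induct)
    (simp_all add: qsym_gamma.add qsym_gamma.scale H.add H.scale G.add G.scale
      qsym_gamma_cb_mono qsym_char_qM qchar_def)

text \<open>Both sides are bilinear, so by \<open>level_letter_induct\<close> it suffices to take for \<open>u\<close> and \<open>v\<close> the
  ab-indices of posets. There the claim is the defining property of a character, since products of
  posets correspond to products of quasisymmetric functions.\<close>

lemma qsym_char_gamma_mult: "qsym_char G (qsym_gamma u * qsym_gamma v) = G u * G v"
proof (induction u arbitrary: v rule: level_letter_induct)
  case (prod w)
  show ?case
  proof (induction v rule: level_letter_induct)
    case (prod w')
    interpret P: ranked_poset "level_set w" "level_rel w" "\<lambda>x. x div 2" 0 "level_top w"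
      by (rule ranked_poset_level)
    interpret Q: ranked_poset "level_set w'" "level_rel w'" "\<lambda>x. x div 2" 0 "level_top w'"
      by (rule ranked_poset_level)
    note gr = P.graded Q.graded
    have rk: "total_rank (level_set w) (level_rel w) \<ge> 1" "total_rank (level_set w') (level_rel w') \<ge> 1"
      by (simp_all only: P.total_rank_eq Q.total_rank_eq) simp_all
    let ?X = "ab_index (level_set w \<times> level_set w') (prod_rel (level_rel w) (level_rel w')) :: 'k ab_poly"
    have "G ?X = G (prod_list (map level_letter w)) * G (prod_list (map level_letter w'))"
      using G gr rk by (simp add: ab_character_def ab_index_level)
    moreover have "qsym_gamma ?X
        = qsym_gamma (prod_list (map level_letter w)) * qsym_gamma (prod_list (map level_letter w'))"
      using gamma_ab_index_prod[OF gr(1) rk(1) gr(2) rk(2), where 'k = 'k] by (simp add: ab_index_level)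
    ultimately show ?case using qsym_char_gamma[of ?X] by simp
  qed (simp_all add: qsym_gamma.add qsym_gamma.scale distrib_left H.add G.add H.scale G.scale
      mult.commute[of _ "qscale _ _"] qscale_mult_left mult.left_commute,
      metis mult.commute)
qed (simp_all add: qsym_gamma.add qsym_gamma.scale distrib_right H.add G.add
    qscale_mult_left H.scale G.scale)

lemma qsym_char_mult: "qsym_char G (f * g) = qsym_char G f * qsym_char G g"
proof -
  obtain u where u: "f = qscale (qcounit f) 1 + qsym_gamma u" by (rule qsym_decompose)
  obtain v where v: "g = qscale (qcounit g) 1 + qsym_gamma v" by (rule qsym_decompose)
  have one: "qsym_char G 1 = 1" using qsym_char_qM[of "[]" G] by (simp add: qM_Nil qchar_def)
  have "f * g = qscale (qcounit f) (qscale (qcounit g) 1) + qscale (qcounit f) (qsym_gamma v)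
      + (qscale (qcounit g) (qsym_gamma u) + qsym_gamma u * qsym_gamma v)"
  proof -
    have "qsym_gamma u * qscale (qcounit g) 1 = qscale (qcounit g) (qsym_gamma u)"
      by (metis mult.commute mult_1 qscale_mult_left)
    then show ?thesis
      by (subst u, subst v) (simp add: distrib_left distrib_right qscale_mult_left)
  qed
  moreover have "qsym_char G f = qcounit f + G u" "qsym_char G g = qcounit g + G v"
    by (subst u, simp add: H.add H.scale one qsym_char_gamma,
        subst v, simp add: H.add H.scale one qsym_char_gamma)
  ultimately show ?thesis
    by (simp add: H.add H.scale one qsym_char_gamma qsym_char_gamma_mult algebra_simps)
qed

end

section \<open>Products of values on consecutive blocks\<close>

definition comps :: "nat \<Rightarrow> nat list set"
  where "comps s = {q. 0 \<notin> set q \<and> sum_list q = s}"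

lemma finite_comps: "finite (comps s)"
proof (rule finite_subset)
  show "comps s \<subseteq> {q. set q \<subseteq> {..s} \<and> length q \<le> s}"
  proof
    fix q assume q: "q \<in> comps s"
    then have "0 \<notin> set q" by (simp add: comps_def)
    then have "length q \<le> sum_list q" by (induction q) auto
    then show "q \<in> {q. set q \<subseteq> {..s} \<and> length q \<le> s}"
      using q member_le_sum_list[of _ q] by (auto simp: comps_def)
  qed
qed (simp add: finite_lists_length_le)

lemma comps_0: "comps 0 = {[]}"
proof -
  have "q = []" if "q \<in> comps 0" for q
    using that by (cases q) (auto simp: comps_def)
  then show ?thesis by (auto simp: comps_def)
qed

text \<open>For the coefficients \<open>F\<close> of a quasisymmetric function \<open>f\<close>, this is
  \<open>(h\<^bsub>s\<^sub>1\<^esub> \<otimes> \<dots> \<otimes> h\<^bsub>s\<^sub>k\<^esub>)(\<Delta>\<^sup>k f)\<close>, where \<open>h\<^bsub>s\<^esub>\<close> is the functional \<open>h\<close> restricted to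
  degree \<open>s\<close>: since the coproduct is deconcatenation, the coefficient of \<open>\<Delta>\<^sup>k f\<close> at
  \<open>M\<^bsub>q\<^sub>1\<^esub> \<otimes> \<dots> \<otimes> M\<^bsub>q\<^sub>k\<^esub>\<close> is \<open>F (q\<^sub>1 @ \<dots> @ q\<^sub>k)\<close>. Taking functions instead of
  quasisymmetric functions as arguments makes the shift \<open>\<lambda>w. F (q @ w)\<close> available.\<close>

primrec block_coef :: "(nat list \<Rightarrow> 'k::field) \<Rightarrow> nat list \<Rightarrow> (nat list \<Rightarrow> 'k) \<Rightarrow> 'k"
  where "block_coef h [] F = F []"
  | "block_coef h (s # e) F = (\<Sum>q\<in>comps s. h q * block_coef h e (\<lambda>w. F (q @ w)))"

lemma block_coef_sum: "block_coef h e (\<lambda>w. \<Sum>j\<in>J. F j w) = (\<Sum>j\<in>J. block_coef h e (F j))"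
  by (induction e arbitrary: F) (simp_all add: sum_distrib_left sum.swap[of _ J])

lemma block_coef_scale: "block_coef h e (\<lambda>w. c * F w) = c * block_coef h e F"
  by (induction e arbitrary: F) (simp_all add: sum_distrib_left mult.left_commute)

lemma block_coef_scale_right: "block_coef h e (\<lambda>w. F w * c) = block_coef h e F * c"
  using block_coef_scale[of h e c F] by (simp add: mult.commute)

lemma block_coef_add: "block_coef h e (\<lambda>w. F w + F' w) = block_coef h e F + block_coef h e F'"
  by (induction e arbitrary: F F') (simp_all add: sum.distrib distrib_left)

lemma block_coef_cong:
  assumes "\<And>w. 0 \<notin> set w \<Longrightarrow> F w = F' w"
  shows "block_coef h e F = block_coef h e F'"
  using assms
proof (induction e arbitrary: F F')
  case (Cons s e)
  have "block_coef h e (\<lambda>w. F (q @ w)) = block_coef h e (\<lambda>w. F' (q @ w))" if "q \<in> comps s" for q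
    using that by (intro Cons.IH Cons.prems) (simp add: comps_def)
  then show ?case by simp
qed simp

text \<open>This is coassociativity, and the reason why the chain map preserves the coproduct.\<close>

lemma block_coef_append: "block_coef h (x @ y) F = block_coef h x (\<lambda>w. block_coef h y (\<lambda>w'. F (w @ w')))"
  by (induction x arbitrary: F) simp_all

text \<open>The only composition of \<open>0\<close> is the empty one, on which \<open>h\<close> has the value \<open>1\<close>; a zero entry
  therefore contributes the counit.\<close>

lemma block_coef_filter:
  assumes "h [] = 1"
  shows "block_coef h (filter (\<lambda>x. 0 < x) e) F = block_coef h e F"
  by (induction e arbitrary: F) (auto simp: comps_0 assms)

subsection \<open>Multiplicativity\<close>

text \<open>Coefficient functions of quasisymmetric functions have this property, and unlike the property
  of being such a function it passes immediately to the shifts \<open>\<lambda>w. F (x @ w)\<close> and to the functions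
  \<open>\<lambda>x. block_coef h u (\<lambda>w. F (x @ w))\<close> that the induction over blocks produces.\<close>

definition zero_insensitive :: "(nat list \<Rightarrow> 'k) \<Rightarrow> bool"
  where "zero_insensitive F \<longleftrightarrow> (\<forall>w. F (filter (\<lambda>x. 0 < x) w) = F w)"

lemma zero_insensitive_qc: "zero_insensitive (qc f)"
  by (simp add: zero_insensitive_def qc_filter)

lemma zero_insensitive_append_left:
  assumes "zero_insensitive F"
  shows "F (filter (\<lambda>x. 0 < x) x @ w) = F (x @ w)"
proof -
  have "filter (\<lambda>x. 0 < x) (filter (\<lambda>x. 0 < x) x @ w) = filter (\<lambda>x. 0 < x) (x @ w)" by simp
  then show ?thesis using assms unfolding zero_insensitive_def by metis
qed

lemma zero_insensitive_shift:
  assumes "zero_insensitive F"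
  shows "zero_insensitive (\<lambda>w. F (x @ w))"
  unfolding zero_insensitive_def
proof
  fix w
  have "filter (\<lambda>x. 0 < x) (x @ filter (\<lambda>x. 0 < x) w) = filter (\<lambda>x. 0 < x) (x @ w)" by simp
  then show "F (x @ filter (\<lambda>x. 0 < x) w) = F (x @ w)"
    using assms unfolding zero_insensitive_def by metis
qed

lemma zero_insensitive_block_coef:
  "zero_insensitive F \<Longrightarrow> zero_insensitive (\<lambda>x. block_coef h u (\<lambda>w. F (x @ w)))"
  by (simp add: zero_insensitive_def[of "\<lambda>x. block_coef h u (\<lambda>w. F (x @ w))"]
      zero_insensitive_append_left)

lemma esplits_sum_list: "(x, y) \<in> esplits w \<Longrightarrow> sum_list x + sum_list y = sum_list w"
proof (induction w arbitrary: x y)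
  case Nil
  then show ?case by (simp add: esplits_Nil)
next
  case (Cons e w)
  then show ?case by (fastforce simp: in_esplits_Cons)
qed

text \<open>Multiplicativity of \<open>h\<close>, degree by degree:
  \<open>h\<^bsub>s\<^esub>(f g) = \<Sum>\<^bsub>a + b = s\<^esub> h\<^bsub>a\<^esub>(f) h\<^bsub>b\<^esub>(g)\<close>. It is the case of a single block in
  \<open>block_coef_split_prod\<close>.\<close>

definition homog_mult :: "(nat list \<Rightarrow> 'k::field) \<Rightarrow> bool"
  where "homog_mult h \<longleftrightarrow> (\<forall>s X Y. zero_insensitive X \<longrightarrow> zero_insensitive Y \<longrightarrow>
    block_coef h [s] (split_prod X Y) = split_prod (\<lambda>u. block_coef h u X) (\<lambda>v. block_coef h v Y) [s])"

text \<open>The coproduct is multiplicative: here this is the fact that splittings of \<open>q @ w\<close> are pairs of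
  splittings of \<open>q\<close> and of \<open>w\<close>. The first block is then handled by multiplicativity of \<open>h\<close>, the
  remaining ones by induction.\<close>

lemma block_coef_split_prod:
  fixes h :: "nat list \<Rightarrow> 'k::field"
  assumes h: "homog_mult h"
    and "zero_insensitive F" "zero_insensitive F'"
  shows "block_coef h e (split_prod F F') = split_prod (\<lambda>u. block_coef h u F) (\<lambda>v. block_coef h v F') e"
  using assms(2,3)
proof (induction e arbitrary: F F')
  case Nil
  then show ?case by (simp add: split_prod_def)
next
  case (Cons s e)
  let ?T = "\<lambda>u x. block_coef h u (\<lambda>w. F (x @ w))" and ?T' = "\<lambda>u x. block_coef h u (\<lambda>w. F' (x @ w))"
  have app: "split_prod F F' (q @ w)
      = (\<Sum>(x, y)\<in>esplits q. split_prod (\<lambda>w. F (x @ w)) (\<lambda>w. F' (y @ w)) w)" for q w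
    by (simp add: split_prod_def sum_esplits_append)
  have inner: "block_coef h e (\<lambda>w. split_prod F F' (q @ w)) = (\<Sum>(u, v)\<in>esplits e. split_prod (?T u) (?T' v) q)" for q
  proof -
    have "block_coef h e (\<lambda>w. split_prod F F' (q @ w))
        = (\<Sum>(x, y)\<in>esplits q. block_coef h e (split_prod (\<lambda>w. F (x @ w)) (\<lambda>w. F' (y @ w))))"
      by (simp add: app block_coef_sum case_prod_unfold)
    also have "\<dots> = (\<Sum>(x, y)\<in>esplits q. \<Sum>(u, v)\<in>esplits e. ?T u x * ?T' v y)"
      by (simp add: Cons zero_insensitive_shift split_prod_def)
    also have "\<dots> = (\<Sum>(u, v)\<in>esplits e. split_prod (?T u) (?T' v) q)"
      unfolding split_prod_def case_prod_unfold by (rule sum.swap)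
    finally show ?thesis .
  qed
  have "block_coef h (s # e) (split_prod F F')
      = (\<Sum>(u, v)\<in>esplits e. \<Sum>q\<in>comps s. h q * split_prod (?T u) (?T' v) q)"
    by (simp add: inner sum_distrib_left sum.swap[of _ "esplits e"] case_prod_unfold)
  also have "\<dots> = (\<Sum>(u, v)\<in>esplits e. block_coef h [s] (split_prod (?T u) (?T' v)))"
    by simp
  also have "\<dots> = (\<Sum>(u, v)\<in>esplits e. \<Sum>a\<le>s. block_coef h (a # u) F * block_coef h ((s - a) # v) F')"
  proof (rule sum.cong[OF refl], clarify)
    fix u v
    have "block_coef h [s] (split_prod (?T u) (?T' v))
        = split_prod (\<lambda>a. block_coef h a (?T u)) (\<lambda>a. block_coef h a (?T' v)) [s]"
      using h Cons.prems unfolding homog_mult_def by (blast intro: zero_insensitive_block_coef)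
    then show "block_coef h [s] (split_prod (?T u) (?T' v))
        = (\<Sum>a\<le>s. block_coef h (a # u) F * block_coef h ((s - a) # v) F')"
      by (simp add: split_prod_def sum_esplits_Cons)
  qed
  also have "\<dots> = split_prod (\<lambda>u. block_coef h u F) (\<lambda>v. block_coef h v F') (s # e)"
    unfolding split_prod_def sum_esplits_Cons
    by (simp only: case_prod_unfold sum.swap[of _ "esplits e"])
  finally show ?case .
qed

lemma qsym_char_homogeneous:
  assumes "\<And>q. 0 \<notin> set q \<Longrightarrow> qc f q \<noteq> 0 \<Longrightarrow> sum_list q = s"
  shows "qsym_char G f = (\<Sum>q\<in>comps s. qchar G q * qc f q)"
proof -
  have "Poly_Mapping.keys (qcoords f) \<subseteq> comps s"
    using assms by (auto simp: in_keys_iff lookup_qcoords comps_def split: if_splits)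
  then have "qsym_char G f = (\<Sum>q\<in>comps s. Poly_Mapping.lookup (qcoords f) q * qchar G q)"
    unfolding qsym_char_def by (rule lin_ext_superset[OF vector_space_mult finite_comps])
  also have "\<dots> = (\<Sum>q\<in>comps s. qchar G q * qc f q)"
    by (rule sum.cong) (simp_all add: lookup_qcoords comps_def)
  finally show ?thesis .
qed

text \<open>Apply multiplicativity of the functional to the homogeneous quasisymmetric functions whose
  coefficients are \<open>X\<close> in degree \<open>a\<close> and \<open>Y\<close> in degree \<open>s - a\<close>, and sum over \<open>a\<close>.\<close>

lemma homog_mult_qchar:
  assumes G: "ab_character G"
  shows "homog_mult (qchar G)"
  unfolding homog_mult_def
proof (intro allI impI)
  fix s and X Y :: "nat list \<Rightarrow> 'a"
  assume X: "zero_insensitive X" and Y: "zero_insensitive Y"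
  \<comment> \<open>The homogeneous part of degree \<open>a\<close> of the quasisymmetric function with coefficients \<open>Z\<close>.\<close>
  define f where "f Z a = (\<Sum>q\<in>comps a. qscale (Z q) (qM q))" for Z :: "nat list \<Rightarrow> 'a" and a
  have qcf: "qc (f Z a) w = (if sum_list w = a then Z w else 0)" if Z: "zero_insensitive Z" for Z a w
  proof -
    let ?w = "filter (\<lambda>x. 0 < x) w"
    have sl: "sum_list ?w = sum_list w" by (induction w) auto
    have "qc (f Z a) w = (\<Sum>q\<in>comps a. if q = ?w then Z q else 0)"
      unfolding f_def qc_sum by (rule sum.cong) (auto simp: qc_qM)
    also have "\<dots> = (if ?w \<in> comps a then Z ?w else 0)"
      by (simp add: sum.delta finite_comps)
    also have "\<dots> = (if sum_list w = a then Z w else 0)"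
      using Z by (auto simp: comps_def sl zero_insensitive_def)
    finally show ?thesis .
  qed
  have single: "block_coef (qchar G) [a] Z = qsym_char G (f Z a)" if Z: "zero_insensitive Z" for Z a
    by (subst qsym_char_homogeneous[of _ a])
      (auto simp: qcf[OF Z] comps_def split: if_splits intro!: sum.cong)
  have prod: "qsym_char G (f X a * f Y (s - a)) = (\<Sum>q\<in>comps s. qchar G q *
      (\<Sum>(x, y)\<in>esplits q. if sum_list x = a then X x * Y y else 0))" if "a \<le> s" for a
  proof -
    have c: "qc (f X a * f Y (s - a)) q
        = (\<Sum>(x, y)\<in>esplits q. if sum_list x = a \<and> sum_list y = s - a then X x * Y y else 0)"
      if "0 \<notin> set q" for q
      using that unfolding qc_mult[OF that] split_prod_def qcf[OF X] qcf[OF Y]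
      by (intro sum.cong) auto
    have "sum_list q = s" if q: "0 \<notin> set q" "qc (f X a * f Y (s - a)) q \<noteq> 0" for q
    proof -
      obtain x y where "(x, y) \<in> esplits q" "sum_list x = a" "sum_list y = s - a"
        using q(2) unfolding c[OF q(1)]
        by (auto elim!: sum.not_neutral_contains_not_neutral split: if_splits)
      then show ?thesis using esplits_sum_list \<open>a \<le> s\<close> by fastforce
    qed
    then have "qsym_char G (f X a * f Y (s - a))
        = (\<Sum>q\<in>comps s. qchar G q * qc (f X a * f Y (s - a)) q)"
      by (rule qsym_char_homogeneous)
    also have "\<dots> = (\<Sum>q\<in>comps s. qchar G q *
        (\<Sum>(x, y)\<in>esplits q. if sum_list x = a then X x * Y y else 0))"
    proof (rule sum.cong[OF refl])
      fix q assume q: "q \<in> comps s"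
      then have "qc (f X a * f Y (s - a)) q
        = (\<Sum>(x, y)\<in>esplits q. if sum_list x = a \<and> sum_list y = s - a then X x * Y y else 0)"
        by (intro c) (simp add: comps_def)
      also have "\<dots> = (\<Sum>(x, y)\<in>esplits q. if sum_list x = a then X x * Y y else 0)"
        using q by (intro sum.cong refl) (auto simp: comps_def dest!: esplits_sum_list)
      finally show "qchar G q * qc (f X a * f Y (s - a)) q = qchar G q *
        (\<Sum>(x, y)\<in>esplits q. if sum_list x = a then X x * Y y else 0)" by simp
    qed
    finally show ?thesis .
  qed
  have "split_prod (\<lambda>u. block_coef (qchar G) u X) (\<lambda>v. block_coef (qchar G) v Y) [s]
      = (\<Sum>a\<le>s. block_coef (qchar G) [a] X * block_coef (qchar G) [s - a] Y)"
    unfolding split_prod_def sum_esplits_Cons sum_esplits_Nil ..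
  also have "\<dots> = (\<Sum>a\<le>s. qsym_char G (f X a * f Y (s - a)))"
    by (simp only: single[OF X] single[OF Y] qsym_char_mult[OF G])
  also have "\<dots> = (\<Sum>a\<le>s. \<Sum>q\<in>comps s. qchar G q *
      (\<Sum>(x, y)\<in>esplits q. if sum_list x = a then X x * Y y else 0))"
    by (intro sum.cong refl prod) simp
  also have "\<dots> = (\<Sum>q\<in>comps s. qchar G q *
      (\<Sum>(x, y)\<in>esplits q. \<Sum>a\<le>s. if sum_list x = a then X x * Y y else 0))"
    by (simp only: sum_distrib_left case_prod_unfold sum.swap[of _ "{..s}"])
  also have "\<dots> = (\<Sum>q\<in>comps s. qchar G q * split_prod X Y q)"
    unfolding split_prod_def
    by (intro sum.cong refl arg_cong2[where f = "(*)"])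
      (auto simp: comps_def dest!: esplits_sum_list)
  finally show "block_coef (qchar G) [s] (split_prod X Y)
      = split_prod (\<lambda>u. block_coef (qchar G) u X) (\<lambda>v. block_coef (qchar G) v Y) [s]" by simp
qed

subsection \<open>Values on monomial quasisymmetric functions\<close>

text \<open>Deconcatenation of \<open>p\<close>, read off from coefficients.\<close>

lemma qc_qM_append:
  "qc (qM p) (q @ w) = (\<Sum>i\<le>length p. qc (qM (take i p)) q * qc (qM (drop i p)) w :: 'k::field)"
proof -
  let ?q = "filter (\<lambda>x. 0 < x) q" and ?w = "filter (\<lambda>x. 0 < x) w"
  have ind: "(if P then 1 else 0) * (if Q then 1 else 0) = (if P \<and> Q then 1 else (0 :: 'k))" for P Q
    by simp
  have key: "?q = take i p \<and> ?w = drop i p \<longleftrightarrow> i = length ?q \<and> ?q @ ?w = p" if "i \<le> length p" for i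
    using that by (metis append_eq_conv_conj append_take_drop_id length_take min.absorb2)
  have "(\<Sum>i\<le>length p. qc (qM (take i p)) q * qc (qM (drop i p)) w)
      = (\<Sum>i\<le>length p. if i = length ?q then (if ?q @ ?w = p then 1 else 0) else (0 :: 'k))"
    by (intro sum.cong refl, unfold qc_qM ind, subst key) simp_all
  also have "\<dots> = qc (qM p) (q @ w)"
    by (auto simp: qc_qM)
  finally show ?thesis by simp
qed

lemma block_coef_qM_append:
  "block_coef h (x @ y) (qc (qM p))
    = (\<Sum>i\<le>length p. block_coef h x (qc (qM (take i p))) * block_coef h y (qc (qM (drop i p))))"
proof -
  have "block_coef h y (\<lambda>w'. qc (qM p) (w @ w'))
      = (\<Sum>i\<le>length p. qc (qM (take i p)) w * block_coef h y (qc (qM (drop i p))))" for w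
    by (simp only: qc_qM_append block_coef_sum block_coef_scale)
  then show ?thesis
    by (simp only: block_coef_append block_coef_sum block_coef_scale_right)
qed

lemma block_coef_qM_single:
  assumes "0 \<notin> set q"
  shows "block_coef h [s] (qc (qM q)) = (if sum_list q = s then h q else 0)"
proof -
  have "block_coef h [s] (qc (qM q)) = (\<Sum>p\<in>comps s. if p = q then h p else 0)"
    unfolding block_coef.simps by (rule sum.cong) (auto simp: qc_qM comps_def filter_id_nz)
  also have "\<dots> = (if sum_list q = s then h q else 0)"
    using assms by (simp add: sum.delta finite_comps) (simp add: comps_def)
  finally show ?thesis .
qed

text \<open>The blocks are consecutive segments of \<open>p\<close>: the first one is a prefix of sum \<open>s\<close>. This is the
  recursion to which the chain map is compared.\<close>

lemma block_coef_qM_Cons: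
  assumes "0 \<notin> set p"
  shows "block_coef h (s # e) (qc (qM p)) = (\<Sum>i\<le>length p.
    if sum_list (take i p) = s then h (take i p) * block_coef h e (qc (qM (drop i p))) else 0)"
proof -
  have "0 \<notin> set (take i p)" for i using assms in_set_takeD by fastforce
  then show ?thesis
    using block_coef_qM_append[of h "[s]" e p] block_coef_qM_single[of _ h s]
    by (simp add: if_distrib[of "\<lambda>x. x * _"] del: block_coef.simps cong: if_cong)
qed

lemma block_coef_one: "0 \<notin> set e \<Longrightarrow> block_coef h e (qc 1) = qc 1 e"
  using block_coef_qM_Cons[of "[]" h]
  by (cases e) (auto simp: qc_qM simp flip: qM_Nil)

section \<open>Coefficients of the chain map of the second kind\<close>

lemma linear_comp_lin_ext:
  assumes "Vector_Spaces.linear sc sc' L"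
  shows "L (lin_ext sc F u) = lin_ext sc' (\<lambda>w. L (F w)) u"
proof -
  interpret Vector_Spaces.linear sc sc' L by fact
  show ?thesis by (simp add: lin_ext_def sum scale)
qed

lemma linear_ab_coprod: "Vector_Spaces.linear pm_scale pm_scale ab_coprod"
  unfolding ab_coprod_def by (rule linear_lin_ext[OF vector_space_pm_scale])

lemma linear_pm_mult:
  "Vector_Spaces.linear pm_scale pm_scale (\<lambda>v. u * v :: 'k::field ab_poly)"
proof -
  show ?thesis by unfold_locales (simp_all add: distrib_left pm_scale_mult_right)
qed

text \<open>The linear map \<open>u \<mapsto> \<Sum> X(u\<^sub>(\<^sub>1\<^sub>)) b Y(u\<^sub>(\<^sub>2\<^sub>))\<close>. Leaving \<open>X\<close> variable allows inductions that
  absorb the first letter of \<open>u\<close> into \<open>X\<close>, in place of a bimodule structure on the tensor square.\<close>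

definition coprod_apply ::
    "('k::field ab_poly \<Rightarrow> 'k ab_poly) \<Rightarrow> ('k ab_poly \<Rightarrow> 'k ab_poly) \<Rightarrow> 'k ab_poly \<Rightarrow> 'k ab_poly"
  where "coprod_apply X Y u =
    lin_ext pm_scale (\<lambda>(v, w). X (ab_word v) * ab_b * Y (ab_word w)) (ab_coprod u)"

lemma linear_coprod_apply: "Vector_Spaces.linear pm_scale pm_scale (coprod_apply X Y)"
proof -
  have "Vector_Spaces.linear pm_scale pm_scale
    (lin_ext pm_scale (\<lambda>(v, w). X (ab_word v) * ab_b * Y (ab_word w)) \<circ> ab_coprod)"
    by (intro Vector_Spaces.linear_compose[OF linear_ab_coprod] linear_lin_ext vector_space_pm_scale)
  then show ?thesis by (simp add: coprod_apply_def[abs_def] o_def)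
qed

lemma coprod_apply_word:
  "coprod_apply X Y (ab_word w) =
    (\<Sum>i<length w. X (ab_word (take i w)) * ab_b * Y (ab_word (drop (Suc i) w)))"
proof -
  let ?L = "lin_ext pm_scale (\<lambda>(v, w). X (ab_word v) * ab_b * Y (ab_word w))"
  interpret L: Vector_Spaces.linear pm_scale pm_scale ?L
    by (rule linear_lin_ext[OF vector_space_pm_scale])
  show ?thesis
    unfolding coprod_apply_def ab_coprod_def lin_ext_single[OF vector_space_pm_scale] L.sum
    by (simp add: vector_space_pm_scale)
qed

lemma ab_word_Nil: "ab_word [] = (1 :: 'k::field ab_poly)"
  by (simp flip: zero_list_def)

lemma ab_word_Cons: "ab_word (l # w) = (ab_word [l] * ab_word w :: 'k::field ab_poly)"
  by (simp add: mult_single plus_list_def)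

text \<open>The coproduct is a derivation, and every letter has the coproduct \<open>1 \<otimes> 1\<close>.\<close>

lemma coprod_apply_letter:
  fixes X Y :: "'k::field ab_poly \<Rightarrow> 'k ab_poly"
  assumes Y: "Vector_Spaces.linear pm_scale pm_scale Y"
  shows "coprod_apply X Y (ab_word [l] * u)
    = X 1 * ab_b * Y u + coprod_apply (\<lambda>v. X (ab_word [l] * v)) Y u"
proof -
  interpret Y: Vector_Spaces.linear pm_scale pm_scale Y by fact
  interpret C: Vector_Spaces.linear pm_scale pm_scale "coprod_apply X Y"
    by (rule linear_coprod_apply)
  interpret C': Vector_Spaces.linear pm_scale pm_scale "coprod_apply (\<lambda>v. X (ab_word [l] * v)) Y"
    by (rule linear_coprod_apply)
  show ?thesis
  proof (induction u rule: pm_induct)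
    case zero
    then show ?case by (simp add: C.zero C'.zero Y.zero)
  next
    case (add u v)
    then show ?case by (simp add: C.add C'.add Y.add distrib_left)
  next
    case (scale_single c w)
    have "coprod_apply X Y (ab_word (l # w))
        = X 1 * ab_b * Y (ab_word w) + coprod_apply (\<lambda>v. X (ab_word [l] * v)) Y (ab_word w)"
      unfolding coprod_apply_word length_Cons sum.lessThan_Suc_shift
      by (simp add: ab_word_Nil ab_word_Cons[symmetric])
    then show ?case
      by (simp add: pm_scale_mult_right C.scale C'.scale Y.scale ab_word_Cons[symmetric]
          pm.scale_right_distrib)
  qed
qed

text \<open>The two copies of \<open>1 \<otimes> 1\<close> cancel, that is, \<open>\<Delta>(a - b) = 0\<close>.\<close>

lemma coprod_apply_cb:
  fixes X Y :: "'k::field ab_poly \<Rightarrow> 'k ab_poly"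
  assumes X: "Vector_Spaces.linear pm_scale pm_scale X"
    and Y: "Vector_Spaces.linear pm_scale pm_scale Y"
  shows "coprod_apply X Y ((ab_a - ab_b) * u) = coprod_apply (\<lambda>v. X ((ab_a - ab_b) * v)) Y u"
proof -
  interpret X: Vector_Spaces.linear pm_scale pm_scale X by fact
  interpret C: Vector_Spaces.linear pm_scale pm_scale "coprod_apply X Y"
    by (rule linear_coprod_apply)
  have "coprod_apply (\<lambda>v. X (ab_a * v)) Y u - coprod_apply (\<lambda>v. X (ab_b * v)) Y u
      = coprod_apply (\<lambda>v. X ((ab_a - ab_b) * v)) Y u"
    unfolding coprod_apply_def lin_ext_def sum_subtractf[symmetric]
    by (intro sum.cong refl)
      (simp add: case_prod_unfold pm.scale_right_diff_distrib[symmetric] X.diff left_diff_distrib)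
  then show ?thesis
    using coprod_apply_letter[OF Y, of X LA u] coprod_apply_letter[OF Y, of X LB u]
    by (simp add: left_diff_distrib C.diff)
qed

lemma comp_induct [consumes 2, case_names one Suc Cons]:
  assumes "p \<noteq> []" "0 \<notin> set p"
    and "P [Suc 0]" "\<And>k p. k \<ge> 1 \<Longrightarrow> 0 \<notin> set p \<Longrightarrow> P (k # p) \<Longrightarrow> P (Suc k # p)"
    and "\<And>p. p \<noteq> [] \<Longrightarrow> 0 \<notin> set p \<Longrightarrow> P p \<Longrightarrow> P (Suc 0 # p)"
  shows "P p"
proof -
  have "P (comp_of_word w)" for w
  proof (induction w rule: comp_of_word.induct)
    case (2 w)
    then show ?case
      using comp_of_word[of w] assms(4) by (cases "comp_of_word w") (auto simp: Suc_le_eq)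
  next
    case (3 w)
    then show ?case using comp_of_word[of w] assms(5) by simp
  qed (use assms(3) in simp)
  from this[of "word_of_comp p"] show ?thesis
    using assms(1,2) by (simp add: comp_of_word_of_comp)
qed

text \<open>By the derivation rule, with \<open>\<Delta>(a - b) = 0\<close> and \<open>\<Delta>(b) = 1 \<otimes> 1\<close>, a word in \<open>a - b\<close> and \<open>b\<close> is
  cut at the letters \<open>b\<close>. So \<open>\<Delta>\<close> is deconcatenation of compositions into nonempty parts, the reduced
  coproduct of quasisymmetric functions.\<close>

lemma coprod_apply_cb_mono:
  fixes X Y :: "'k::field ab_poly \<Rightarrow> 'k ab_poly"
  assumes "p \<noteq> []" "0 \<notin> set p" and X: "Vector_Spaces.linear pm_scale pm_scale X"
    and Y: "Vector_Spaces.linear pm_scale pm_scale Y"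
  shows "coprod_apply X Y (cb_mono p)
    = (\<Sum>i\<in>{1..<length p}. X (cb_mono (take i p)) * ab_b * Y (cb_mono (drop i p)))"
  using assms(1-3)
proof (induction p arbitrary: X rule: comp_induct)
  case one
  then show ?case using coprod_apply_word[of X Y "[]"] by (simp add: ab_word_Nil)
next
  case (Suc k p)
  interpret X: Vector_Spaces.linear pm_scale pm_scale X by fact
  have lin: "Vector_Spaces.linear pm_scale pm_scale (\<lambda>v. X ((ab_a - ab_b) * v))"
    using Vector_Spaces.linear_compose[OF linear_pm_mult X.linear_axioms] by (simp add: o_def)
  show ?case
    unfolding cb_mono_Suc_Cons[OF Suc.hyps(1)] coprod_apply_cb[OF Suc.prems Y] Suc.IH[OF lin]
  proof (intro sum.cong)
    fix i assume "i \<in> {1..<length (Suc k # p)}"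
    then obtain j where "i = Suc j" by (cases i) auto
    then show "X ((ab_a - ab_b) * cb_mono (take i (k # p))) * ab_b * Y (cb_mono (drop i (k # p)))
        = X (cb_mono (take i (Suc k # p))) * ab_b * Y (cb_mono (drop i (Suc k # p)))"
      using Suc.hyps(1) by (simp add: cb_mono_Suc_Cons)
  qed simp
next
  case (Cons p)
  interpret X: Vector_Spaces.linear pm_scale pm_scale X by fact
  have lin: "Vector_Spaces.linear pm_scale pm_scale (\<lambda>v. X (ab_b * v))"
    using Vector_Spaces.linear_compose[OF linear_pm_mult X.linear_axioms] by (simp add: o_def)
  have "(\<Sum>i\<in>{1..<length (Suc 0 # p)}.
        X (cb_mono (take i (Suc 0 # p))) * ab_b * Y (cb_mono (drop i (Suc 0 # p))))
      = X 1 * ab_b * Y (cb_mono p) + (\<Sum>i\<in>{1..<length p}.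
        X (cb_mono (Suc 0 # take i p)) * ab_b * Y (cb_mono (drop i p)))"
    using Cons.hyps(1) unfolding length_Cons One_nat_def
    by (subst sum.atLeast_Suc_lessThan)
      (simp, simp only: sum.shift_bounds_Suc_ivl take_Suc_Cons drop_Suc_Cons take_0 drop_0 cb_mono_one)
  also have "\<dots> = X 1 * ab_b * Y (cb_mono p) + (\<Sum>i\<in>{1..<length p}.
        X (ab_b * cb_mono (take i p)) * ab_b * Y (cb_mono (drop i p)))"
    using Cons.hyps(1) by (intro arg_cong2[where f = "(+)"] sum.cong refl) (simp add: cb_mono_1_Cons)
  also have "\<dots> = coprod_apply X Y (cb_mono (Suc 0 # p))"
    using coprod_apply_letter[OF Y, of X LB "cb_mono p"] Cons.IH[OF lin] Cons.hyps(1)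
    by (simp add: cb_mono_1_Cons)
  finally show ?case by simp
qed

definition homogeneous :: "nat \<Rightarrow> 'k::field ab_poly \<Rightarrow> bool"
  where "homogeneous d u \<longleftrightarrow> (\<forall>w\<in>Poly_Mapping.keys u. length w = d)"

lemma homogeneous_mult: "homogeneous d u \<Longrightarrow> homogeneous e v \<Longrightarrow> homogeneous (d + e) (u * v)"
  using keys_mult[of u v] by (fastforce simp: homogeneous_def plus_list_def)

lemma homogeneous_one: "homogeneous 0 1"
  by (simp add: homogeneous_def zero_list_def)

lemma homogeneous_b: "homogeneous 1 ab_b"
  by (simp add: homogeneous_def)

lemma homogeneous_diff: "homogeneous 1 (ab_a - ab_b)"
  using keys_diff[of ab_a ab_b] by (fastforce simp: homogeneous_def)

lemma homogeneous_cb_mono: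
  "p \<noteq> [] \<Longrightarrow> 0 \<notin> set p \<Longrightarrow> homogeneous (sum_list p - 1) (cb_mono p)"
proof (induction p rule: comp_induct)
  case one
  then show ?case by (simp add: homogeneous_one)
next
  case (Suc k p)
  then show ?case
    using homogeneous_mult[OF homogeneous_diff Suc.IH] by (simp add: cb_mono_Suc_Cons Suc_diff_le)
next
  case (Cons p)
  have "sum_list p \<ge> 1" using Cons.hyps(1,2) by (cases p) auto
  then show ?case
    using homogeneous_mult[OF homogeneous_b Cons.IH] Cons.hyps by (simp add: cb_mono_1_Cons)
qed

lemma linear_ab_hat: "Vector_Spaces.linear pm_scale pm_scale (ab_hat G)"
  unfolding ab_hat_def by (rule linear_lin_ext[OF vector_space_pm_scale])

lemma cb_mono_single: "s \<ge> 1 \<Longrightarrow> cb_mono [s] = (ab_a - ab_b) ^ (s - 1)"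
  by (simp add: cb_mono_def)

lemma lin_ext_ab_word: "lin_ext pm_scale ab_word u = u"
proof -
  interpret L: Vector_Spaces.linear pm_scale pm_scale "lin_ext pm_scale ab_word"
    by (rule linear_lin_ext[OF vector_space_pm_scale])
  show ?thesis
    by (induction u rule: pm_induct) (simp_all add: L.zero L.add L.scale vector_space_pm_scale)
qed

text \<open>The element \<open>cb_mono p\<close> is homogeneous of degree \<open>sum_list p - 1\<close>, so \<^const>\<open>ab_hat\<close> replaces
  all its letters by \<open>a - b\<close>, up to the factor \<open>G (cb_mono p)\<close>: the block \<open>p\<close> is merged into a single
  part.\<close>

lemma ab_hat_cb_mono:
  assumes "Vector_Spaces.linear pm_scale (*) G" "p \<noteq> []" "0 \<notin> set p"
  shows "ab_hat G (cb_mono p) = pm_scale (qchar G p) (cb_mono [sum_list p])"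
proof -
  interpret G: Vector_Spaces.linear pm_scale "(*)" G by fact
  let ?u = "cb_mono p :: 'a ab_poly" and ?c = "(ab_a - ab_b) ^ (sum_list p - 1) :: 'a ab_poly"
  have "ab_hat G ?u = (\<Sum>w\<in>Poly_Mapping.keys ?u.
      pm_scale (Poly_Mapping.lookup ?u w * G (ab_word w)) ?c)"
    using homogeneous_cb_mono[OF assms(2,3), where 'a = 'a]
    by (simp add: ab_hat_def lin_ext_def homogeneous_def)
  also have "\<dots> = pm_scale (lin_ext (*) (\<lambda>w. G (ab_word w)) ?u) ?c"
    by (simp add: lin_ext_def pm.scale_sum_left)
  also have "lin_ext (*) (\<lambda>w. G (ab_word w)) ?u = G (lin_ext pm_scale ab_word ?u)"
    by (rule linear_comp_lin_ext[symmetric]) (rule assms(1))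
  also have "lin_ext pm_scale ab_word ?u = ?u"
    by (rule lin_ext_ab_word)
  finally show ?thesis
    using assms(2,3) by (cases p) (simp_all add: qchar_def cb_mono_single)
qed

text \<open>The summand of the chain map for the coproduct into \<open>n + 1\<close> parts.\<close>

definition chain_part :: "('k::field ab_poly \<Rightarrow> 'k) \<Rightarrow> nat \<Rightarrow> 'k ab_poly \<Rightarrow> 'k ab_poly"
  where "chain_part G n u = lin_ext pm_scale
    (\<lambda>ws. bjoin (map (\<lambda>w. ab_hat G (ab_word w)) ws)) (ab_coprod_iter n u)"

lemma chain_map2_eq: "chain_map2 G u = Sum_any (\<lambda>n. chain_part G n u)"
  by (simp add: chain_map2_def chain_part_def)

lemma linear_ab_coprod_iter: "Vector_Spaces.linear pm_scale pm_scale (ab_coprod_iter n)"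
proof (cases n)
  case 0
  have "ab_coprod_iter 0 = (lin_ext pm_scale (\<lambda>w. Poly_Mapping.single [w] 1) :: 'a ab_poly \<Rightarrow> _)"
    by (rule ext) simp
  then show ?thesis unfolding 0 by (simp only: linear_lin_ext[OF vector_space_pm_scale])
next
  case (Suc m)
  have "ab_coprod_iter (Suc m) = lin_ext pm_scale
     (\<lambda>(v, w). lin_ext pm_scale (\<lambda>ws. Poly_Mapping.single (v # ws) 1)
        (ab_coprod_iter m (ab_word w))) \<circ> (ab_coprod :: 'a ab_poly \<Rightarrow> _)"
    by (rule ext) simp
  then show ?thesis unfolding Suc
    by (simp only:) (intro Vector_Spaces.linear_compose[OF linear_ab_coprod] linear_lin_ext vector_space_pm_scale)
qed

lemma linear_chain_part: "Vector_Spaces.linear pm_scale pm_scale (chain_part G n)"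
proof -
  have "Vector_Spaces.linear pm_scale pm_scale (lin_ext pm_scale
    (\<lambda>ws. bjoin (map (\<lambda>w. ab_hat G (ab_word w)) ws)) \<circ> ab_coprod_iter n)"
    by (intro Vector_Spaces.linear_compose[OF linear_ab_coprod_iter] linear_lin_ext vector_space_pm_scale)
  then show ?thesis by (simp add: chain_part_def[abs_def] o_def)
qed

interpretation chain_part: Vector_Spaces.linear pm_scale pm_scale "chain_part G n" for G n
  by (rule linear_chain_part)

lemma keys_lin_ext: "Poly_Mapping.keys (lin_ext pm_scale F u) \<subseteq> (\<Union>w\<in>Poly_Mapping.keys u. Poly_Mapping.keys (F w))"
proof
  fix x assume "x \<in> Poly_Mapping.keys (lin_ext pm_scale F u)"
  then have "(\<Sum>w\<in>Poly_Mapping.keys u. Poly_Mapping.lookup u w * Poly_Mapping.lookup (F w) x) \<noteq> 0"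
    by (simp add: in_keys_iff lin_ext_def lookup_sum)
  then obtain w where "w \<in> Poly_Mapping.keys u" "Poly_Mapping.lookup u w * Poly_Mapping.lookup (F w) x \<noteq> 0"
    by (rule sum.not_neutral_contains_not_neutral)
  then show "x \<in> (\<Union>w\<in>Poly_Mapping.keys u. Poly_Mapping.keys (F w))" by (auto simp: in_keys_iff)
qed

text \<open>Excludes the value of \<^const>\<open>bjoin\<close> on the empty list, for which
  \<open>bjoin (u # us) = u * ab_b * bjoin us\<close> would fail.\<close>

lemma ab_coprod_iter_nonempty: "[] \<notin> Poly_Mapping.keys (ab_coprod_iter n u)"
proof (cases n)
  case 0
  then show ?thesis
    using keys_lin_ext[of "\<lambda>w. Poly_Mapping.single [w] 1" u] by auto
next
  case (Suc m)
  then show ?thesis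
    using keys_lin_ext[of "\<lambda>(v, w). lin_ext pm_scale (\<lambda>ws. Poly_Mapping.single (v # ws) 1)
        (ab_coprod_iter m (ab_word w))" "ab_coprod u"]
      keys_lin_ext[of "\<lambda>ws. Poly_Mapping.single (_ # ws) 1" "ab_coprod_iter m (ab_word _)"]
    by fastforce
qed

lemma chain_part_0: "chain_part G 0 u = ab_hat G u"
proof -
  let ?L = "lin_ext pm_scale (\<lambda>ws. bjoin (map (\<lambda>w. ab_hat G (ab_word w)) ws))"
  have "chain_part G 0 u = lin_ext pm_scale (\<lambda>w. ?L (Poly_Mapping.single [w] 1)) u"
    unfolding chain_part_def ab_coprod_iter.simps
    by (rule linear_comp_lin_ext[OF linear_lin_ext[OF vector_space_pm_scale]])
  then show ?thesis by (simp add: vector_space_pm_scale ab_hat_def)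
qed

lemma chain_part_Suc: "chain_part G (Suc n) u = coprod_apply (ab_hat G) (chain_part G n) u"
proof -
  let ?f = "\<lambda>ws. bjoin (map (\<lambda>w. ab_hat G (ab_word w)) ws)"
  let ?L = "lin_ext pm_scale ?f"
  note lin = linear_lin_ext[OF vector_space_pm_scale]
  have "?L (lin_ext pm_scale (\<lambda>ws. Poly_Mapping.single (v # ws) 1) (ab_coprod_iter n (ab_word w)))
      = ab_hat G (ab_word v) * ab_b * chain_part G n (ab_word w)" for v w
  proof -
    have "?L (lin_ext pm_scale (\<lambda>ws. Poly_Mapping.single (v # ws) 1) (ab_coprod_iter n (ab_word w)))
        = lin_ext pm_scale (\<lambda>ws. ?f (v # ws)) (ab_coprod_iter n (ab_word w))"
      by (subst linear_comp_lin_ext[OF lin]) (simp add: vector_space_pm_scale)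
    also have "\<dots> = lin_ext pm_scale (\<lambda>ws. (ab_hat G (ab_word v) * ab_b) * ?f ws)
        (ab_coprod_iter n (ab_word w))"
      unfolding lin_ext_def
    proof (intro sum.cong refl arg_cong2[where f = pm_scale])
      fix ws assume "ws \<in> Poly_Mapping.keys (ab_coprod_iter n (ab_word w) :: _ \<Rightarrow>\<^sub>0 'a)"
      then have "ws \<noteq> []" using ab_coprod_iter_nonempty by metis
      then show "?f (v # ws) = (ab_hat G (ab_word v) * ab_b) * ?f ws" by (cases ws) simp_all
    qed
    also have "\<dots> = ab_hat G (ab_word v) * ab_b * chain_part G n (ab_word w)"
      unfolding chain_part_def by (rule linear_comp_lin_ext[OF linear_pm_mult, symmetric])
    finally show ?thesis .
  qed
  then show ?thesis
    unfolding chain_part_def[of G "Suc n"] ab_coprod_iter.simps coprod_apply_def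
    by (subst linear_comp_lin_ext[OF lin]) (simp add: case_prod_unfold)
qed

lemma cb_mono_mult:
  "s \<ge> 1 \<Longrightarrow> p \<noteq> [] \<Longrightarrow> cb_mono [s] * ab_b * cb_mono p = cb_mono (s # p)"
  by (cases p) (simp_all add: cb_mono_def)

text \<open>Multiplication by \<open>(a - b)\<^bsup>s-1\<^esup> b\<close> corresponds to prefixing compositions with the part \<open>s\<close>.\<close>

lemma qc_gamma_Cons:
  assumes "s \<ge> 1" "0 \<notin> set e"
  shows "qc (qsym_gamma (cb_mono [s] * ab_b * u)) e
    = (case e of [] \<Rightarrow> 0 | t # e' \<Rightarrow> if t = s then qc (qsym_gamma u) e' else 0)"
proof (induction u rule: cb_mono_induct)
  case (add u v)
  then show ?case by (cases e) (simp_all add: distrib_left qsym_gamma.add)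
next
  case (scale c u)
  then show ?case by (cases e) (simp_all add: pm_scale_mult_right qsym_gamma.scale)
next
  case (mono p)
  then show ?case using assms
    by (cases e) (simp_all add: cb_mono_mult qsym_gamma_cb_mono qc_qM filter_id_nz)
qed

context
  fixes G :: "'k::field ab_poly \<Rightarrow> 'k"
  assumes lin: "Vector_Spaces.linear pm_scale (*) G"
begin

lemma chain_part_Suc_cb_mono:
  assumes p: "p \<noteq> []" "0 \<notin> set p"
  shows "chain_part G (Suc n) (cb_mono p) = (\<Sum>i\<in>{1..<length p}. pm_scale (qchar G (take i p))
    (cb_mono [sum_list (take i p)] * ab_b * chain_part G n (cb_mono (drop i p))))"
  unfolding chain_part_Suc coprod_apply_cb_mono[OF p linear_ab_hat linear_chain_part]
proof (rule sum.cong[OF refl])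
  fix i assume "i \<in> {1..<length p}"
  then have "take i p \<noteq> []" "0 \<notin> set (take i p)" using p(2) in_set_takeD by fastforce+
  then show "ab_hat G (cb_mono (take i p)) * ab_b * chain_part G n (cb_mono (drop i p))
      = pm_scale (qchar G (take i p))
        (cb_mono [sum_list (take i p)] * ab_b * chain_part G n (cb_mono (drop i p)))"
    by (simp add: ab_hat_cb_mono[OF lin] pm_scale_mult_left)
qed

lemma chain_part_vanish:
  "p \<noteq> [] \<Longrightarrow> 0 \<notin> set p \<Longrightarrow> length p \<le> n \<Longrightarrow> chain_part G n (cb_mono p) = 0"
proof (induction n arbitrary: p)
  case (Suc n)
  have "chain_part G n (cb_mono (drop i p)) = 0" if "i \<in> {1..<length p}" for i
    using that Suc.prems in_set_dropD by (intro Suc.IH) fastforce+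
  then show ?case
    unfolding chain_part_Suc_cb_mono[OF Suc.prems(1,2)]
    by (intro sum.neutral) simp
qed simp

text \<open>A coproduct into \<open>n + 1\<close> parts produces exactly the monomial functions with \<open>n + 1\<close> parts, one
  for each way to cut \<open>p\<close> into \<open>n + 1\<close> nonempty blocks; this is the recursion \<open>block_coef_qM_Cons\<close>.\<close>

lemma qc_gamma_chain_part:
  "p \<noteq> [] \<Longrightarrow> 0 \<notin> set p \<Longrightarrow> 0 \<notin> set e \<Longrightarrow> qc (qsym_gamma (chain_part G n (cb_mono p))) e
    = (if length e = Suc n then block_coef (qchar G) e (qc (qM p)) else 0)"
proof (induction n arbitrary: p e)
  case 0
  have s: "sum_list p \<noteq> 0" using "0.prems" by (cases p) auto
  have "qc (qsym_gamma (chain_part G 0 (cb_mono p))) e = (if e = [sum_list p] then qchar G p else 0)"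
    using 0 s by (simp add: chain_part_0 ab_hat_cb_mono[OF lin] qsym_gamma.scale qsym_gamma_cb_mono
        qc_qM filter_id_nz)
  moreover have "\<exists>s. e = [s]" if "length e = Suc 0" using that by (cases e) auto
  ultimately show ?case using block_coef_qM_single[OF 0(2), of "qchar G"]
    by (auto simp del: block_coef.simps split: if_splits)
next
  case (Suc n)
  have pos: "0 \<notin> set (take i p)" "0 \<notin> set (drop i p)" for i
    using Suc.prems(2) in_set_takeD in_set_dropD by fastforce+
  have sum_pos: "sum_list (take i p) \<ge> 1" if "i \<ge> 1" for i
    using that Suc.prems(1,2) by (cases i; cases p) auto
  show ?case
  proof (cases e)
    case Nil
    have "qc (qsym_gamma (chain_part G (Suc n) (cb_mono p))) e = (\<Sum>i\<in>{1..<length p}. 0)"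
      unfolding chain_part_Suc_cb_mono[OF Suc.prems(1,2)] qsym_gamma.sum qc_sum
    proof (rule sum.cong[OF refl])
      fix i assume "i \<in> {1..<length p}"
      then have "sum_list (take i p) \<ge> 1" by (intro sum_pos) simp
      then show "qc (qsym_gamma (pm_scale (qchar G (take i p)) (cb_mono [sum_list (take i p)] * ab_b *
          chain_part G n (cb_mono (drop i p))))) e = 0"
        by (simp add: qsym_gamma.scale qc_gamma_Cons Nil)
    qed
    then show ?thesis using Nil by simp
  next
    case (Cons t e')
    let ?f = "\<lambda>i. if sum_list (take i p) = t
      then qchar G (take i p) * block_coef (qchar G) e' (qc (qM (drop i p))) else 0"
    have t: "t \<ge> 1" "0 \<notin> set e'" using Suc.prems(3) Cons by auto
    have "qc (qsym_gamma (chain_part G (Suc n) (cb_mono p))) e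
        = (\<Sum>i\<in>{1..<length p}. if length e' = Suc n then ?f i else 0)"
      unfolding chain_part_Suc_cb_mono[OF Suc.prems(1,2)] qsym_gamma.sum qc_sum
    proof (rule sum.cong[OF refl])
      fix i assume i: "i \<in> {1..<length p}"
      have "qc (qsym_gamma (chain_part G n (cb_mono (drop i p)))) e'
          = (if length e' = Suc n then block_coef (qchar G) e' (qc (qM (drop i p))) else 0)"
        using i t(2) pos by (intro Suc.IH) auto
      then show "qc (qsym_gamma (pm_scale (qchar G (take i p)) (cb_mono [sum_list (take i p)] * ab_b *
          chain_part G n (cb_mono (drop i p))))) e = (if length e' = Suc n then ?f i else 0)"
        using i sum_pos Suc.prems(3) by (simp add: qsym_gamma.scale qc_gamma_Cons Cons)
    qed
    also have "\<dots> = (if length e = Suc (Suc n) then \<Sum>i\<le>length p. ?f i else 0)"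
    proof (cases "length e' = Suc n")
      case True
      \<comment> \<open>The empty prefix is excluded by \<open>t \<ge> 1\<close>, and the whole of \<open>p\<close> as first block because \<open>e'\<close> is nonempty.\<close>
      have last: "?f (length p) = 0"
        using True t(2) block_coef_one[OF t(2), of "qchar G"]
        by (auto simp: qM_Nil qc_qM filter_id_nz simp flip: qM_Nil)
      have "(\<Sum>i\<in>{1..<length p}. ?f i) = (\<Sum>i\<le>length p. ?f i)"
        by (rule sum.mono_neutral_left) (use last t in \<open>auto simp: not_less_eq_eq le_antisym Suc_le_eq\<close>)
      then show ?thesis using True Cons by simp
    qed (simp add: Cons)
    also have "\<dots> = (if length e = Suc (Suc n) then block_coef (qchar G) e (qc (qM p)) else 0)"
      unfolding Cons block_coef_qM_Cons[OF Suc.prems(2)] ..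
    finally show ?thesis .
  qed
qed

lemma chain_part_eventually_0: "\<exists>N. \<forall>n\<ge>N. chain_part G n u = 0"
proof (induction u rule: cb_mono_induct)
  case (add u v)
  then obtain N M where "\<forall>n\<ge>N. chain_part G n u = 0" "\<forall>n\<ge>M. chain_part G n v = 0" by blast
  then show ?case
    by (intro exI[of _ "max N M"]) (simp add: chain_part.add)
next
  case (scale c u)
  then show ?case
    by (auto simp: chain_part.scale)
next
  case (mono p)
  then show ?case using chain_part_vanish by blast
qed

lemma chain_map2_sum:
  assumes "\<forall>n\<ge>N. chain_part G n u = 0"
  shows "chain_map2 G u = (\<Sum>n<N. chain_part G n u)"
  unfolding chain_map2_eq
  by (rule Sum_any.expand_superset) (use assms in \<open>auto simp: not_less[symmetric]\<close>)

lemma qc_gamma_chain_map2: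
  assumes e: "0 \<notin> set e"
  shows "qc (qsym_gamma (chain_map2 G u)) e = block_coef (qchar G) e (qc (qsym_gamma u))"
proof (induction u rule: cb_mono_induct)
  case (add u v)
  obtain N M where N: "\<forall>n\<ge>N. chain_part G n u = 0" "\<forall>n\<ge>M. chain_part G n v = 0"
    using chain_part_eventually_0 by blast
  define K where "K = max N M"
  have K: "\<forall>n\<ge>K. chain_part G n u = 0" "\<forall>n\<ge>K. chain_part G n v = 0"
    "\<forall>n\<ge>K. chain_part G n (u + v) = 0"
    using N by (simp_all add: K_def chain_part.add)
  then have "chain_map2 G (u + v) = chain_map2 G u + chain_map2 G v"
    by (simp add: chain_map2_sum[OF K(1)] chain_map2_sum[OF K(2)] chain_map2_sum[OF K(3)]
        sum.distrib chain_part.add)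
  then show ?case
    using add block_coef_add[of "qchar G" e "qc (qsym_gamma u)" "qc (qsym_gamma v)"]
    by (simp add: qsym_gamma.add cong: block_coef_cong)
next
  case (scale c u)
  obtain N where N: "\<forall>n\<ge>N. chain_part G n u = 0" using chain_part_eventually_0 by blast
  have sc: "chain_part G n (pm_scale c u) = pm_scale c (chain_part G n u)" for n
    by (rule chain_part.scale)
  then have "\<forall>n\<ge>N. chain_part G n (pm_scale c u) = 0" using N by simp
  then have "chain_map2 G (pm_scale c u) = pm_scale c (chain_map2 G u)"
    by (simp add: chain_map2_sum[OF N] chain_map2_sum sc pm.scale_sum_right)
  then show ?case
    using scale block_coef_scale[of "qchar G" e c "qc (qsym_gamma u)"]
    by (simp add: qsym_gamma.scale cong: block_coef_cong)
next
  case (mono p)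
  define N where "N = max (length p) (length e)"
  have "\<forall>n\<ge>N. chain_part G n (cb_mono p) = 0" using mono by (simp add: N_def chain_part_vanish)
  then have "qc (qsym_gamma (chain_map2 G (cb_mono p))) e
      = (\<Sum>n<N. if length e = Suc n then block_coef (qchar G) e (qc (qM p)) else 0)"
    by (simp add: chain_map2_sum qsym_gamma.sum qc_sum qc_gamma_chain_part mono e)
  also have "\<dots> = block_coef (qchar G) e (qc (qM p))"
  proof (cases e)
    case Nil
    then show ?thesis using mono by (simp add: qc_qM)
  next
    case (Cons t e')
    have "(\<Sum>n<N. if length e = Suc n then block_coef (qchar G) e (qc (qM p)) else 0)
        = (\<Sum>n<N. if n = length e' then block_coef (qchar G) e (qc (qM p)) else 0)"
      by (intro sum.cong refl) (auto simp: Cons)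
    then show ?thesis using Cons by (simp add: N_def)
  qed
  finally show ?case using mono by (simp add: qsym_gamma_cb_mono)
qed

end

lemma inv_qsym_gamma: "inv qsym_gamma (qsym_gamma u) = u"
  by (rule inv_f_f[OF bij_betw_imp_inj_on[OF bij_betw_qsym_gamma]])

text \<open>The description of the chain map from which all its properties are derived: the constant term
  is treated separately by definition, but obeys the same formula.\<close>

lemma qc_qsym_chain_map2:
  assumes "Vector_Spaces.linear pm_scale (*) (G :: 'k::field ab_poly \<Rightarrow> 'k)"
  shows "qc (qsym_chain_map2 G f) w = block_coef (qchar G) w (qc f)"
proof -
  obtain u where u: "f = qscale (qcounit f) 1 + qsym_gamma u" by (rule qsym_decompose)
  then have u': "f - qscale (qcounit f) 1 = qsym_gamma u" by (metis add_diff_cancel_left')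
  have *: "qc (qsym_chain_map2 G f) e = block_coef (qchar G) e (qc f)" if e: "0 \<notin> set e" for e
  proof -
    have "qc f = (\<lambda>w. qcounit f * qc 1 w + qc (qsym_gamma u) w)"
      by (subst u) (simp add: fun_eq_iff)
    then have "block_coef (qchar G) e (qc f) = qcounit f * qc 1 e + block_coef (qchar G) e (qc (qsym_gamma u))"
      by (simp only: block_coef_add block_coef_scale block_coef_one[OF e])
    then show ?thesis
      by (simp add: qsym_chain_map2_def u' inv_qsym_gamma qc_gamma_chain_map2[OF assms e])
  qed
  have "qc (qsym_chain_map2 G f) w = qc (qsym_chain_map2 G f) (filter (\<lambda>x. 0 < x) w)"
    by (simp only: qc_filter)
  also have "\<dots> = block_coef (qchar G) w (qc f)"
    by (subst *) (simp_all add: block_coef_filter qchar_def)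
  finally show ?thesis .
qed

section \<open>Hopf algebra endomorphisms\<close>

lemma linear_eq_on_qM:
  assumes "Vector_Spaces.linear qscale scale L" "Vector_Spaces.linear qscale scale L'"
    and eq: "\<And>p. 0 \<notin> set p \<Longrightarrow> L (qM p) = L' (qM p)"
  shows "L f = L' f"
proof -
  have "lin_ext scale (\<lambda>p. L (qM p)) (qcoords f) = lin_ext scale (\<lambda>p. L' (qM p)) (qcoords f)"
    unfolding lin_ext_def
    by (intro sum.cong refl) (auto simp: eq in_keys_iff lookup_qcoords split: if_splits)
  then have "L (lin_ext qscale qM (qcoords f)) = L' (lin_ext qscale qM (qcoords f))"
    by (simp add: linear_comp_lin_ext[OF assms(1)] linear_comp_lin_ext[OF assms(2)])
  then show ?thesis by (simp add: lin_ext_qM_qcoords)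
qed

lemma linear_times_qsym: "Vector_Spaces.linear qscale qscale (\<lambda>g. f * g)"
proof unfold_locales
  show "f * (g + h) = f * g + f * h" for g h by (rule distrib_left)
  show "f * qscale c g = qscale c (f * g)" for c g
    by (metis mult.commute qscale_mult_left)
qed

lemma linear_qsym_times: "Vector_Spaces.linear qscale qscale (\<lambda>f. f * g)"
  using linear_times_qsym[of g] by (simp add: mult.commute)

lemma lookup_qtensor:
  "Poly_Mapping.lookup (qtensor f g) (x, y)
    = Poly_Mapping.lookup (qcoords f) x * Poly_Mapping.lookup (qcoords g) y"
proof -
  have *: "Poly_Mapping.lookup (lin_ext pm_scale (\<lambda>q. Poly_Mapping.single (p, q) 1) u) (x, y)
      = (if p = x then Poly_Mapping.lookup u y else 0)" for p and u :: "nat list \<Rightarrow>\<^sub>0 'a"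
    by (auto simp: lin_ext_def lookup_sum lookup_single when_def sum.delta in_keys_iff
        if_distrib[of "\<lambda>x. _ * x"] cong: if_cong)
  show ?thesis
    unfolding qtensor_def
    by (subst lin_ext_def)
      (auto simp: lookup_sum * sum.delta in_keys_iff if_distrib[of "\<lambda>x. _ * x"] cong: if_cong)
qed

lemma qtensor_qM: "0 \<notin> set p \<Longrightarrow> 0 \<notin> set q \<Longrightarrow> qtensor (qM p) (qM q) = Poly_Mapping.single (p, q) 1"
  by (simp add: qtensor_def qcoords_qM vector_space_pm_scale)

lemma linear_qcoprod: "Vector_Spaces.linear qscale pm_scale qcoprod"
proof -
  have "Vector_Spaces.linear qscale pm_scale (lin_ext pm_scale
    (\<lambda>p. \<Sum>i\<le>length p. qtensor (qM (take i p)) (qM (drop i p))) \<circ> qcoords)"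
    by (intro Vector_Spaces.linear_compose[OF linear_qcoords] linear_lin_ext vector_space_pm_scale)
  then show ?thesis by (simp add: qcoprod_def[abs_def] o_def)
qed

lemma qcoprod_qM:
  assumes "0 \<notin> set p"
  shows "qcoprod (qM p) = (\<Sum>i\<le>length p. Poly_Mapping.single (take i p, drop i p) 1)"
proof -
  have "0 \<notin> set (take i p)" "0 \<notin> set (drop i p)" for i
    using assms in_set_takeD in_set_dropD by fastforce+
  then show ?thesis
    using assms by (simp add: qcoprod_def qcoords_qM vector_space_pm_scale qtensor_qM)
qed

lemma lookup_qcoprod:
  assumes "0 \<notin> set x" "0 \<notin> set y"
  shows "Poly_Mapping.lookup (qcoprod f) (x, y) = qc f (x @ y)"
proof -
  have *: "Poly_Mapping.lookup (\<Sum>i\<le>length p. qtensor (qM (take i p)) (qM (drop i p))) (x, y)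
      = qc (qM p :: 'a qsym) (x @ y)" for p
    using assms by (simp add: lookup_sum lookup_qtensor lookup_qcoords qc_qM_append)
  have "Poly_Mapping.lookup (qcoprod f) (x, y) = qc (lin_ext qscale qM (qcoords f)) (x @ y)"
    by (simp add: qcoprod_def lin_ext_def lookup_sum[of _ "Poly_Mapping.keys _"] * qc_sum)
  then show ?thesis by (simp add: lin_ext_qM_qcoords)
qed

lemma lookup_qcoprod_zero:
  assumes "0 \<in> set x \<or> 0 \<in> set y"
  shows "Poly_Mapping.lookup (qcoprod f) (x, y) = 0"
  using assms by (auto simp: qcoprod_def lin_ext_def lookup_sum lookup_qtensor lookup_qcoords intro!: sum.neutral)

lemma linear_qtensor_map: "Vector_Spaces.linear pm_scale pm_scale (qtensor_map \<phi> \<psi>)"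
  unfolding qtensor_map_def by (rule linear_lin_ext[OF vector_space_pm_scale])

lemma linear_qmult: "Vector_Spaces.linear pm_scale qscale qmult"
  unfolding qmult_def by (rule linear_lin_ext[OF vector_space_qscale])

interpretation qtensor_map: Vector_Spaces.linear pm_scale pm_scale "qtensor_map \<phi> \<psi>" for \<phi> \<psi>
  by (rule linear_qtensor_map)

interpretation qmult: Vector_Spaces.linear pm_scale qscale qmult
  by (rule linear_qmult)

lemma qtensor_map_qcoprod_qM:
  "0 \<notin> set p \<Longrightarrow> qtensor_map \<phi> \<psi> (qcoprod (qM p))
    = (\<Sum>i\<le>length p. qtensor (\<phi> (qM (take i p))) (\<psi> (qM (drop i p))))"
  by (simp add: qcoprod_qM qtensor_map.sum) (simp add: qtensor_map_def vector_space_pm_scale)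

text \<open>Reduces an identity on pure tensors to basis elements, once for both
  \<open>qmult_qtensor\<close> and \<open>qmult_qtensor_map_id\<close>.\<close>

lemma linear_on_qtensor:
  assumes L: "Vector_Spaces.linear pm_scale qscale L"
    and eq: "\<And>p q. L (Poly_Mapping.single (p, q) 1) = A p * B q"
  shows "L (qtensor f g) = lin_ext qscale A (qcoords f) * lin_ext qscale B (qcoords g)"
proof -
  have "L (qtensor f g) = lin_ext qscale (\<lambda>p. A p * lin_ext qscale B (qcoords g)) (qcoords f)"
    by (simp only: qtensor_def linear_comp_lin_ext[OF L] eq linear_comp_lin_ext[OF linear_times_qsym])
  also have "\<dots> = lin_ext qscale A (qcoords f) * lin_ext qscale B (qcoords g)"
    by (rule linear_comp_lin_ext[OF linear_qsym_times, symmetric])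
  finally show ?thesis .
qed

lemma qmult_qtensor: "qmult (qtensor f g) = f * g"
proof -
  have "qmult (qtensor f g) = lin_ext qscale qM (qcoords f) * lin_ext qscale qM (qcoords g)"
    by (rule linear_on_qtensor[OF linear_qmult]) (simp add: qmult_def vector_space_qscale)
  then show ?thesis by (simp add: lin_ext_qM_qcoords)
qed

lemma qmult_qtensor_map_qcoprod_qM:
  "0 \<notin> set p \<Longrightarrow> qmult (qtensor_map \<phi> \<psi> (qcoprod (qM p)))
    = (\<Sum>i\<le>length p. \<phi> (qM (take i p)) * \<psi> (qM (drop i p)))"
  by (simp add: qtensor_map_qcoprod_qM qmult.sum qmult_qtensor)

lemma qmult_qtensor_map_id:
  assumes S: "Vector_Spaces.linear qscale qscale S"
  shows "qmult (qtensor_map id S (qtensor f g)) = f * S g"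
proof -
  have L: "Vector_Spaces.linear pm_scale qscale (\<lambda>u. qmult (qtensor_map id S u))"
    using Vector_Spaces.linear_compose[OF linear_qtensor_map linear_qmult] by (simp add: o_def)
  have "qmult (qtensor_map id S (qtensor f g))
      = lin_ext qscale qM (qcoords f) * lin_ext qscale (\<lambda>q. S (qM q)) (qcoords g)"
    by (rule linear_on_qtensor[OF L]) (simp add: qtensor_map_def vector_space_pm_scale qmult_qtensor)
  also have "lin_ext qscale (\<lambda>q. S (qM q)) (qcoords g) = S (lin_ext qscale qM (qcoords g))"
    by (rule linear_comp_lin_ext[OF S, symmetric])
  finally show ?thesis unfolding lin_ext_qM_qcoords .
qed

text \<open>In the convolution product of \<open>\<phi>\<close> and \<open>X\<close> at \<open>qM p\<close> the term for the empty prefix is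
  \<open>X (qM p)\<close>, and the other terms involve \<open>X\<close> at shorter compositions only. So \<open>X\<close> is determined
  recursively, without appeal to associativity of convolution.\<close>

lemma right_convolution_inverse_unique:
  fixes \<phi> X Y :: "'k::field qsym \<Rightarrow> 'k qsym"
  assumes "\<phi> 1 = 1" "0 \<notin> set p"
    and eq: "\<And>p. 0 \<notin> set p \<Longrightarrow> (\<Sum>i\<le>length p. \<phi> (qM (take i p)) * X (qM (drop i p)))
      = (\<Sum>i\<le>length p. \<phi> (qM (take i p)) * Y (qM (drop i p)))"
  shows "X (qM p) = Y (qM p)"
  using assms(2)
proof (induction p rule: length_induct)
  case (1 p)
  have IH: "X (qM (drop (Suc i) p)) = Y (qM (drop (Suc i) p))" if "i < length p" for i
  proof -
    have "0 \<notin> set (drop (Suc i) p)" using 1(2) in_set_dropD by metis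
    then show ?thesis using 1(1) that by simp
  qed
  have split: "(\<Sum>i\<le>length p. \<phi> (qM (take i p)) * Z (qM (drop i p)))
      = Z (qM p) + (\<Sum>i<length p. \<phi> (qM (take (Suc i) p)) * Z (qM (drop (Suc i) p)))" for Z
    unfolding lessThan_Suc_atMost[symmetric] sum.lessThan_Suc_shift
    by (simp add: qM_Nil assms(1))
  have "(\<Sum>i<length p. \<phi> (qM (take (Suc i) p)) * X (qM (drop (Suc i) p)))
      = (\<Sum>i<length p. \<phi> (qM (take (Suc i) p)) * Y (qM (drop (Suc i) p)))"
    by (intro sum.cong refl) (simp add: IH)
  then show ?case using eq[OF 1(2)] by (simp add: split)
qed

text \<open>Both \<open>\<phi> \<circ> S\<close> and \<open>S \<circ> \<phi>\<close> are right convolution inverses of \<open>\<phi>\<close>: apply \<open>\<phi>\<close> to the equation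
  \<open>id * S = \<eta> \<epsilon>\<close>, using that \<open>\<phi>\<close> is multiplicative, or precompose that equation with \<open>\<phi>\<close>, using
  that \<open>\<phi>\<close> respects the coproduct.\<close>

lemma bialgebra_endomorphism_antipode:
  assumes lin: "Vector_Spaces.linear qscale qscale \<phi>"
    and one: "\<phi> 1 = 1" and mult: "\<And>f g. \<phi> (f * g) = \<phi> f * \<phi> g"
    and counit: "\<And>f. qcounit (\<phi> f) = qcounit f"
    and coprod: "\<And>f. qcoprod (\<phi> f) = qtensor_map \<phi> \<phi> (qcoprod f)"
    and S: "qsym_antipode S"
  shows "\<phi> (S f) = S (\<phi> f)"
proof -
  interpret \<phi>: Vector_Spaces.linear qscale qscale \<phi> by fact
  have linS: "Vector_Spaces.linear qscale qscale S"
    and anti: "qmult (qtensor_map id S (qcoprod f)) = qscale (qcounit f) 1" for f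
    using S by (auto simp: qsym_antipode_def)
  have 1: "(\<Sum>i\<le>length p. \<phi> (qM (take i p)) * \<phi> (S (qM (drop i p)))) = qscale (qcounit (qM p)) 1"
    if "0 \<notin> set p" for p
  proof -
    have "(\<Sum>i\<le>length p. \<phi> (qM (take i p)) * \<phi> (S (qM (drop i p))))
        = \<phi> (qmult (qtensor_map id S (qcoprod (qM p))))"
      by (simp add: qmult_qtensor_map_qcoprod_qM[OF that] \<phi>.sum mult)
    then show ?thesis by (simp add: anti \<phi>.scale one)
  qed
  have 2: "(\<Sum>i\<le>length p. \<phi> (qM (take i p)) * S (\<phi> (qM (drop i p)))) = qscale (qcounit (qM p)) 1"
    if "0 \<notin> set p" for p
  proof -
    have "(\<Sum>i\<le>length p. \<phi> (qM (take i p)) * S (\<phi> (qM (drop i p))))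
        = qmult (qtensor_map id S (qtensor_map \<phi> \<phi> (qcoprod (qM p))))"
      by (simp add: qtensor_map_qcoprod_qM[OF that] qtensor_map.sum qmult.sum qmult_qtensor_map_id[OF linS])
    then show ?thesis by (simp add: coprod[symmetric] anti counit)
  qed
  show ?thesis
  proof (rule linear_eq_on_qM[of qscale "\<lambda>f. \<phi> (S f)" "\<lambda>f. S (\<phi> f)"])
    show "Vector_Spaces.linear qscale qscale (\<lambda>f. \<phi> (S f))" "Vector_Spaces.linear qscale qscale (\<lambda>f. S (\<phi> f))"
      using Vector_Spaces.linear_compose[OF linS lin] Vector_Spaces.linear_compose[OF lin linS]
      by (simp_all add: o_def)
    show "\<phi> (S (qM p)) = S (\<phi> (qM p))" if "0 \<notin> set p" for p
      using right_convolution_inverse_unique[of \<phi> p "\<lambda>f. \<phi> (S f)" "\<lambda>f. S (\<phi> f)"] that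
      by (simp add: one 1 2)
  qed
qed

theorem theorem12p6:
  fixes G :: "'k::field ab_poly \<Rightarrow> 'k"
  assumes "ab_character G"
  shows "qsym_hopf_endomorphism (qsym_chain_map2 G)"
proof -
  let ?\<phi> = "qsym_chain_map2 G" and ?h = "qchar G"
  have "Vector_Spaces.linear pm_scale (*) G" using assms by (simp add: ab_character_def)
  note coef = qc_qsym_chain_map2[OF this]
  have lin: "Vector_Spaces.linear qscale qscale ?\<phi>"
  proof unfold_locales
    fix f g :: "'k qsym" and c :: 'k
    have "qc (f + g) = (\<lambda>w. qc f w + qc g w)" "qc (qscale c f) = (\<lambda>w. c * qc f w)"
      by (simp_all add: fun_eq_iff)
    then show "?\<phi> (f + g) = ?\<phi> f + ?\<phi> g" "?\<phi> (qscale c f) = qscale c (?\<phi> f)"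
      by (auto intro!: qsym_eqI_qc simp: coef block_coef_add block_coef_scale)
  qed
  have one: "?\<phi> 1 = 1"
    by (rule qsym_eqI_qc) (simp add: coef block_coef_one)
  have mult: "?\<phi> (f * g) = ?\<phi> f * ?\<phi> g" for f g
  proof (rule qsym_eqI_qc)
    fix e :: "nat list" assume e: "0 \<notin> set e"
    \<comment> \<open>This is the step in which the multiplicativity of \<open>G\<close> enters.\<close>
    have "qc (?\<phi> (f * g)) e = block_coef ?h e (split_prod (qc f) (qc g))"
      unfolding coef by (rule block_coef_cong) (rule qc_mult)
    also have "\<dots> = split_prod (qc (?\<phi> f)) (qc (?\<phi> g)) e"
      using block_coef_split_prod[OF homog_mult_qchar[OF assms] zero_insensitive_qc zero_insensitive_qc]
      by (simp add: split_prod_def coef)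
    finally show "qc (?\<phi> (f * g)) e = qc (?\<phi> f * ?\<phi> g) e" by (simp only: qc_mult[OF e])
  qed
  have counit: "qcounit (?\<phi> f) = qcounit f" for f
    by (simp add: qcounit_eq_qc coef)
  have coprod: "qcoprod (?\<phi> f) = qtensor_map ?\<phi> ?\<phi> (qcoprod f)" for f
  proof (rule linear_eq_on_qM[of pm_scale "\<lambda>f. qcoprod (?\<phi> f)"
        "\<lambda>f. qtensor_map ?\<phi> ?\<phi> (qcoprod f)"])
    show "Vector_Spaces.linear qscale pm_scale (\<lambda>f. qcoprod (?\<phi> f))"
      "Vector_Spaces.linear qscale pm_scale (\<lambda>f. qtensor_map ?\<phi> ?\<phi> (qcoprod f))"
      using Vector_Spaces.linear_compose[OF lin linear_qcoprod]
        Vector_Spaces.linear_compose[OF linear_qcoprod linear_qtensor_map]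
      by (simp_all add: o_def)
    fix p :: "nat list" assume p: "0 \<notin> set p"
    show "qcoprod (?\<phi> (qM p)) = qtensor_map ?\<phi> ?\<phi> (qcoprod (qM p))"
    proof (rule poly_mapping_eqI)
      fix z :: "nat list \<times> nat list"
      obtain x y where z: "z = (x, y)" by (cases z)
      show "Poly_Mapping.lookup (qcoprod (?\<phi> (qM p))) z
          = Poly_Mapping.lookup (qtensor_map ?\<phi> ?\<phi> (qcoprod (qM p))) z"
      proof (cases "0 \<in> set x \<or> 0 \<in> set y")
        case True
        then show ?thesis
          by (auto simp: z lookup_qcoprod_zero qtensor_map_qcoprod_qM[OF p] lookup_sum lookup_qtensor
              lookup_qcoords intro!: sum.neutral[symmetric])
      next
        case False
        then show ?thesis
          by (simp add: z lookup_qcoprod qtensor_map_qcoprod_qM[OF p] lookup_sum lookup_qtensor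
              lookup_qcoords coef block_coef_qM_append)
      qed
    qed
  qed
  show ?thesis
    unfolding qsym_hopf_endomorphism_def
    using lin one mult counit coprod bialgebra_endomorphism_antipode[OF lin one mult counit coprod]
    by blast
qed

end
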